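(* Let $R$ be a complex finite dimensional associative (generally noncommutative) algebra, $\Omega_1,\Omega_2\subseteq\mathbb{C}$ domains, and $\Psi\colon \Omega_1\times\Omega_2\to R$ a nonsplit $R$-valued bispectral function, with associated algebras $B_1,B_2,K_1,K_2,A_1,A_2$ and isomorphism $b\colon B_1\to B_2$ (defined in the context). Then for every factorization $$L(x,\partial_x)=Q(x,\partial_x)\,g(x)^{-1}P(x,\partial_x)$$ with $L(x,\partial_x)\in A_1$, $P(x,\partial_x),Q(x,\partial_x)\in B_1$, and a regular element $g(x)\in K_1$, the $R$-valued function $$\Phi(x,z):=P(x,\partial_x)\Psi(x,z)\colon\Omega_1\times\Omega_2\to R$$ is bispectral, and, more precisely, satisfies $$\left(P(x,\partial_x)Q(x,\partial_x)g(x)^{-1}\right)\Phi(x,z)=\Phi(x,z)\,b(L)(z),$$ $$g(x)\Phi(x,z)=\Phi(x,z)\left(b(L)(z)^{-1}\,b(Q)(z,\partial_z)\,b(P)(z,\partial_z)\right).$$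
   Context: Right action: for an $R$-valued analytic function $\Psi(x,z)$ and an $R$-valued differential operator in $z$, set $\Psi(x,z)\cdot(a(z)\partial_z^k):=(-1)^k\partial_z^k(\Psi(x,z)a(z))$, extended linearly. Differential operators in $x$ act on the left in the usual way. Bispectral: an $R$-valued analytic function $\Psi$ on $\Omega_1\times\Omega_2$ is ($R$-valued, noncommutative) bispectral if there exist $R$-valued analytic differential operators $L(x,\partial_x)$ on $\Omega_1$ and $\Lambda(z,\partial_z)$ on $\Omega_2$ and $R$-valued analytic functions $\theta\colon\Omega_1\to R$, $f\colon\Omega_2\to R$ with $L(x,\partial_x)\Psi(x,z)=\Psi(x,z)f(z)$ and $\theta(x)\Psi(x,z)=\Psi(x,z)\Lambda(z,\partial_z)$. Nonsplit: there are no nonzero analytic differential operators $L(x,\partial_x)$ and $\Lambda(z,\partial_z)$ that satisfy one of these two equations with $f\equiv0$ (i.e. $L(x,\partial_x)\Psi(x,z)=0$) or $\theta\equiv0$ (i.e. $\Psi(x,z)\Lambda(z,\partial_z)=0$), respectively. $B_1$: the algebra of all $R$-valued analytic differential operators $P(x,\partial_x)$ on $\Omega_1$ for which there is an $R$-valued analytic differential operator $S(z,\partial_z)$ on $\Omega_2$ with $P(x,\partial_x)\Psi(x,z)=\Psi(x,z)S(z,\partial_z)$. $B_2$: the algebra of all such operators $S(z,\partial_z)$. By nonsplitness $b(P):=S$ is a well defined algebra isomorphism $b\colon B_1\to B_2$. $K_i\subseteq B_i$ is the subalgebra of differential operators of order $0$, i.e. $R$-valued analytic functions in $B_i$; $A_1:=b^{-1}(K_2)$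 and $A_2:=b(K_1)$. A regular element of an algebra is one that is not a left or right zero divisor. *)

theory Defs
  imports "HOL-Complex_Analysis.Complex_Analysis"
begin

section \<open>Finite dimensional complex algebras\<close>

class complex_algebra_1 = ring_1 +
  fixes scaleC :: "complex \<Rightarrow> 'a \<Rightarrow> 'a"
  assumes scaleC_add_right: "scaleC c (a + b) = scaleC c a + scaleC c b"
    and scaleC_add_left: "scaleC (c + d) a = scaleC c a + scaleC d a"
    and scaleC_scaleC: "scaleC c (scaleC d a) = scaleC (c * d) a"
    and scaleC_one: "scaleC 1 a = a"
    and scaleC_mult_left: "scaleC c a * b = scaleC c (a * b)"
    and scaleC_mult_right: "a * scaleC c b = scaleC c (a * b)"

text \<open>Finite dimensionality: the only linear subspace containing some finite set \<open>B\<close> is the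
  whole algebra, i.e. \<open>B\<close> spans it.\<close>

class fin_dim_complex_algebra = complex_algebra_1 +
  assumes finite_spanning_set:
    "\<exists>B. finite B \<and> (\<forall>V. B \<subseteq> V \<and> 0 \<in> V \<and> (\<forall>a\<in>V. \<forall>b\<in>V. a + b \<in> V) \<and>
       (\<forall>c. \<forall>a\<in>V. scaleC c a \<in> V) \<longrightarrow> V = UNIV)"

definition invertible_elt :: "'r::ring_1 \<Rightarrow> bool" where
  "invertible_elt a \<longleftrightarrow> (\<exists>b. a * b = 1 \<and> b * a = 1)"

definition inverse_elt :: "'r::ring_1 \<Rightarrow> 'r" where
  "inverse_elt a = (THE b. a * b = 1 \<and> b * a = 1)"

section \<open>Analytic functions with values in a finite dimensional algebra\<close>

definition functional :: "('r::fin_dim_complex_algebra \<Rightarrow> complex) \<Rightarrow> bool" where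
  "functional \<phi> \<longleftrightarrow> Vector_Spaces.linear scaleC (*) \<phi>"

text \<open>No norm is chosen on the algebra: since it is finite dimensional, analyticity and
  derivatives are tested against all complex linear functionals, i.e. coordinatewise.\<close>

definition Rderiv :: "(complex \<Rightarrow> 'r::fin_dim_complex_algebra) \<Rightarrow> complex \<Rightarrow> 'r" where
  "Rderiv f x = (THE v. \<forall>\<phi>. functional \<phi> \<longrightarrow>
     ((\<lambda>t. \<phi> (f t)) has_field_derivative \<phi> v) (at x))"

text \<open>An analytic function on \<open>\<Omega>\<close> is represented by its extension by zero, so that equality of
  functions (and of the differential operators below) on \<open>\<Omega>\<close> is equality in HOL.\<close>

definition Ranalytic :: "complex set \<Rightarrow> (complex \<Rightarrow> 'r::fin_dim_complex_algebra) \<Rightarrow> bool" where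
  "Ranalytic \<Omega> f \<longleftrightarrow>
     (\<forall>\<phi>. functional \<phi> \<longrightarrow> (\<lambda>t. \<phi> (f t)) analytic_on \<Omega>) \<and> (\<forall>t. t \<notin> \<Omega> \<longrightarrow> f t = 0)"

text \<open>Analyticity in two variables is joint complex differentiability on the open set
  \<open>\<Omega>\<^sub>1 \<times> \<Omega>\<^sub>2\<close>; the values of \<open>\<Psi>\<close> outside this set are irrelevant.\<close>

definition Ranalytic2 ::
    "complex set \<Rightarrow> complex set \<Rightarrow> (complex \<Rightarrow> complex \<Rightarrow> 'r::fin_dim_complex_algebra) \<Rightarrow> bool" where
  "Ranalytic2 \<Omega>\<^sub>1 \<Omega>\<^sub>2 \<Psi> \<longleftrightarrow>
     (\<forall>\<phi>. functional \<phi> \<longrightarrow> (\<forall>x\<in>\<Omega>\<^sub>1. \<forall>z\<in>\<Omega>\<^sub>2. \<exists>a b.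
        ((\<lambda>p. \<phi> (\<Psi> (fst p) (snd p))) has_derivative (\<lambda>h. a * fst h + b * snd h)) (at (x, z))))"

definition domain_set :: "complex set \<Rightarrow> bool" where
  "domain_set \<Omega> \<longleftrightarrow> open \<Omega> \<and> connected \<Omega> \<and> \<Omega> \<noteq> {}"

section \<open>Differential operators\<close>

text \<open>The operator \<open>\<Sum>\<^sub>k A\<^sub>k(x) \<partial>\<^sup>k\<close> is represented by its coefficient sequence \<open>A\<close>.\<close>

type_synonym 'r dop = "nat \<Rightarrow> complex \<Rightarrow> 'r"

definition dop_supp :: "'r::fin_dim_complex_algebra dop \<Rightarrow> nat set" where
  "dop_supp A = {k. \<exists>x. A k x \<noteq> 0}"

definition dop_zero :: "'r::fin_dim_complex_algebra dop" where
  "dop_zero = (\<lambda>k x. 0)"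

definition analytic_dop :: "complex set \<Rightarrow> 'r::fin_dim_complex_algebra dop \<Rightarrow> bool" where
  "analytic_dop \<Omega> A \<longleftrightarrow> finite (dop_supp A) \<and> (\<forall>k. Ranalytic \<Omega> (A k))"

definition fun_dop :: "(complex \<Rightarrow> 'r) \<Rightarrow> 'r::fin_dim_complex_algebra dop" where
  "fun_dop f = (\<lambda>k. if k = 0 then f else (\<lambda>_. 0))"

definition fun_restrict ::
    "complex set \<Rightarrow> (complex \<Rightarrow> 'r) \<Rightarrow> complex \<Rightarrow> 'r::fin_dim_complex_algebra" where
  "fun_restrict U f = (\<lambda>x. if x \<in> U then f x else 0)"

definition dop_restrict :: "complex set \<Rightarrow> 'r dop \<Rightarrow> 'r::fin_dim_complex_algebra dop" where
  "dop_restrict U A = (\<lambda>k. fun_restrict U (A k))"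

text \<open>The composition \<open>A \<circ> B\<close> as operators on \<open>U\<close>, by the Leibniz rule
  \<open>(a \<partial>\<^sup>j)(b \<partial>\<^sup>k) = \<Sum>\<^sub>i (j choose i) a b\<^sup>(\<^sup>i\<^sup>) \<partial>\<^sup>k\<^sup>+\<^sup>j\<^sup>-\<^sup>i\<close>.\<close>

definition dop_mult ::
    "complex set \<Rightarrow> 'r dop \<Rightarrow> 'r dop \<Rightarrow> 'r::fin_dim_complex_algebra dop" where
  "dop_mult U A B = (\<lambda>m x. if x \<in> U
     then \<Sum>j\<in>dop_supp A. \<Sum>i | i \<le> j \<and> j \<le> m + i.
            of_nat (j choose i) * A j x * (Rderiv ^^ i) (B (m + i - j)) x
     else 0)"

definition left_action ::
    "'r::fin_dim_complex_algebra dop \<Rightarrow> (complex \<Rightarrow> 'r) \<Rightarrow> complex \<Rightarrow> 'r" where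
  "left_action A f x = (\<Sum>k\<in>dop_supp A. A k x * (Rderiv ^^ k) f x)"

definition right_action ::
    "(complex \<Rightarrow> 'r) \<Rightarrow> 'r::fin_dim_complex_algebra dop \<Rightarrow> complex \<Rightarrow> 'r" where
  "right_action f A z = (\<Sum>k\<in>dop_supp A. (-1) ^ k * (Rderiv ^^ k) (\<lambda>t. f t * A k t) z)"

definition dop_x ::
    "'r::fin_dim_complex_algebra dop \<Rightarrow> (complex \<Rightarrow> complex \<Rightarrow> 'r) \<Rightarrow> complex \<Rightarrow> complex \<Rightarrow> 'r" where
  "dop_x L \<Psi> x z = left_action L (\<lambda>t. \<Psi> t z) x"

definition dop_z ::
    "(complex \<Rightarrow> complex \<Rightarrow> 'r) \<Rightarrow> 'r::fin_dim_complex_algebra dop \<Rightarrow> complex \<Rightarrow> complex \<Rightarrow> 'r" where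
  "dop_z \<Psi> \<Lambda> x z = right_action (\<Psi> x) \<Lambda> z"

section \<open>Bispectral functions and the associated algebras\<close>

definition bispectral_by ::
    "complex set \<Rightarrow> complex set \<Rightarrow> (complex \<Rightarrow> complex \<Rightarrow> 'r::fin_dim_complex_algebra) \<Rightarrow>
     'r dop \<Rightarrow> (complex \<Rightarrow> 'r) \<Rightarrow> (complex \<Rightarrow> 'r) \<Rightarrow> 'r dop \<Rightarrow> bool" where
  "bispectral_by \<Omega>\<^sub>1 \<Omega>\<^sub>2 \<Psi> L f \<theta> \<Lambda> \<longleftrightarrow> Ranalytic2 \<Omega>\<^sub>1 \<Omega>\<^sub>2 \<Psi> \<and>
     analytic_dop \<Omega>\<^sub>1 L \<and> analytic_dop \<Omega>\<^sub>2 \<Lambda> \<and> Ranalytic \<Omega>\<^sub>1 \<theta> \<and> Ranalytic \<Omega>\<^sub>2 f \<and>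
     (\<forall>x\<in>\<Omega>\<^sub>1. \<forall>z\<in>\<Omega>\<^sub>2. dop_x L \<Psi> x z = \<Psi> x z * f z) \<and>
     (\<forall>x\<in>\<Omega>\<^sub>1. \<forall>z\<in>\<Omega>\<^sub>2. \<theta> x * \<Psi> x z = dop_z \<Psi> \<Lambda> x z)"

definition bispectral ::
    "complex set \<Rightarrow> complex set \<Rightarrow> (complex \<Rightarrow> complex \<Rightarrow> 'r::fin_dim_complex_algebra) \<Rightarrow> bool" where
  "bispectral \<Omega>\<^sub>1 \<Omega>\<^sub>2 \<Psi> \<longleftrightarrow> (\<exists>L f \<theta> \<Lambda>. bispectral_by \<Omega>\<^sub>1 \<Omega>\<^sub>2 \<Psi> L f \<theta> \<Lambda>)"

definition nonsplit ::
    "complex set \<Rightarrow> complex set \<Rightarrow> (complex \<Rightarrow> complex \<Rightarrow> 'r::fin_dim_complex_algebra) \<Rightarrow> bool" where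
  "nonsplit \<Omega>\<^sub>1 \<Omega>\<^sub>2 \<Psi> \<longleftrightarrow>
     \<not> (\<exists>L. analytic_dop \<Omega>\<^sub>1 L \<and> L \<noteq> dop_zero \<and> (\<forall>x\<in>\<Omega>\<^sub>1. \<forall>z\<in>\<Omega>\<^sub>2. dop_x L \<Psi> x z = 0)) \<and>
     \<not> (\<exists>\<Lambda>. analytic_dop \<Omega>\<^sub>2 \<Lambda> \<and> \<Lambda> \<noteq> dop_zero \<and> (\<forall>x\<in>\<Omega>\<^sub>1. \<forall>z\<in>\<Omega>\<^sub>2. dop_z \<Psi> \<Lambda> x z = 0))"

definition intertwined ::
    "complex set \<Rightarrow> complex set \<Rightarrow> (complex \<Rightarrow> complex \<Rightarrow> 'r::fin_dim_complex_algebra) \<Rightarrow>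
     'r dop \<Rightarrow> 'r dop \<Rightarrow> bool" where
  "intertwined \<Omega>\<^sub>1 \<Omega>\<^sub>2 \<Psi> P S \<longleftrightarrow> analytic_dop \<Omega>\<^sub>1 P \<and> analytic_dop \<Omega>\<^sub>2 S \<and>
     (\<forall>x\<in>\<Omega>\<^sub>1. \<forall>z\<in>\<Omega>\<^sub>2. dop_x P \<Psi> x z = dop_z \<Psi> S x z)"

definition alg_B1 where
  "alg_B1 \<Omega>\<^sub>1 \<Omega>\<^sub>2 \<Psi> = {P. \<exists>S. intertwined \<Omega>\<^sub>1 \<Omega>\<^sub>2 \<Psi> P S}"

definition alg_B2 where
  "alg_B2 \<Omega>\<^sub>1 \<Omega>\<^sub>2 \<Psi> = {S. \<exists>P. intertwined \<Omega>\<^sub>1 \<Omega>\<^sub>2 \<Psi> P S}"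

text \<open>For nonsplit \<open>\<Psi>\<close> the operator \<open>S\<close> is uniquely determined by \<open>P \<in> B\<^sub>1\<close>.\<close>

definition b_map where
  "b_map \<Omega>\<^sub>1 \<Omega>\<^sub>2 \<Psi> P = (THE S. intertwined \<Omega>\<^sub>1 \<Omega>\<^sub>2 \<Psi> P S)"

definition alg_K1 where
  "alg_K1 \<Omega>\<^sub>1 \<Omega>\<^sub>2 \<Psi> = alg_B1 \<Omega>\<^sub>1 \<Omega>\<^sub>2 \<Psi> \<inter> range fun_dop"

definition alg_K2 where
  "alg_K2 \<Omega>\<^sub>1 \<Omega>\<^sub>2 \<Psi> = alg_B2 \<Omega>\<^sub>1 \<Omega>\<^sub>2 \<Psi> \<inter> range fun_dop"

definition alg_A1 where
  "alg_A1 \<Omega>\<^sub>1 \<Omega>\<^sub>2 \<Psi> = {P \<in> alg_B1 \<Omega>\<^sub>1 \<Omega>\<^sub>2 \<Psi>. b_map \<Omega>\<^sub>1 \<Omega>\<^sub>2 \<Psi> P \<in> alg_K2 \<Omega>\<^sub>1 \<Omega>\<^sub>2 \<Psi>}"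

text \<open>Regularity within an algebra \<open>\<A>\<close> of differential operators on \<open>\<Omega>\<close>.\<close>

definition regular_in ::
    "complex set \<Rightarrow> 'r dop set \<Rightarrow> 'r::fin_dim_complex_algebra dop \<Rightarrow> bool" where
  "regular_in \<Omega> \<A> G \<longleftrightarrow> G \<in> \<A> \<and>
     (\<forall>A\<in>\<A>. A \<noteq> dop_zero \<longrightarrow> dop_mult \<Omega> G A \<noteq> dop_zero \<and> dop_mult \<Omega> A G \<noteq> dop_zero)"

section \<open>Inverses of functions\<close>

text \<open>The inverse of an algebra valued analytic function \<open>f\<close> on a domain \<open>\<Omega>\<close> is an analytic
  function on the open subset \<open>inv_locus \<Omega> f\<close>. Invertibility of \<open>f t\<close> means nonvanishing of the
  determinant of left multiplication by \<open>f t\<close>, so this subset is either empty or the complement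
  in \<open>\<Omega>\<close> of a discrete set of poles of \<open>f\<^sup>-\<^sup>1\<close>. Expressions containing \<open>f\<^sup>-\<^sup>1\<close> are operators on it.\<close>

definition inv_locus :: "complex set \<Rightarrow> (complex \<Rightarrow> 'r::fin_dim_complex_algebra) \<Rightarrow> complex set" where
  "inv_locus \<Omega> f = {t \<in> \<Omega>. invertible_elt (f t)}"

definition inv_fun ::
    "complex set \<Rightarrow> (complex \<Rightarrow> 'r) \<Rightarrow> complex \<Rightarrow> 'r::fin_dim_complex_algebra" where
  "inv_fun \<Omega> f = (\<lambda>t. if t \<in> inv_locus \<Omega> f then inverse_elt (f t) else 0)"

end

theory Submission
  imports Defs
begin

text \<open>The first equation is immediate: \<open>P Q g\<^sup>-\<^sup>1 P \<Psi> = P L \<Psi> = P \<Psi> b(L)\<close>. The second one amounts to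
  \<open>b(g) = b(P) h\<^sup>-\<^sup>1 b(Q)\<close> with \<open>h = b(L)\<close>. Formally \<open>L = Q g\<^sup>-\<^sup>1 P\<close> gives \<open>(Q g\<^sup>-\<^sup>1) (P L\<^sup>-\<^sup>1) = 1\<close>, and one
  wants the product in the other order; but neither \<open>g\<^sup>-\<^sup>1\<close> nor \<open>L\<^sup>-\<^sup>1\<close> lies in \<open>B\<^sub>1\<close>, and \<open>R\<close> may have
  zero divisors. The substitute is an Ore condition on the \<open>z\<close> side: nonsplitness makes
  composition with \<open>b(P)\<close> injective, and counting dimensions over the holomorphic functions
  yields a nonzero scalar operator \<open>d\<close> and an operator \<open>A\<close> with \<open>b(g) d = b(P) A\<close>. Letting both sides
  act on \<open>Q g\<^sup>-\<^sup>1 \<Psi>\<close> gives \<open>b(Q) d = h A\<close> by nonsplitness, whence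
  \<open>(b(g) - b(P) h\<^sup>-\<^sup>1 b(Q)) d = 0\<close>, and \<open>d\<close> can be cancelled by comparing leading coefficients.\<close>

section \<open>Holomorphic functions of two variables\<close>

text \<open>Injectivity of composition with \<open>b(P)\<close> comes from the function
  \<open>N = Q g\<^sup>-\<^sup>1 \<Psi>\<close>. Since left and right actions commute,
  \<open>b(P)\<close> acting on \<open>N\<close> gives \<open>\<Psi> h\<close>, and
  \<open>b(g)\<close> acting on \<open>N\<close> gives the same as \<open>b(Q)\<close> acting on
  \<open>\<Psi>\<close>. Hence \<open>b(P) A = 0\<close> forces \<open>h A = 0\<close>, and then
  \<open>A = 0\<close> where \<open>h\<close> is invertible. The obstacle is that nonsplitness
  speaks only of operators analytic on all of \<open>\<Omega>\<^sub>2\<close>, whereas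
  \<open>b(P) h\<^sup>-\<^sup>1 b(Q)\<close> exists only where \<open>h\<close> is invertible. So
  nonsplitness is used for identities free of \<open>h\<^sup>-\<^sup>1\<close>, and the last step is
  an identity of operators, tested on arbitrary analytic functions, in which a right factor is
  cancelled. That factor has to be scalar: on a connected open set a nonzero scalar holomorphic
  function times a nonzero algebra-valued one is nonzero, which fails for two algebra-valued
  ones.\<close>

definition hol2 :: "complex set \<Rightarrow> complex set \<Rightarrow> (complex \<Rightarrow> complex \<Rightarrow> complex) \<Rightarrow> bool" where
  "hol2 U V F \<longleftrightarrow> continuous_on (U \<times> V) (\<lambda>(x, z). F x z) \<and>
     (\<forall>z\<in>V. (\<lambda>x. F x z) holomorphic_on U) \<and> (\<forall>x\<in>U. F x holomorphic_on V)"

lemma hol2_swap: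
  assumes "hol2 U V F"
  shows "hol2 V U (\<lambda>z x. F x z)"
proof -
  have "continuous_on (V \<times> U) ((\<lambda>(x, z). F x z) \<circ> prod.swap)"
    by (rule continuous_on_compose[OF continuous_on_swap])
       (use assms in \<open>simp add: hol2_def product_swap\<close>)
  then show ?thesis
    using assms by (simp add: hol2_def o_def case_prod_unfold)
qed

lemma hol2_subset:
  assumes "hol2 U V F" "U' \<subseteq> U" "V' \<subseteq> V"
  shows "hol2 U' V' F"
  using assms unfolding hol2_def
  by (meson Sigma_mono continuous_on_subset holomorphic_on_subset subsetD)

text \<open>This is the Cauchy kernel for the first derivative, pulled back to the unit interval:
  the velocity \<open>2 pi i r exp(2 pi i t)\<close> of the circle cancels the factor
  \<open>1 / (2 pi i)\<close> and leaves \<open>r exp(2 pi i t)\<close>.\<close>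

definition circle_kernel :: "complex \<Rightarrow> real \<Rightarrow> complex \<Rightarrow> real \<Rightarrow> complex" where
  "circle_kernel c r x t = r * exp (2 * of_real pi * \<i> * of_real t) / (circlepath c r t - x)\<^sup>2"

text \<open>An integral over a fixed compact interval turns continuity and differentiability of the
  derivative in a parameter into statements about parameter integrals.\<close>

lemma deriv_eq_circle_integral:
  assumes "continuous_on (cball c r) f" "f holomorphic_on ball c r" "x \<in> ball c r"
  shows "deriv f x = integral (cbox 0 1) (\<lambda>t. f (circlepath c r t) * circle_kernel c r x t)"
proof -
  have "deriv f x = 1 / (2 * of_real pi * \<i>) *
      contour_integral (circlepath c r) (\<lambda>u. f u / (u - x)\<^sup>2)"
    by (rule DERIV_imp_deriv, rule Cauchy_derivative_integral_circlepath(2)) (use assms in auto)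
  also have "\<dots> = integral {0..1} (\<lambda>t. 1 / (2 * of_real pi * \<i>) *
      (f (circlepath c r t) / (circlepath c r t - x)\<^sup>2 * vector_derivative (circlepath c r) (at t)))"
    unfolding contour_integral_integral by (rule integral_mult_right[symmetric])
  also have "\<dots> = integral {0..1} (\<lambda>t. f (circlepath c r t) * circle_kernel c r x t)"
    by (rule integral_cong) (simp add: vector_derivative_circlepath circle_kernel_def field_simps)
  finally show ?thesis by simp
qed

lemma circlepath_ne_inside:
  assumes "x \<in> ball c r" shows "circlepath c r t \<noteq> x"
proof
  assume "circlepath c r t = x"
  moreover have "dist c (circlepath c r t) = \<bar>r\<bar>"
    by (simp add: circlepath dist_norm norm_mult)
  ultimately show False using assms by auto
qed

lemma circlepath_in_cball: "r > 0 \<Longrightarrow> circlepath c r t \<in> cball c r"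
  by (simp add: circlepath dist_norm norm_mult)

lemma continuous_on_circle_kernel:
  assumes "continuous_on S a" "continuous_on S b" "\<And>s. s \<in> S \<Longrightarrow> a s \<in> ball c r"
  shows "continuous_on S (\<lambda>s. circle_kernel c r (a s) (b s))"
  unfolding circle_kernel_def
proof (intro continuous_intros assms)
  show "continuous_on S (\<lambda>s. circlepath c r (b s))"
    unfolding circlepath by (intro continuous_intros assms)
  show "\<forall>s\<in>S. (circlepath c r (b s) - a s)\<^sup>2 \<noteq> 0"
    using assms(3) circlepath_ne_inside by simp
qed

lemma continuous_on_circlepath: 
  assumes "continuous_on S b"
  shows "continuous_on S (\<lambda>s. circlepath c r (b s))"
  unfolding circlepath by (intro continuous_intros assms)

lemma continuous_on_compose_pair:
  assumes "continuous_on (U \<times> V) (\<lambda>(x, z). F x z)" "continuous_on S a" "continuous_on S b"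
    "\<And>s. s \<in> S \<Longrightarrow> a s \<in> U" "\<And>s. s \<in> S \<Longrightarrow> b s \<in> V"
  shows "continuous_on S (\<lambda>s. F (a s) (b s))"
  using continuous_on_compose2[OF assms(1) continuous_on_Pair[OF assms(2,3)]] assms(4,5) by auto

lemma hol2_continuous: "hol2 U V F \<Longrightarrow> continuous_on (U \<times> V) (\<lambda>(x, z). F x z)"
  by (simp add: hol2_def)

lemma hol2_deriv_rep:
  assumes F: "hol2 U V F" and r: "r > 0" "cball c r \<subseteq> U" and x: "x \<in> ball c r" and z: "z \<in> V"
  shows "deriv (\<lambda>t. F t z) x = integral (cbox 0 1) (\<lambda>t. F (circlepath c r t) z * circle_kernel c r x t)"
proof (rule deriv_eq_circle_integral[OF _ _ x])
  have h: "(\<lambda>x. F x z) holomorphic_on U" using F z by (simp add: hol2_def)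
  show "continuous_on (cball c r) (\<lambda>t. F t z)"
    using h r by (meson holomorphic_on_imp_continuous_on continuous_on_subset)
  show "(\<lambda>t. F t z) holomorphic_on ball c r"
    using h r by (meson holomorphic_on_subset ball_subset_cball order_trans)
qed

text \<open>Near a given point the derivative is a Cauchy integral over one fixed circle, with an
  integrand jointly continuous in the point, the parameter and the curve variable.\<close>

lemma hol2_deriv_continuous:
  assumes U: "open U" and V: "open V" and F: "hol2 U V F"
  shows "continuous_on (U \<times> V) (\<lambda>(x, z). deriv (\<lambda>t. F t z) x)"
proof (rule continuous_at_imp_continuous_on, clarify)
  fix x0 z0 assume x0: "x0 \<in> U" and z0: "z0 \<in> V"
  obtain r where r: "r > 0" "cball x0 r \<subseteq> U" using U x0 open_contains_cball by blast
  let ?f = "\<lambda>(x, z). integral (cbox 0 1) (\<lambda>t. F (circlepath x0 r t) z * circle_kernel x0 r x t)"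
  have "continuous_on (ball x0 r \<times> V) (\<lambda>p. integral (cbox 0 1)
      (\<lambda>t. F (circlepath x0 r t) (snd p) * circle_kernel x0 r (fst p) t))"
    using circlepath_in_cball[OF r(1)] r(2)
    by (intro integral_continuous_on_param, unfold case_prod_unfold)
       (intro continuous_on_mult continuous_on_circle_kernel
         continuous_on_compose_pair[OF hol2_continuous[OF F]] continuous_on_circlepath
         continuous_on_fst continuous_on_snd continuous_on_id; auto)
  then have "continuous_on (ball x0 r \<times> V) ?f" by (simp add: case_prod_unfold)
  then have "continuous_on (ball x0 r \<times> V) (\<lambda>(x, z). deriv (\<lambda>t. F t z) x)"
    by (rule continuous_on_eq) (auto simp: hol2_deriv_rep[OF F r])
  then show "isCont (\<lambda>(x, z). deriv (\<lambda>t. F t z) x) (x0, z0)"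
    using V x0 z0 r by (simp add: continuous_on_eq_continuous_at open_Times)
qed

text \<open>Differentiation under the Cauchy integral. The circle is part of the conclusion because
  the resulting integral over it is later recognised as a mixed derivative.\<close>

lemma hol2_deriv_snd_deriv:
  assumes U: "open U" and V: "open V" and F: "hol2 U V F" and x: "x \<in> U" and z: "z \<in> V"
  obtains c r where "r > 0" "cball c r \<subseteq> U" "x \<in> ball c r"
   "((\<lambda>z. deriv (\<lambda>t. F t z) x) has_field_derivative
      integral (cbox 0 1) (\<lambda>t. deriv (F (circlepath c r t)) z * circle_kernel c r x t)) (at z)"
proof -
  obtain r where r: "r > 0" "cball x r \<subseteq> U" using U x open_contains_cball by blast
  obtain s where s: "s > 0" "ball z s \<subseteq> V" using V z open_contains_ball by blast
  note cp = circlepath_in_cball[OF r(1)]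
  have x': "x \<in> ball x r" using r by simp
  have Fz: "continuous_on (U \<times> V) (\<lambda>(x, z). deriv (F x) z)"
    using hol2_swap[OF F] hol2_deriv_continuous[OF V U hol2_swap[OF F]]
      continuous_on_compose[OF continuous_on_swap, of "U \<times> V" "\<lambda>(x, z). deriv (\<lambda>t. F z t) x"]
    by (simp add: product_swap o_def case_prod_unfold)
  have D: "((\<lambda>z. F w z) has_field_derivative deriv (F w) z') (at z')" if "w \<in> U" "z' \<in> V" for w z'
    using F that V by (auto simp: hol2_def intro: holomorphic_derivI)
  have "((\<lambda>z. integral (cbox 0 1) (\<lambda>t. F (circlepath x r t) z * circle_kernel x r x t)) has_field_derivative
      integral (cbox 0 1) (\<lambda>t. deriv (F (circlepath x r t)) z * circle_kernel x r x t)) (at z within ball z s)"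
  proof (rule leibniz_rule_field_derivative)
    show "((\<lambda>z. F (circlepath x r t) z * circle_kernel x r x t) has_field_derivative
        deriv (F (circlepath x r t)) z' * circle_kernel x r x t) (at z' within ball z s)" if "z' \<in> ball z s" for z' t
      using that s r cp by (intro DERIV_cmult_right has_field_derivative_at_within[OF D]) auto
    show "(\<lambda>t. F (circlepath x r t) z' * circle_kernel x r x t) integrable_on cbox 0 1" if "z' \<in> ball z s" for z'
      using that s r cp x'
      by (intro integrable_continuous continuous_on_mult continuous_on_circle_kernel
         continuous_on_compose_pair[OF hol2_continuous[OF F]] continuous_on_circlepath
         continuous_on_const continuous_on_id) auto
    have "continuous_on (ball z s \<times> cbox 0 1) (\<lambda>p. deriv (F (circlepath x r (snd p))) (fst p))"
      using s r cp
      by (intro continuous_on_compose_pair[OF Fz] continuous_on_circlepath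
         continuous_on_fst continuous_on_snd continuous_on_id) auto
    then show "continuous_on (ball z s \<times> cbox 0 1)
       (\<lambda>(z, t). deriv (F (circlepath x r t)) z * circle_kernel x r x t)"
      unfolding case_prod_unfold using x'
      by (intro continuous_intros continuous_on_circle_kernel)
  qed (use s in auto)
  then have "((\<lambda>z. integral (cbox 0 1) (\<lambda>t. F (circlepath x r t) z * circle_kernel x r x t)) has_field_derivative
      integral (cbox 0 1) (\<lambda>t. deriv (F (circlepath x r t)) z * circle_kernel x r x t)) (at z)"
    using s by (simp add: at_within_open[of z "ball z s"])
  then have "((\<lambda>z. deriv (\<lambda>t. F t z) x) has_field_derivative
      integral (cbox 0 1) (\<lambda>t. deriv (F (circlepath x r t)) z * circle_kernel x r x t)) (at z)"
    by (rule has_field_derivative_transform_within_open[OF _ open_ball[of z s]])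
      (use s hol2_deriv_rep[OF F r x'] in \<open>auto simp del: cbox_interval\<close>)
  then show thesis using that r x' by blast
qed

lemma hol2_deriv_fst:
  assumes U: "open U" and V: "open V" and F: "hol2 U V F"
  shows "hol2 U V (\<lambda>x z. deriv (\<lambda>t. F t z) x)"
proof -
  have "(\<lambda>x. deriv (\<lambda>t. F t z) x) holomorphic_on U" if "z \<in> V" for z
    using F U that by (auto simp: hol2_def intro: holomorphic_deriv)
  moreover have "(\<lambda>z. deriv (\<lambda>t. F t z) x) holomorphic_on V" if x: "x \<in> U" for x
    unfolding holomorphic_on_open[OF V]
  proof (intro ballI exI)
    fix z assume "z \<in> V"
    obtain D where "((\<lambda>z. deriv (\<lambda>t. F t z) x) has_field_derivative D) (at z)"
      using hol2_deriv_snd_deriv[OF U V F x \<open>z \<in> V\<close>] by metis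
    then show "((\<lambda>z. deriv (\<lambda>t. F t z) x) has_field_derivative
        deriv (\<lambda>z. deriv (\<lambda>t. F t z) x) z) (at z)"
      by (simp add: DERIV_imp_deriv)
  qed
  ultimately show ?thesis using hol2_deriv_continuous[OF U V F] by (simp add: hol2_def)
qed

lemma hol2_deriv_snd:
  assumes U: "open U" and V: "open V" and F: "hol2 U V F"
  shows "hol2 U V (\<lambda>x. deriv (F x))"
  using hol2_swap[OF hol2_deriv_fst[OF V U hol2_swap[OF F]]] by simp

text \<open>The integral found by differentiating under the sign is the Cauchy integral of the
  holomorphic function \<open>\<lambda>x. deriv (F x) z\<close>.\<close>

lemma hol2_deriv_commute:
  assumes U: "open U" and V: "open V" and F: "hol2 U V F" and x: "x \<in> U" and z: "z \<in> V"
  shows "deriv (\<lambda>z. deriv (\<lambda>t. F t z) x) z = deriv (\<lambda>t. deriv (F t) z) x"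
proof -
  obtain c r where "r > 0" "cball c r \<subseteq> U" "x \<in> ball c r"
   "((\<lambda>z. deriv (\<lambda>t. F t z) x) has_field_derivative
      integral (cbox 0 1) (\<lambda>t. deriv (F (circlepath c r t)) z * circle_kernel c r x t)) (at z)"
    using hol2_deriv_snd_deriv[OF assms] by blast
  then show ?thesis
    using hol2_deriv_rep[OF hol2_deriv_snd[OF U V F], of r c x z] z by (simp add: DERIV_imp_deriv)
qed

text \<open>Both partial derivatives exist and one of them is continuous, which gives total
  differentiability; the ball in the second variable supplies the convexity that the criterion asks
  for.\<close>

lemma hol2_has_derivative:
  assumes U: "open U" and V: "open V" and F: "hol2 U V F" and x: "x \<in> U" and z: "z \<in> V"
  shows "((\<lambda>p. F (fst p) (snd p)) has_derivative
     (\<lambda>h. deriv (\<lambda>t. F t z) x * fst h + deriv (F x) z * snd h)) (at (x, z))"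
proof -
  obtain s where s: "s > 0" "ball z s \<subseteq> V" using V z open_contains_ball by blast
  have "((\<lambda>(x, z). F x z) has_derivative (\<lambda>(tx, tz). deriv (\<lambda>t. F t z) x * tx +
          blinfun_apply (blinfun_mult_right (deriv (F x) z)) tz)) (at (x, z) within U \<times> ball z s)"
  proof (rule has_derivative_partialsI)
    have "(\<lambda>x. F x z) holomorphic_on U" using F z by (simp add: hol2_def)
    then show "((\<lambda>x. F x z) has_derivative (*) (deriv (\<lambda>t. F t z) x)) (at x within U)"
      unfolding has_field_derivative_def[symmetric]
      by (meson U x has_field_derivative_at_within holomorphic_derivI)
    show "(F x' has_derivative blinfun_apply (blinfun_mult_right (deriv (F x') z'))) (at z' within ball z s)"
      if "x' \<in> U" "z' \<in> ball z s" for x' z'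
    proof -
      have "F x' holomorphic_on V" using F that by (simp add: hol2_def)
      then have "(F x' has_field_derivative deriv (F x') z') (at z' within ball z s)"
        using that s by (meson V has_field_derivative_at_within holomorphic_derivI subsetD)
      then show ?thesis by (simp add: has_field_derivative_def)
    qed
    have "isCont (\<lambda>p. deriv (F (fst p)) (snd p)) (x, z)"
      using hol2_continuous[OF hol2_deriv_snd[OF U V F]] x z U V
      by (simp add: continuous_on_eq_continuous_at open_Times case_prod_unfold)
    then have "isCont (\<lambda>p. blinfun_mult_right (deriv (F (fst p)) (snd p))) (x, z)"
      by (rule bounded_linear.isCont[OF bounded_linear_blinfun_mult_right])
    then show "continuous (at (x, z) within U \<times> ball z s) (\<lambda>(x, z). blinfun_mult_right (deriv (F x) z))"
      by (simp add: case_prod_unfold continuous_at_imp_continuous_at_within)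
  qed (use s in auto)
  then show ?thesis
    using U s x z by (simp add: case_prod_unfold at_within_open[of _ "U \<times> ball z s"] open_Times)
qed

text \<open>Together with the preceding lemma this makes \<open>hol2\<close> equivalent to joint
  differentiability on open sets. Continuity with separate holomorphy is the form that passes easily
  through sums, products and parameter integrals.\<close>

lemma hol2I_has_derivative:
  assumes "\<And>x z. x \<in> U \<Longrightarrow> z \<in> V \<Longrightarrow> \<exists>a b.
        ((\<lambda>p. F (fst p) (snd p)) has_derivative (\<lambda>h. a * fst h + b * snd h)) (at (x, z))"
  shows "hol2 U V F"
proof -
  have 1: "continuous_on (U \<times> V) (\<lambda>(x, z). F x z)"
  proof (intro continuous_at_imp_continuous_on ballI)
    fix p assume "p \<in> U \<times> V"
    then obtain a b where "((\<lambda>p. F (fst p) (snd p)) has_derivative (\<lambda>h. a * fst h + b * snd h)) (at p)"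
      using assms[of "fst p" "snd p"] by auto
    then show "isCont (\<lambda>(x, z). F x z) p"
      using has_derivative_continuous by (simp add: case_prod_unfold)
  qed
  have 2: "(\<lambda>x. F x z) field_differentiable at x" "F x field_differentiable at z"
    if xz: "x \<in> U" "z \<in> V" for x z
  proof -
    obtain a b where d: "((\<lambda>p. F (fst p) (snd p)) has_derivative (\<lambda>h. a * fst h + b * snd h)) (at (x, z))"
      using assms[OF xz] by blast
    have "((\<lambda>p. F (fst p) (snd p)) \<circ> (\<lambda>t. (t, z)) has_derivative (\<lambda>h. a * fst h + b * snd h) \<circ> (\<lambda>t. (t, 0))) (at x)"
      by (rule diff_chain_at) (auto intro!: derivative_eq_intros d)
    then show "(\<lambda>x. F x z) field_differentiable at x"
      by (auto simp: o_def field_differentiable_def has_field_derivative_def)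
    have "((\<lambda>p. F (fst p) (snd p)) \<circ> (\<lambda>t. (x, t)) has_derivative (\<lambda>h. a * fst h + b * snd h) \<circ> (\<lambda>t. (0, t))) (at z)"
      by (rule diff_chain_at) (auto intro!: derivative_eq_intros d)
    then show "F x field_differentiable at z"
      by (auto simp: o_def field_differentiable_def has_field_derivative_def)
  qed
  show ?thesis
    unfolding hol2_def holomorphic_on_def using 1 2 field_differentiable_at_within by blast
qed

section \<open>Holomorphic functions with values in the algebra\<close>

lemma vector_space_scaleC: "vector_space (scaleC :: complex \<Rightarrow> 'r::complex_algebra_1 \<Rightarrow> 'r)"
  by unfold_locales (simp_all add: scaleC_add_right scaleC_add_left scaleC_scaleC scaleC_one)

text \<open>The class axiom gives only a finite spanning set. A basis is fixed once and for all so
  that the locale of finite dimensional vector spaces can be interpreted globally.\<close>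

definition alg_basis :: "'r::fin_dim_complex_algebra set" where
  "alg_basis = (SOME B. finite_dimensional_vector_space scaleC B)"

lemma finite_dimensional_alg_basis:
  "finite_dimensional_vector_space scaleC (alg_basis :: 'r::fin_dim_complex_algebra set)"
  unfolding alg_basis_def
proof (rule someI_ex)
  interpret vector_space "scaleC :: complex \<Rightarrow> 'r \<Rightarrow> 'r" by (rule vector_space_scaleC)
  obtain S :: "'r set" where S: "finite S"
    "\<And>V. S \<subseteq> V \<and> 0 \<in> V \<and> (\<forall>a\<in>V. \<forall>b\<in>V. a + b \<in> V) \<and> (\<forall>c. \<forall>a\<in>V. scaleC c a \<in> V) \<Longrightarrow> V = UNIV"
    using finite_spanning_set by blast
  have span_S: "span S = UNIV"
    by (rule S(2)) (simp add: span_superset span_zero span_add span_scale)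
  obtain B where B: "B \<subseteq> S" "independent B" "S \<subseteq> span B"
    by (rule maximal_independent_subset[of S])
  have "span B = UNIV" using span_S B(3) by (metis span_mono span_span top.extremum_uniqueI)
  then have "finite_dimensional_vector_space (scaleC :: complex \<Rightarrow> 'r \<Rightarrow> 'r) B"
    by unfold_locales (use B S(1) finite_subset in auto)
  then show "\<exists>B. finite_dimensional_vector_space (scaleC :: complex \<Rightarrow> 'r \<Rightarrow> 'r) B" ..
qed

interpretation Rvs: finite_dimensional_vector_space "scaleC :: complex \<Rightarrow> 'r::fin_dim_complex_algebra \<Rightarrow> 'r" alg_basis
  by (rule finite_dimensional_alg_basis)

definition coord :: "'r::fin_dim_complex_algebra \<Rightarrow> 'r \<Rightarrow> complex" where
  "coord e a = Rvs.representation alg_basis a e"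

lemma finite_alg_basis [simp]: "finite alg_basis"
  by (rule Rvs.finite_Basis)

lemma functional_iff:
  "functional \<phi> \<longleftrightarrow> (\<forall>a b. \<phi> (a + b) = \<phi> a + \<phi> b) \<and> (\<forall>c a. \<phi> (scaleC c a) = c * \<phi> a)"
proof -
  have "vector_space ((*) :: complex \<Rightarrow> complex \<Rightarrow> complex)"
    by unfold_locales (simp_all add: algebra_simps)
  then show ?thesis
    unfolding functional_def using Vector_Spaces.linear_iff vector_space_scaleC by blast
qed

lemma functional_add: "functional \<phi> \<Longrightarrow> \<phi> (a + b) = \<phi> a + \<phi> b"
  by (simp add: functional_iff)

lemma functional_scaleC: "functional \<phi> \<Longrightarrow> \<phi> (scaleC c a) = c * \<phi> a"
  by (simp add: functional_iff)

lemma functional_zero: "functional \<phi> \<Longrightarrow> \<phi> 0 = 0"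
  by (metis functional_add add_cancel_left_left)

lemma functional_minus: "functional \<phi> \<Longrightarrow> \<phi> (- a) = - \<phi> a"
  by (metis add_eq_0_iff functional_add functional_zero neg_eq_iff_add_eq_0)

lemma functional_diff: "functional \<phi> \<Longrightarrow> \<phi> (a - b) = \<phi> a - \<phi> b"
  by (metis functional_add functional_minus diff_conv_add_uminus)

lemma functional_sum: "functional \<phi> \<Longrightarrow> \<phi> (\<Sum>i\<in>I. f i) = (\<Sum>i\<in>I. \<phi> (f i))"
  by (induction I rule: infinite_finite_induct) (simp_all add: functional_add functional_zero)

lemma functional_mult_left: "functional \<phi> \<Longrightarrow> functional (\<lambda>a. \<phi> (b * a))"
  by (simp add: functional_iff distrib_left scaleC_mult_right)

lemma functional_mult_right: "functional \<phi> \<Longrightarrow> functional (\<lambda>a. \<phi> (a * b))"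
  by (simp add: functional_iff distrib_right scaleC_mult_left)

lemma functional_coord: "functional (coord e)"
  by (simp add: functional_iff coord_def Rvs.representation_add Rvs.representation_scale
      Rvs.independent_Basis Rvs.span_Basis)

lemma coord_sum: "(\<Sum>e\<in>alg_basis. scaleC (coord e a) e) = a"
  unfolding coord_def
  by (rule Rvs.sum_representation_eq) (simp_all add: Rvs.independent_Basis Rvs.span_Basis)

lemma coord_eqI: "(\<And>e. e \<in> alg_basis \<Longrightarrow> coord e a = coord e b) \<Longrightarrow> a = b"
  by (metis (no_types, lifting) coord_sum sum.cong)

lemma functional_eqI: "(\<And>\<phi>. functional \<phi> \<Longrightarrow> \<phi> a = \<phi> b) \<Longrightarrow> a = b"
  by (rule coord_eqI) (simp add: functional_coord)

lemma functional_expand: 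
  assumes "functional \<phi>" shows "\<phi> a = (\<Sum>e\<in>alg_basis. coord e a * \<phi> e)"
  by (subst coord_sum[symmetric]) (simp only: functional_sum functional_scaleC assms)

text \<open>Expanding the left factor in the basis makes a functional of a product a finite sum of
  products of scalar functions; holomorphy and differentiation of products reduce to the scalar case
  in this way.\<close>

lemma functional_mult_expand:
  assumes "functional \<phi>" shows "\<phi> (a * b) = (\<Sum>e\<in>alg_basis. coord e a * \<phi> (e * b))"
  by (rule functional_expand[OF functional_mult_right[OF assms]])

section \<open>Derivatives computed through functionals\<close>

lemma Rderiv_eqI:
  assumes "\<And>\<phi>. functional \<phi> \<Longrightarrow> ((\<lambda>t. \<phi> (f t)) has_field_derivative \<phi> v) (at x)"
  shows "Rderiv f x = v"
  unfolding Rderiv_def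
proof (rule the_equality)
  show "w = v" if "\<forall>\<phi>. functional \<phi> \<longrightarrow> ((\<lambda>t. \<phi> (f t)) has_field_derivative \<phi> w) (at x)" for w
    by (rule functional_eqI) (use that assms DERIV_unique in blast)
qed (use assms in blast)

text \<open>\<open>Rderiv\<close> is a definite description, so existence has to be supplied: the
  vector assembled from the coordinate derivatives works for every functional, since functionals are
  combinations of coordinates.\<close>

lemma has_field_derivative_Rderiv:
  assumes f: "\<And>\<phi>. functional \<phi> \<Longrightarrow> (\<lambda>t. \<phi> (f t)) field_differentiable at x" and \<phi>: "functional \<phi>"
  shows "((\<lambda>t. \<phi> (f t)) has_field_derivative \<phi> (Rderiv f x)) (at x)"
proof -
  let ?v = "\<Sum>e\<in>alg_basis. scaleC (deriv (\<lambda>t. coord e (f t)) x) e"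
  have *: "((\<lambda>t. \<psi> (f t)) has_field_derivative \<psi> ?v) (at x)" if \<psi>: "functional \<psi>" for \<psi>
  proof -
    have "((\<lambda>t. \<Sum>e\<in>alg_basis. coord e (f t) * \<psi> e) has_field_derivative
        (\<Sum>e\<in>alg_basis. deriv (\<lambda>t. coord e (f t)) x * \<psi> e)) (at x)"
      by (intro DERIV_sum DERIV_cmult_right)
         (simp add: DERIV_deriv_iff_field_differentiable f[OF functional_coord])
    then show ?thesis
      by (simp add: functional_sum[OF \<psi>] functional_scaleC[OF \<psi>] functional_expand[OF \<psi>, symmetric])
  qed
  have "Rderiv f x = ?v" by (rule Rderiv_eqI) (rule *)
  then show ?thesis using *[OF \<phi>] by simp
qed

lemma Rderiv_cong:
  assumes "open U" "x \<in> U" "\<And>t. t \<in> U \<Longrightarrow> f t = g t"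
  shows "Rderiv f x = Rderiv g x"
proof -
  have "((\<lambda>t. \<phi> (f t)) has_field_derivative v) (at x) \<longleftrightarrow> ((\<lambda>t. \<phi> (g t)) has_field_derivative v) (at x)"
    for \<phi> :: "'a \<Rightarrow> complex" and v
    by (rule DERIV_cong_ev) (use assms in \<open>auto simp: eventually_nhds\<close>)
  then show ?thesis by (simp add: Rderiv_def)
qed

lemma Rderiv_pow_cong:
  assumes "open U" "x \<in> U" "\<And>t. t \<in> U \<Longrightarrow> f t = g t"
  shows "(Rderiv ^^ k) f x = (Rderiv ^^ k) g x"
  using assms(2)
proof (induction k arbitrary: x)
  case (Suc k)
  show ?case using Rderiv_cong[OF assms(1) Suc.prems Suc.IH] by simp
qed (simp add: assms(3))

text \<open>\<open>Ranalytic\<close> also prescribes the value zero outside the set, a condition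
  that is lost on passing to a smaller open set. Computations therefore use \<open>Rhol\<close>, and
  \<open>dop_on\<close> below for operators.\<close>

definition Rhol :: "complex set \<Rightarrow> (complex \<Rightarrow> 'r::fin_dim_complex_algebra) \<Rightarrow> bool" where
  "Rhol U f \<longleftrightarrow> (\<forall>\<phi>. functional \<phi> \<longrightarrow> (\<lambda>t. \<phi> (f t)) holomorphic_on U)"

lemma RholI: "(\<And>\<phi>. functional \<phi> \<Longrightarrow> (\<lambda>t. \<phi> (f t)) holomorphic_on U) \<Longrightarrow> Rhol U f"
  by (simp add: Rhol_def)

lemma RholD: "Rhol U f \<Longrightarrow> functional \<phi> \<Longrightarrow> (\<lambda>t. \<phi> (f t)) holomorphic_on U"
  by (simp add: Rhol_def)

lemma Ranalytic_iff_Rhol: "open U \<Longrightarrow> Ranalytic U f \<longleftrightarrow> Rhol U f \<and> (\<forall>t. t \<notin> U \<longrightarrow> f t = 0)"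
  by (simp add: Ranalytic_def Rhol_def analytic_on_open)

lemma Rhol_subset: "Rhol U f \<Longrightarrow> V \<subseteq> U \<Longrightarrow> Rhol V f"
  unfolding Rhol_def using holomorphic_on_subset by blast

lemma Rhol_cong: "(\<And>t. t \<in> U \<Longrightarrow> f t = g t) \<Longrightarrow> Rhol U f \<longleftrightarrow> Rhol U g"
  unfolding Rhol_def by (simp cong: holomorphic_cong)

lemma Rhol_has_field_derivative:
  assumes "open U" "Rhol U f" "x \<in> U" "functional \<phi>"
  shows "((\<lambda>t. \<phi> (f t)) has_field_derivative \<phi> (Rderiv f x)) (at x)"
  by (rule has_field_derivative_Rderiv)
     (use assms in \<open>auto dest: RholD holomorphic_on_imp_differentiable_at\<close>)

lemma functional_Rderiv:
  assumes "open U" "Rhol U f" "x \<in> U" "functional \<phi>"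
  shows "\<phi> (Rderiv f x) = deriv (\<lambda>t. \<phi> (f t)) x"
  using DERIV_imp_deriv[OF Rhol_has_field_derivative[OF assms]] by simp

lemma Rhol_Rderiv:
  assumes "open U" "Rhol U f" shows "Rhol U (Rderiv f)"
proof (rule RholI)
  fix \<phi> :: "'a \<Rightarrow> complex" assume \<phi>: "functional \<phi>"
  show "(\<lambda>t. \<phi> (Rderiv f t)) holomorphic_on U"
    by (rule holomorphic_transform[OF holomorphic_deriv[OF RholD[OF assms(2) \<phi>] assms(1)]])
       (simp add: functional_Rderiv[OF assms _ \<phi>])
qed

lemma Rhol_Rderiv_pow: "open U \<Longrightarrow> Rhol U f \<Longrightarrow> Rhol U ((Rderiv ^^ k) f)"
  by (induction k) (auto intro: Rhol_Rderiv)

lemma functional_Rderiv_pow: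
  assumes "open U" "Rhol U f" "x \<in> U" "functional \<phi>"
  shows "\<phi> ((Rderiv ^^ k) f x) = (deriv ^^ k) (\<lambda>t. \<phi> (f t)) x"
  using assms(3)
proof (induction k arbitrary: x)
  case (Suc k)
  have "\<phi> ((Rderiv ^^ Suc k) f x) = deriv (\<lambda>t. \<phi> ((Rderiv ^^ k) f t)) x"
    using functional_Rderiv[OF assms(1) Rhol_Rderiv_pow[OF assms(1,2)] Suc.prems assms(4)] by simp
  also have "\<dots> = deriv ((deriv ^^ k) (\<lambda>t. \<phi> (f t))) x"
    by (rule deriv_cong_ev) (use Suc assms(1) in \<open>auto simp: eventually_nhds\<close>)
  finally show ?case by simp
qed simp

lemma Rhol_const: "Rhol U (\<lambda>t. a)"
  by (simp add: Rhol_def)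

lemma Rhol_scaleC: "c holomorphic_on U \<Longrightarrow> Rhol U f \<Longrightarrow> Rhol U (\<lambda>t. scaleC (c t) (f t))"
  by (simp add: Rhol_def functional_scaleC holomorphic_on_mult)

lemma Rhol_minus: "Rhol U f \<Longrightarrow> Rhol U (\<lambda>t. - f t)"
  by (simp add: Rhol_def functional_minus holomorphic_on_minus)

lemma Rhol_diff: "Rhol U f \<Longrightarrow> Rhol U g \<Longrightarrow> Rhol U (\<lambda>t. f t - g t)"
  by (simp add: Rhol_def functional_diff holomorphic_on_diff)

lemma Rhol_sum: "(\<And>i. i \<in> I \<Longrightarrow> Rhol U (f i)) \<Longrightarrow> Rhol U (\<lambda>t. \<Sum>i\<in>I. f i t)"
  by (simp add: Rhol_def functional_sum holomorphic_on_sum)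

lemma Rhol_mult:
  assumes "Rhol U f" "Rhol U g" shows "Rhol U (\<lambda>t. f t * g t)"
proof (rule RholI)
  fix \<phi> :: "'a \<Rightarrow> complex" assume \<phi>: "functional \<phi>"
  have "(\<lambda>t. \<Sum>e\<in>alg_basis. coord e (f t) * \<phi> (e * g t)) holomorphic_on U"
    by (intro holomorphic_on_sum holomorphic_on_mult RholD[OF assms(1) functional_coord]
        RholD[OF assms(2) functional_mult_left[OF \<phi>]])
  then show "(\<lambda>t. \<phi> (f t * g t)) holomorphic_on U"
    unfolding functional_mult_expand[OF \<phi>, of "f _" "g _"] .
qed

lemma Rderiv_const: "Rderiv (\<lambda>t. a) x = 0"
  by (rule Rderiv_eqI) (simp add: functional_zero)

lemma Rderiv_sum:
  assumes "open U" "\<And>i. i \<in> I \<Longrightarrow> Rhol U (f i)" "x \<in> U"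
  shows "Rderiv (\<lambda>t. \<Sum>i\<in>I. f i t) x = (\<Sum>i\<in>I. Rderiv (f i) x)"
  by (rule Rderiv_eqI)
     (simp add: functional_sum DERIV_sum Rhol_has_field_derivative[OF assms(1,2,3)])

lemma Rderiv_mult:
  assumes "open U" "Rhol U f" "Rhol U g" "x \<in> U"
  shows "Rderiv (\<lambda>t. f t * g t) x = Rderiv f x * g x + f x * Rderiv g x"
proof (rule Rderiv_eqI)
  fix \<phi> :: "'a \<Rightarrow> complex" assume \<phi>: "functional \<phi>"
  have "((\<lambda>t. \<Sum>e\<in>alg_basis. coord e (f t) * \<phi> (e * g t)) has_field_derivative
     (\<Sum>e\<in>alg_basis. coord e (Rderiv f x) * \<phi> (e * g x) + \<phi> (e * Rderiv g x) * coord e (f x))) (at x)"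
    by (intro DERIV_sum DERIV_mult Rhol_has_field_derivative[OF assms(1,2,4)] functional_coord
      Rhol_has_field_derivative[OF assms(1,3,4) functional_mult_left[OF \<phi>]])
  then show "((\<lambda>t. \<phi> (f t * g t)) has_field_derivative \<phi> (Rderiv f x * g x + f x * Rderiv g x)) (at x)"
    unfolding functional_mult_expand[OF \<phi>, of "f _" "g _"] functional_add[OF \<phi>]
      functional_mult_expand[OF \<phi>, of "Rderiv f x" "g x"]
      functional_mult_expand[OF \<phi>, of "f x" "Rderiv g x"]
    by (simp only: sum.distrib mult.commute[of "\<phi> _"])
qed

lemma Rderiv_pow_Suc: "(Rderiv ^^ Suc k) f = (Rderiv ^^ k) (Rderiv f)"
  by (simp only: funpow_Suc_right o_apply)

lemma Rderiv_pow_const: "(Rderiv ^^ k) (\<lambda>t. a) x = (if k = 0 then a else 0)"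
proof -
  have 0: "(Rderiv ^^ k) (\<lambda>t. 0 :: 'a) = (\<lambda>t. 0)" for k
    by (induction k) (simp_all add: Rderiv_const)
  have 1: "Rderiv (\<lambda>t. a) = (\<lambda>t. 0)" by (rule ext) (rule Rderiv_const)
  show ?thesis
  proof (cases k)
    case (Suc n) then show ?thesis by (simp only: Rderiv_pow_Suc 0 1) simp
  qed simp
qed

lemma Rderiv_pow_sum:
  assumes "open U" "\<And>i. i \<in> I \<Longrightarrow> Rhol U (f i)" "x \<in> U"
  shows "(Rderiv ^^ k) (\<lambda>t. \<Sum>i\<in>I. f i t) x = (\<Sum>i\<in>I. (Rderiv ^^ k) (f i) x)"
  using assms(3)
proof (induction k arbitrary: x)
  case (Suc k)
  have "(Rderiv ^^ Suc k) (\<lambda>t. \<Sum>i\<in>I. f i t) x = Rderiv (\<lambda>t. \<Sum>i\<in>I. (Rderiv ^^ k) (f i) t) x"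
    using Rderiv_cong[OF assms(1) Suc.prems Suc.IH] by simp
  also have "\<dots> = (\<Sum>i\<in>I. (Rderiv ^^ Suc k) (f i) x)"
    using Rderiv_sum[OF assms(1) _ Suc.prems, of I "\<lambda>i. (Rderiv ^^ k) (f i)"] assms
    by (simp add: Rhol_Rderiv_pow)
  finally show ?case .
qed simp

lemma Rderiv_pow_add:
  assumes "open U" "Rhol U f" "Rhol U g" "x \<in> U"
  shows "(Rderiv ^^ k) (\<lambda>t. f t + g t) x = (Rderiv ^^ k) f x + (Rderiv ^^ k) g x"
  using Rderiv_pow_sum[OF assms(1) _ assms(4), of "{True, False}" "\<lambda>b. if b then f else g" k] assms
  by simp

lemma Rderiv_pow_mult_const:
  assumes "open U" "Rhol U f" "x \<in> U"
  shows "(Rderiv ^^ k) (\<lambda>t. a * f t * b) x = a * (Rderiv ^^ k) f x * b"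
  using assms(3)
proof (induction k arbitrary: x)
  case (Suc k)
  have h: "Rhol U ((Rderiv ^^ k) f)" using assms Rhol_Rderiv_pow by blast
  have "(Rderiv ^^ Suc k) (\<lambda>t. a * f t * b) x = Rderiv (\<lambda>t. a * (Rderiv ^^ k) f t * b) x"
    using Rderiv_cong[OF assms(1) Suc.prems Suc.IH] by simp
  also have "\<dots> = a * (Rderiv ^^ Suc k) f x * b"
    using Rderiv_mult[OF assms(1) Rhol_mult[OF Rhol_const h] Rhol_const Suc.prems]
      Rderiv_mult[OF assms(1) Rhol_const h Suc.prems]
    by (simp add: Rderiv_const)
  finally show ?case .
qed simp

lemma Rderiv_pow_mult_left:
  assumes "open U" "Rhol U f" "x \<in> U"
  shows "(Rderiv ^^ k) (\<lambda>t. a * f t) x = a * (Rderiv ^^ k) f x"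
  using Rderiv_pow_mult_const[OF assms, of k a 1] by simp

lemma Rderiv_pow_mult_right:
  assumes "open U" "Rhol U f" "x \<in> U"
  shows "(Rderiv ^^ k) (\<lambda>t. f t * b) x = (Rderiv ^^ k) f x * b"
  using Rderiv_pow_mult_const[OF assms, of k 1 b] by simp

lemma Rderiv_pow_add_exp: "(Rderiv ^^ (j + k)) f = (Rderiv ^^ j) ((Rderiv ^^ k) f)"
  by (simp add: funpow_add)

section \<open>Inverses\<close>

definition coord_norm :: "'r::fin_dim_complex_algebra \<Rightarrow> real" where
  "coord_norm a = (\<Sum>e\<in>alg_basis. cmod (coord e a))"

lemma cmod_coord_le: "e \<in> alg_basis \<Longrightarrow> cmod (coord e a) \<le> coord_norm a"
  unfolding coord_norm_def by (rule member_le_sum) auto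

lemma coord_norm_nonneg: "coord_norm a \<ge> 0"
  by (simp add: coord_norm_def sum_nonneg)

lemma coord_norm_eq_0: "coord_norm a = 0 \<Longrightarrow> a = 0"
  by (rule coord_eqI)
    (auto simp: coord_norm_def sum_nonneg_eq_0_iff functional_zero[OF functional_coord])

lemma coord_norm_add: "coord_norm (a + b) \<le> coord_norm a + coord_norm b"
  unfolding coord_norm_def sum.distrib[symmetric]
  by (rule sum_mono) (simp add: functional_add[OF functional_coord] norm_triangle_ineq)

lemma coord_norm_minus: "coord_norm (- a) = coord_norm a"
  unfolding coord_norm_def by (simp add: functional_minus[OF functional_coord])

lemma coord_norm_zero: "coord_norm 0 = 0"
  unfolding coord_norm_def by (simp add: functional_zero[OF functional_coord])

lemma coord_norm_scaleC: "coord_norm (scaleC c a) = cmod c * coord_norm a"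
  unfolding coord_norm_def by (simp add: functional_scaleC[OF functional_coord] norm_mult sum_distrib_left)

lemma coord_norm_sum: "coord_norm (\<Sum>i\<in>I. f i) \<le> (\<Sum>i\<in>I. coord_norm (f i))"
proof (induction I rule: infinite_finite_induct)
  case (insert i I) then show ?case using coord_norm_add[of "f i" "sum f I"] by simp
qed (simp_all add: coord_norm_zero)

text \<open>The sum norm of the coordinates need not be submultiplicative; the constant collects the
  norms of the products of basis elements.\<close>

lemma coord_norm_mult_bound:
  obtains C where "C > 0" "\<And>a b :: 'r::fin_dim_complex_algebra. coord_norm (a * b) \<le> C * coord_norm a * coord_norm b"
proof -
  define C where "C = (\<Sum>e\<in>alg_basis. \<Sum>e'\<in>alg_basis. coord_norm (e * e' :: 'r))"
  have C: "C \<ge> 0" by (simp add: C_def sum_nonneg coord_norm_nonneg)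
  have "coord_norm (a * b) \<le> C * coord_norm a * coord_norm b" for a b :: 'r
  proof -
    have "a * b = (\<Sum>e\<in>alg_basis. \<Sum>e'\<in>alg_basis. scaleC (coord e a) (scaleC (coord e' b) (e * e')))"
      by (subst coord_sum[of a, symmetric], subst coord_sum[of b, symmetric])
        (simp only: sum_product scaleC_mult_left scaleC_mult_right scaleC_scaleC mult.commute)
    also have "coord_norm \<dots> \<le> (\<Sum>e\<in>alg_basis. \<Sum>e'\<in>alg_basis. coord_norm (scaleC (coord e a) (scaleC (coord e' b) (e * e'))))"
      by (intro order_trans[OF coord_norm_sum] sum_mono coord_norm_sum)
    also have "\<dots> \<le> (\<Sum>e\<in>alg_basis. \<Sum>e'\<in>alg_basis. coord_norm a * coord_norm b * coord_norm (e * e' :: 'r))"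
      unfolding coord_norm_scaleC mult.assoc[symmetric]
      by (rule sum_mono, rule sum_mono, rule mult_right_mono[OF mult_mono])
        (simp_all add: cmod_coord_le coord_norm_nonneg)
    finally show ?thesis by (simp add: C_def sum_distrib_left mult_ac)
  qed
  \<comment> \<open>Only nonnegativity of the sum is at hand, so the constant is raised by one to
    become strictly positive.\<close>
  moreover have "C * coord_norm a * coord_norm b \<le> (C + 1) * coord_norm a * coord_norm b" for a b :: 'r
    by (intro mult_right_mono coord_norm_nonneg) simp
  ultimately show thesis using that[of "C + 1"] C by (meson add_nonneg_pos order_trans zero_less_one)
qed

lemma inverse_elt_unique:
  assumes "a * b = 1" "b * a = 1" shows "invertible_elt a" "inverse_elt a = b"
proof -
  show "invertible_elt a" using assms by (auto simp: invertible_elt_def)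
  have "c = b" if "a * c = 1" "c * a = 1" for c
    using that assms by (metis mult.assoc mult_1 mult_1_right)
  then show "inverse_elt a = b" unfolding inverse_elt_def using assms by blast
qed

lemma inverse_elt_mult:
  assumes "invertible_elt a" shows "a * inverse_elt a = 1" "inverse_elt a * a = 1"
  using assms inverse_elt_unique unfolding invertible_elt_def by metis+

text \<open>Left multiplication by \<open>a\<close> is injective, hence surjective by finite dimensionality.\<close>

lemma right_inverse_of_injective:
  fixes a :: "'r::fin_dim_complex_algebra"
  assumes inj: "\<And>y. a * y = 0 \<Longrightarrow> y = 0"
  obtains y where "a * y = 1" "y * a = 1"
proof -
  interpret finite_dimensional_vector_space_pair
    "scaleC :: complex \<Rightarrow> 'r \<Rightarrow> 'r" alg_basis "scaleC :: complex \<Rightarrow> 'r \<Rightarrow> 'r" alg_basis ..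
  have "Vector_Spaces.linear scaleC scaleC ((*) a)"
    using vector_space_scaleC by (simp add: Vector_Spaces.linear_iff distrib_left scaleC_mult_right)
  moreover have "inj ((*) a)"
    by (rule injI) (use inj in \<open>metis right_diff_distrib right_minus_eq\<close>)
  ultimately have "surj ((*) a)" by (rule linear_injective_imp_surjective) simp
  then obtain y where y: "a * y = 1" by (metis surjD)
  have "a * (y * a - 1) = 0" by (simp add: right_diff_distrib mult.assoc[symmetric] y)
  then have "y * a = 1" using inj by fastforce
  with y that show thesis by blast
qed

text \<open>In place of a Neumann series: smallness of \<open>d\<close> makes left multiplication by
  \<open>1 + d\<close> injective, finite dimension then gives a two-sided inverse \<open>y\<close>,
  and \<open>y = 1 - d * y\<close> bounds it.\<close>

lemma inverse_one_plus_small: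
  fixes d :: "'r::fin_dim_complex_algebra"
  assumes C: "C > 0" "\<And>a b :: 'r. coord_norm (a * b) \<le> C * coord_norm a * coord_norm b"
    and d: "C * coord_norm d \<le> 1 / 2"
  obtains y where "(1 + d) * y = 1" "y * (1 + d) = 1" "coord_norm y \<le> 2 * coord_norm (1 :: 'r)"
proof -
  have small: "coord_norm (d * y) \<le> coord_norm y / 2" for y
    using C(2)[of d y] mult_right_mono[OF d coord_norm_nonneg[of y]] by simp
  have "y = 0" if "(1 + d) * y = 0" for y
  proof -
    have "coord_norm y = coord_norm (d * y)"
      using that by (metis add.commute add_eq_0_iff coord_norm_minus distrib_right mult_1)
    then show ?thesis using small[of y] coord_norm_nonneg[of y] by (intro coord_norm_eq_0) simp
  qed
  then obtain y where y: "(1 + d) * y = 1" "y * (1 + d) = 1"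
    by (rule right_inverse_of_injective)
  have "y = 1 + - (d * y)" using y(1) by (simp add: distrib_right eq_diff_eq)
  then have "coord_norm y \<le> coord_norm (1 :: 'r) + coord_norm (d * y)"
    using coord_norm_add[of 1 "- (d * y)"] by (simp add: coord_norm_minus)
  then show thesis using that y small[of y] by fastforce
qed

lemma tendsto_coord_norm:
  assumes "\<And>\<phi>. functional \<phi> \<Longrightarrow> ((\<lambda>t. \<phi> (f t)) \<longlongrightarrow> \<phi> l) F"
  shows "((\<lambda>t. coord_norm (f t - l)) \<longlongrightarrow> 0) F"
proof -
  have "((\<lambda>t. \<Sum>e\<in>alg_basis. cmod (coord e (f t) - coord e l)) \<longlongrightarrow> (\<Sum>e\<in>alg_basis. cmod (coord e l - coord e l))) F"
    by (intro tendsto_sum tendsto_norm tendsto_diff tendsto_const assms functional_coord)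
  then show ?thesis by (simp add: coord_norm_def functional_diff[OF functional_coord])
qed

text \<open>With \<open>b\<close> the inverse at \<open>t0\<close>, the product
  \<open>b * f t\<close> is close to \<open>1\<close>, so the preceding lemma inverts it with a
  uniform bound, and multiplying by \<open>b\<close> from the right gives the inverse of
  \<open>f t\<close>. The bound is what later yields continuity of the inverse.\<close>

lemma inverse_locally_bounded:
  assumes U: "open U" "t0 \<in> U" and f: "Rhol U f" and inv: "invertible_elt (f t0)"
  obtains K where "eventually (\<lambda>t. invertible_elt (f t) \<and> coord_norm (inverse_elt (f t)) \<le> K) (nhds t0)"
proof -
  obtain C where C: "C > 0" "\<And>a b :: 'a. coord_norm (a * b) \<le> C * coord_norm a * coord_norm b"
    by (rule coord_norm_mult_bound) blast
  define b where "b = inverse_elt (f t0)"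
  have b: "f t0 * b = 1" "b * f t0 = 1" unfolding b_def using inverse_elt_mult[OF inv] by auto
  have "((\<lambda>t. \<phi> (b * f t)) \<longlongrightarrow> \<phi> 1) (nhds t0)" if \<phi>: "functional \<phi>" for \<phi>
  proof -
    have "(\<lambda>t. \<phi> (b * f t)) holomorphic_on U" by (rule RholD[OF f functional_mult_left[OF \<phi>]])
    then have "isCont (\<lambda>t. \<phi> (b * f t)) t0"
      using U continuous_on_eq_continuous_at holomorphic_on_imp_continuous_on by blast
    then have "((\<lambda>t. \<phi> (b * f t)) \<longlongrightarrow> \<phi> (b * f t0)) (nhds t0)"
      unfolding isCont_def by (rule tendsto_at_iff_tendsto_nhds[THEN iffD1])
    then show ?thesis using b(2) by simp
  qed
  then have "((\<lambda>t. coord_norm (b * f t - 1)) \<longlongrightarrow> 0) (nhds t0)" by (rule tendsto_coord_norm)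
  then have "((\<lambda>t. C * coord_norm (b * f t - 1)) \<longlongrightarrow> C * 0) (nhds t0)"
    by (intro tendsto_mult tendsto_const)
  then have "eventually (\<lambda>t. C * coord_norm (b * f t - 1) < 1 / 2) (nhds t0)"
    by (rule order_tendstoD) simp
  then have "eventually (\<lambda>t. invertible_elt (f t) \<and>
      coord_norm (inverse_elt (f t)) \<le> C * (2 * coord_norm (1 :: 'a)) * coord_norm b) (nhds t0)"
  proof (rule eventually_mono)
    fix t assume "C * coord_norm (b * f t - 1) < 1 / 2"
    then obtain y where y: "(1 + (b * f t - 1)) * y = 1" "y * (1 + (b * f t - 1)) = 1"
        "coord_norm y \<le> 2 * coord_norm (1 :: 'a)"
      using inverse_one_plus_small[OF C, of "b * f t - 1"] by (metis less_imp_le)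
    have 1: "(y * b) * f t = 1" using y(2) by (simp add: mult.assoc)
    have "b * f t * y = 1" using y(1) by simp
    \<comment> \<open>Multiplying by \<open>f t0\<close> on the left and by \<open>b\<close> on the
      right moves \<open>b\<close> past \<open>f t * y\<close>, which turns the right inverse of
      \<open>b * f t\<close> into one of \<open>f t\<close>.\<close>
    then have "f t0 * (b * f t * y) * b = 1" using b by simp
    then have 2: "f t * (y * b) = 1"
      by (metis b(1) mult.assoc mult_1)
    have "coord_norm (y * b) \<le> C * coord_norm y * coord_norm b" by (rule C)
    also have "\<dots> \<le> C * (2 * coord_norm (1 :: 'a)) * coord_norm b"
      by (intro mult_right_mono mult_left_mono y(3) coord_norm_nonneg) (use C in simp)
    finally show "invertible_elt (f t) \<and>
      coord_norm (inverse_elt (f t)) \<le> C * (2 * coord_norm (1 :: 'a)) * coord_norm b"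
      using inverse_elt_unique[OF 2 1] by simp
  qed
  then show thesis by (rule that)
qed

lemma open_inv_locus:
  assumes "open U" "Rhol U f" shows "open (inv_locus U f)"
proof (subst open_subopen, intro ballI)
  fix t assume t: "t \<in> inv_locus U f"
  then have t': "t \<in> U" "invertible_elt (f t)" by (auto simp: inv_locus_def)
  obtain K where "eventually (\<lambda>s. invertible_elt (f s) \<and> coord_norm (inverse_elt (f s)) \<le> K) (nhds t)"
    by (rule inverse_locally_bounded[OF assms(1) t'(1) assms(2) t'(2)])
  then have "eventually (\<lambda>s. invertible_elt (f s)) (nhds t)" by (rule eventually_mono) simp
  moreover have "eventually (\<lambda>s. s \<in> U) (nhds t)"
    by (rule eventually_nhds_in_open[OF assms(1) t'(1)])
  ultimately have "eventually (\<lambda>s. s \<in> inv_locus U f) (nhds t)"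
    by eventually_elim (simp add: inv_locus_def)
  then show "\<exists>T. open T \<and> t \<in> T \<and> T \<subseteq> inv_locus U f"
    unfolding eventually_nhds by blast
qed

lemma inv_fun_eq: "t \<in> inv_locus U f \<Longrightarrow> inv_fun U f t = inverse_elt (f t)"
  by (simp add: inv_fun_def)

lemma inv_fun_mult:
  assumes "t \<in> inv_locus U f" shows "f t * inv_fun U f t = 1" "inv_fun U f t * f t = 1"
  using assms inverse_elt_mult[of "f t"] by (simp_all add: inv_fun_eq) (simp_all add: inv_locus_def)

text \<open>With \<open>i\<close> the inverse of \<open>f\<close>, the identity
  \<open>i(t) - i(t0) = - i(t) (f(t) - f(t0)) i(t0)\<close> and local boundedness give continuity of
  \<open>i\<close>; divided by \<open>t - t0\<close>, the same identity gives
  differentiability.\<close>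

lemma Rhol_inv_fun:
  assumes U: "open U" and f: "Rhol U f"
  shows "Rhol (inv_locus U f) (inv_fun U f)"
proof -
  let ?W = "inv_locus U f" and ?i = "inv_fun U f"
  have W: "open ?W" by (rule open_inv_locus[OF U f])
  obtain C where C: "C > 0" "\<And>a b :: 'a. coord_norm (a * b) \<le> C * coord_norm a * coord_norm b"
    by (rule coord_norm_mult_bound) blast
  have deriv: "\<exists>D. ((\<lambda>t. \<phi> (?i t)) has_field_derivative D) (at t0)" if t0: "t0 \<in> ?W" and \<phi>: "functional \<phi>" for t0 \<phi>
  proof -
    define b where "b = ?i t0"
    have b: "f t0 * b = 1" "b * f t0 = 1" unfolding b_def using inv_fun_mult[OF t0] by auto
    have t0': "t0 \<in> U" "invertible_elt (f t0)" using t0 by (auto simp: inv_locus_def)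
    have f_lim: "((\<lambda>t. \<psi> (f t)) \<longlongrightarrow> \<psi> (f t0)) (at t0)" if "functional \<psi>" for \<psi>
      using RholD[OF f that] U t0'(1)
      by (metis continuous_on_eq_continuous_at holomorphic_on_imp_continuous_on isCont_def)
    obtain K where K: "eventually (\<lambda>t. invertible_elt (f t) \<and> coord_norm (inverse_elt (f t)) \<le> K) (nhds t0)"
      by (rule inverse_locally_bounded[OF U t0'(1) f t0'(2)])
    have inW: "eventually (\<lambda>t. t \<in> ?W) (nhds t0)" using W t0 eventually_nhds_in_open by blast
    have diff_eq: "?i t - b = - (?i t * (f t - f t0) * b)" if "t \<in> ?W" for t
      using inv_fun_mult[OF that] b by (simp add: algebra_simps)
    have "eventually (\<lambda>t. coord_norm (?i t - b) \<le> C * (C * K * coord_norm (f t - f t0)) * coord_norm b) (at t0)"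
      using eventually_nhds_conv_at[THEN iffD1, OF K, THEN conjunct1]
        eventually_nhds_conv_at[THEN iffD1, OF inW, THEN conjunct1]
    proof eventually_elim
      fix t assume "invertible_elt (f t) \<and> coord_norm (inverse_elt (f t)) \<le> K" and t: "t \<in> ?W"
      then have i: "coord_norm (?i t) \<le> K" by (simp add: inv_fun_eq)
      have "coord_norm (?i t - b) = coord_norm (?i t * (f t - f t0) * b)"
        by (simp add: diff_eq[OF t] coord_norm_minus)
      also have "\<dots> \<le> C * coord_norm (?i t * (f t - f t0)) * coord_norm b" by (rule C)
      also have "\<dots> \<le> C * (C * coord_norm (?i t) * coord_norm (f t - f t0)) * coord_norm b"
        by (intro mult_right_mono mult_left_mono C(2) coord_norm_nonneg) (use C in simp)
      also have "\<dots> \<le> C * (C * K * coord_norm (f t - f t0)) * coord_norm b"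
        by (intro mult_right_mono mult_left_mono i coord_norm_nonneg) (use C in simp_all)
      finally show "coord_norm (?i t - b) \<le> C * (C * K * coord_norm (f t - f t0)) * coord_norm b" .
    qed
    then have bound: "eventually (\<lambda>t. norm (coord_norm (?i t - b)) \<le> coord_norm (f t - f t0) * (C * C * K * coord_norm b)) (at t0)"
      by eventually_elim (simp add: coord_norm_nonneg mult_ac)
    have "((\<lambda>t. coord_norm (f t - f t0) * (C * C * K * coord_norm b)) \<longlongrightarrow> 0) (at t0)"
      by (rule tendsto_mult_left_zero[OF tendsto_coord_norm[OF f_lim]])
    with bound have i_lim: "((\<lambda>t. coord_norm (?i t - b)) \<longlongrightarrow> 0) (at t0)"
      by (rule Lim_null_comparison)
    have coord_lim: "((\<lambda>t. coord e (?i t)) \<longlongrightarrow> coord e b) (at t0)" if "e \<in> alg_basis" for e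
    proof (rule LIM_zero_cancel, rule Lim_null_comparison[OF _ i_lim], rule always_eventually, rule allI)
      show "cmod (coord e (?i t) - coord e b) \<le> coord_norm (?i t - b)" for t
        using cmod_coord_le[OF that, of "?i t - b"] by (simp add: functional_diff[OF functional_coord])
    qed
    have quot: "((\<lambda>t. (\<psi> (f t) - \<psi> (f t0)) / (t - t0)) \<longlongrightarrow> \<psi> (Rderiv f t0)) (at t0)" if "functional \<psi>" for \<psi>
      using Rhol_has_field_derivative[OF U f t0'(1) that] by (simp add: has_field_derivative_iff)
    \<comment> \<open>Expanding only the left factor in the basis leaves difference quotients of the
      scalar functions \<open>\<phi> (e * f t * b)\<close>, weighted by coordinates of the inverse,
      whose limits are already known.\<close>
    have "((\<lambda>t. - (\<Sum>e\<in>alg_basis. coord e (?i t) * ((\<phi> (e * f t * b) - \<phi> (e * f t0 * b)) / (t - t0)))) \<longlongrightarrow>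
         - (\<Sum>e\<in>alg_basis. coord e b * \<phi> (e * Rderiv f t0 * b))) (at t0)"
      by (intro tendsto_minus tendsto_sum tendsto_mult coord_lim quot[OF functional_mult_left[OF functional_mult_right[OF \<phi>]]])
    moreover have "eventually (\<lambda>t. - (\<Sum>e\<in>alg_basis. coord e (?i t) * ((\<phi> (e * f t * b) - \<phi> (e * f t0 * b)) / (t - t0)))
        = (\<phi> (?i t) - \<phi> (?i t0)) / (t - t0)) (at t0)"
      using eventually_nhds_conv_at[THEN iffD1, OF inW, THEN conjunct1]
    proof eventually_elim
      fix t assume t: "t \<in> ?W"
      have "\<phi> (?i t) - \<phi> (?i t0) = - \<phi> (?i t * (f t - f t0) * b)"
        unfolding b_def[symmetric] functional_diff[OF \<phi>, symmetric] diff_eq[OF t] functional_minus[OF \<phi>] ..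
      also have "\<phi> (?i t * (f t - f t0) * b) = (\<Sum>e\<in>alg_basis. coord e (?i t) * \<phi> (e * ((f t - f t0) * b)))"
        unfolding mult.assoc by (rule functional_mult_expand[OF \<phi>])
      also have "\<dots> = (\<Sum>e\<in>alg_basis. coord e (?i t) * (\<phi> (e * f t * b) - \<phi> (e * f t0 * b)))"
        unfolding functional_diff[OF \<phi>, symmetric] by (simp add: algebra_simps mult.assoc)
      finally show "- (\<Sum>e\<in>alg_basis. coord e (?i t) * ((\<phi> (e * f t * b) - \<phi> (e * f t0 * b)) / (t - t0)))
        = (\<phi> (?i t) - \<phi> (?i t0)) / (t - t0)"
        by (simp add: sum_divide_distrib)
    qed
    ultimately have "((\<lambda>t. (\<phi> (?i t) - \<phi> (?i t0)) / (t - t0)) \<longlongrightarrow>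
         - (\<Sum>e\<in>alg_basis. coord e b * \<phi> (e * Rderiv f t0 * b))) (at t0)"
      by (rule Lim_transform_eventually)
    then show ?thesis unfolding has_field_derivative_iff by blast
  qed
  show ?thesis
    by (rule RholI, subst holomorphic_on_open[OF W]) (use deriv in blast)
qed

section \<open>Composition of differential operators\<close>

text \<open>Pascal's rule, shaped for inductions on Leibniz formulas in which each term splits into
  \<open>h i\<close> and \<open>h (Suc i)\<close>.\<close>

lemma sum_choose_Suc:
  fixes h :: "nat \<Rightarrow> 'a::ring_1"
  shows "(\<Sum>i\<le>Suc j. of_nat (Suc j choose i) * h i) =
     (\<Sum>i\<le>j. of_nat (j choose i) * h i) + (\<Sum>i\<le>j. of_nat (j choose i) * h (Suc i))"
proof -
  have "(\<Sum>i\<le>Suc j. of_nat (Suc j choose i) * h i) =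
      h 0 + (\<Sum>i\<le>j. of_nat (j choose i) * h (Suc i) + of_nat (j choose Suc i) * h (Suc i))"
    by (subst sum.atMost_Suc_shift) (simp add: distrib_right)
  also have "\<dots> = (h 0 + (\<Sum>i\<le>j. of_nat (j choose Suc i) * h (Suc i))) + (\<Sum>i\<le>j. of_nat (j choose i) * h (Suc i))"
    by (simp add: sum.distrib)
  also have "h 0 + (\<Sum>i\<le>j. of_nat (j choose Suc i) * h (Suc i)) = (\<Sum>i\<le>Suc j. of_nat (j choose i) * h i)"
    using sum.atMost_Suc_shift[of "\<lambda>i. of_nat (j choose i) * h i" j] by simp
  also have "(\<Sum>i\<le>Suc j. of_nat (j choose i) * h i) = (\<Sum>i\<le>j. of_nat (j choose i) * h i)"
    by (simp add: binomial_eq_0)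
  finally show ?thesis .
qed

lemma Rderiv_pow_mult:
  assumes U: "open U" "x \<in> U" and "Rhol U f" "Rhol U g"
  shows "(Rderiv ^^ j) (\<lambda>t. f t * g t) x =
     (\<Sum>i\<le>j. of_nat (j choose i) * ((Rderiv ^^ i) f x * (Rderiv ^^ (j - i)) g x))"
  using assms(3,4)
proof (induction j arbitrary: f g)
  case (Suc j)
  note f = Suc.prems(1) and g = Suc.prems(2)
  have f': "Rhol U (Rderiv f)" and g': "Rhol U (Rderiv g)" using Rhol_Rderiv U f g by auto
  have "(Rderiv ^^ Suc j) (\<lambda>t. f t * g t) x = (Rderiv ^^ j) (\<lambda>t. Rderiv f t * g t + f t * Rderiv g t) x"
    unfolding Rderiv_pow_Suc by (rule Rderiv_pow_cong[OF U]) (rule Rderiv_mult[OF U(1) f g])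
  also have "\<dots> = (Rderiv ^^ j) (\<lambda>t. Rderiv f t * g t) x + (Rderiv ^^ j) (\<lambda>t. f t * Rderiv g t) x"
    by (rule Rderiv_pow_add[OF U(1) Rhol_mult[OF f' g] Rhol_mult[OF f g'] U(2)])
  also have "(Rderiv ^^ j) (\<lambda>t. Rderiv f t * g t) x =
      (\<Sum>i\<le>j. of_nat (j choose i) * ((Rderiv ^^ Suc i) f x * (Rderiv ^^ (Suc j - Suc i)) g x))"
    by (simp only: Suc.IH[OF f' g] Rderiv_pow_Suc diff_Suc_Suc)
  also have "(Rderiv ^^ j) (\<lambda>t. f t * Rderiv g t) x =
      (\<Sum>i\<le>j. of_nat (j choose i) * ((Rderiv ^^ i) f x * (Rderiv ^^ (Suc j - i)) g x))"
    unfolding Suc.IH[OF f g'] by (intro sum.cong) (simp_all add: Suc_diff_le Rderiv_pow_Suc del: funpow.simps)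
  finally show ?case
    by (simp only: sum_choose_Suc add.commute)
qed simp

text \<open>Repeated integration by parts: the Leibniz formula solved for the term in which all
  derivatives fall on \<open>f\<close>. The right action differentiates products, so this is the
  form of the rule that it requires.\<close>

lemma Rderiv_pow_mult_dual:
  assumes U: "open U" "x \<in> U" and "Rhol U f" "Rhol U g"
  shows "(Rderiv ^^ j) f x * g x =
     (\<Sum>i\<le>j. of_nat (j choose i) * ((-1) ^ i * (Rderiv ^^ (j - i)) (\<lambda>t. f t * (Rderiv ^^ i) g t) x))"
  using assms(3)
proof (induction j arbitrary: f)
  case (Suc j)
  note f = Suc.prems(1) 
  have f': "Rhol U (Rderiv f)" using Rhol_Rderiv U f by auto
  have g: "Rhol U ((Rderiv ^^ i) g)" for i using Rhol_Rderiv_pow U assms(4) by auto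
  define h where "h i = (-1) ^ i * (Rderiv ^^ (Suc j - i)) (\<lambda>t. f t * (Rderiv ^^ i) g t) x" for i
  \<comment> \<open>This is the product rule for \<open>f\<close> times the \<open>i\<close>-th
    derivative of \<open>g\<close>, solved for the term with \<open>Rderiv f\<close>; the
    alternating sign in \<open>h\<close> turns the difference into a sum.\<close>
  have *: "(-1) ^ i * (Rderiv ^^ (j - i)) (\<lambda>t. Rderiv f t * (Rderiv ^^ i) g t) x = h i + h (Suc i)"
    if "i \<le> j" for i
  proof -
    have "Rderiv (\<lambda>t. f t * (Rderiv ^^ i) g t) t = Rderiv f t * (Rderiv ^^ i) g t + f t * (Rderiv ^^ Suc i) g t" if "t \<in> U" for t
      using Rderiv_mult[OF U(1) f g that] by simp
    then have "(Rderiv ^^ (Suc j - i)) (\<lambda>t. f t * (Rderiv ^^ i) g t) x =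
       (Rderiv ^^ (j - i)) (\<lambda>t. Rderiv f t * (Rderiv ^^ i) g t + f t * (Rderiv ^^ Suc i) g t) x"
      unfolding Suc_diff_le[OF \<open>i \<le> j\<close>] Rderiv_pow_Suc[of "j - i"] by (rule Rderiv_pow_cong[OF U])
    also have "\<dots> = (Rderiv ^^ (j - i)) (\<lambda>t. Rderiv f t * (Rderiv ^^ i) g t) x
        + (Rderiv ^^ (Suc j - Suc i)) (\<lambda>t. f t * (Rderiv ^^ Suc i) g t) x"
      unfolding diff_Suc_Suc by (rule Rderiv_pow_add[OF U(1) Rhol_mult[OF f' g] Rhol_mult[OF f g] U(2)])
    finally show ?thesis unfolding h_def by (simp only: power_Suc) (simp add: distrib_left)
  qed
  have "(Rderiv ^^ Suc j) f x * g x = (\<Sum>i\<le>j. of_nat (j choose i) * (h i + h (Suc i)))"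
    unfolding Rderiv_pow_Suc Suc.IH[OF f'] by (intro sum.cong) (simp_all add: *)
  also have "\<dots> = (\<Sum>i\<le>Suc j. of_nat (Suc j choose i) * h i)"
    by (simp only: sum_choose_Suc distrib_left sum.distrib)
  finally show ?case unfolding h_def .
qed simp

section \<open>Operators with analytic coefficients, their actions and their composition\<close>

definition dop_on :: "complex set \<Rightarrow> 'r::fin_dim_complex_algebra dop \<Rightarrow> bool" where
  "dop_on U A \<longleftrightarrow> finite (dop_supp A) \<and> (\<forall>k. Rhol U (A k))"

lemma analytic_dop_iff: 
  "open U \<Longrightarrow> analytic_dop U A \<longleftrightarrow> dop_on U A \<and> (\<forall>k t. t \<notin> U \<longrightarrow> A k t = 0)"
  by (auto simp: analytic_dop_def dop_on_def Ranalytic_iff_Rhol)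

lemma dop_on_subset: "dop_on U A \<Longrightarrow> V \<subseteq> U \<Longrightarrow> dop_on V A"
  by (auto simp: dop_on_def intro: Rhol_subset)

lemma dop_on_Rhol: "dop_on U A \<Longrightarrow> Rhol U (A k)"
  by (simp add: dop_on_def)

lemma dop_supp_subset_iff: "dop_supp A \<subseteq> {..<n} \<longleftrightarrow> (\<forall>k\<ge>n. A k = (\<lambda>x. 0))"
  unfolding dop_supp_def by (auto simp: fun_eq_iff subset_eq) (meson leI)

lemma dop_on_bound: 
  assumes "dop_on U A" obtains n where "dop_supp A \<subseteq> {..<n}"
  using assms finite_nat_iff_bounded unfolding dop_on_def by blast

lemma not_in_dop_supp: "k \<notin> dop_supp A \<Longrightarrow> A k = (\<lambda>x. 0)"
  by (auto simp: dop_supp_def)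

lemma left_action_superset:
  assumes "finite K" "dop_supp A \<subseteq> K"
  shows "left_action A f x = (\<Sum>k\<in>K. A k x * (Rderiv ^^ k) f x)"
  unfolding left_action_def
  by (rule sum.mono_neutral_left) (use assms in \<open>auto simp: not_in_dop_supp\<close>)

lemma right_action_superset:
  assumes "finite K" "dop_supp A \<subseteq> K"
  shows "right_action f A z = (\<Sum>k\<in>K. (-1) ^ k * (Rderiv ^^ k) (\<lambda>t. f t * A k t) z)"
  unfolding right_action_def
  by (rule sum.mono_neutral_left) (use assms in \<open>auto simp: not_in_dop_supp Rderiv_pow_const\<close>)

lemma left_action_cong:
  assumes "open U" "x \<in> U" "\<And>t. t \<in> U \<Longrightarrow> f t = g t" "dop_on U A" "dop_on U B" "\<And>k. A k x = B k x"
  shows "left_action A f x = left_action B g x"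
proof -
  have "finite (dop_supp A \<union> dop_supp B)" using assms by (auto simp: dop_on_def)
  then show ?thesis
    using left_action_superset[of "dop_supp A \<union> dop_supp B" A] left_action_superset[of "dop_supp A \<union> dop_supp B" B]
      Rderiv_pow_cong[OF assms(1-3)] assms(6) by simp
qed

lemma right_action_cong:
  assumes "open U" "x \<in> U" "\<And>t. t \<in> U \<Longrightarrow> f t = g t" "dop_on U A" "dop_on U B"
    "\<And>k t. t \<in> U \<Longrightarrow> A k t = B k t"
  shows "right_action f A x = right_action g B x"
proof -
  have "finite (dop_supp A \<union> dop_supp B)" using assms by (auto simp: dop_on_def)
  moreover have "(Rderiv ^^ k) (\<lambda>t. f t * A k t) x = (Rderiv ^^ k) (\<lambda>t. g t * B k t) x" for k
    by (rule Rderiv_pow_cong[OF assms(1,2)]) (use assms in simp)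
  ultimately show ?thesis
    using right_action_superset[of "dop_supp A \<union> dop_supp B" A] right_action_superset[of "dop_supp A \<union> dop_supp B" B]
    by simp
qed

lemma Rhol_right_action:
  assumes "open U" "dop_on U A" "Rhol U f" shows "Rhol U (right_action f A)"
  unfolding right_action_def
  by (intro Rhol_sum Rhol_mult[OF Rhol_const] Rhol_Rderiv_pow[OF assms(1)]
      Rhol_mult[OF assms(3) dop_on_Rhol[OF assms(2)]])

text \<open>A composition is sorted by the order \<open>m\<close> of the result, two successive
  actions by the order \<open>k\<close> of a term of the second factor; the substitution is
  \<open>m = k + (j - i)\<close>. The guard \<open>j \<le> m + i\<close> says that the truncated
  subtraction \<open>m + i - j\<close> is a true one.\<close>

lemma sum_Leibniz_reindex:
  fixes H :: "nat \<Rightarrow> nat \<Rightarrow> nat \<Rightarrow> nat \<Rightarrow> 'a::comm_monoid_add"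
  assumes "\<And>j i k m. k \<ge> nb \<Longrightarrow> H j i k m = 0"
  shows "(\<Sum>m<na + nb. \<Sum>j<na. \<Sum>i | i \<le> j \<and> j \<le> m + i. H j i (m + i - j) m) =
     (\<Sum>j<na. \<Sum>k<nb. \<Sum>i\<le>j. H j i k (k + (j - i)))"
proof -
  have "(\<Sum>m<na + nb. \<Sum>i | i \<le> j \<and> j \<le> m + i. H j i (m + i - j) m) =
      (\<Sum>k<nb. \<Sum>i\<le>j. H j i k (k + (j - i)))" if j: "j < na" for j
  proof -
    have "(\<Sum>m<na + nb. \<Sum>i | i \<le> j \<and> j \<le> m + i. H j i (m + i - j) m) =
       (\<Sum>i\<le>j. \<Sum>m | m < na + nb \<and> j \<le> m + i. H j i (m + i - j) m)"
      using sum.swap_restrict[of "{..<na + nb}" "{..j}" "\<lambda>m i. H j i (m + i - j) m" "\<lambda>m i. j \<le> m + i"]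
      by (simp add: conj_commute)
    also have "\<dots> = (\<Sum>i\<le>j. \<Sum>k<nb. H j i k (k + (j - i)))"
    proof (rule sum.cong)
      fix i assume "i \<in> {..j}"
      then have i: "i \<le> j" by simp
      have "(\<Sum>m | m < na + nb \<and> j \<le> m + i. H j i (m + i - j) m) =
          (\<Sum>k<na + nb - (j - i). H j i k (k + (j - i)))"
        by (rule sum.reindex_bij_witness[of _ "\<lambda>k. k + (j - i)" "\<lambda>m. m + i - j"]) (use i in auto)
      \<comment> \<open>Since \<open>j < na\<close>, the range of \<open>k\<close> covers
        \<open>{..<nb}\<close>, and the surplus terms vanish by assumption.\<close>
      also have "\<dots> = (\<Sum>k<nb. H j i k (k + (j - i)))"
        by (rule sum.mono_neutral_right) (use i j assms in auto)
      finally show "(\<Sum>m | m < na + nb \<and> j \<le> m + i. H j i (m + i - j) m) = (\<Sum>k<nb. H j i k (k + (j - i)))" .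
    qed simp
    also have "\<dots> = (\<Sum>k<nb. \<Sum>i\<le>j. H j i k (k + (j - i)))" by (rule sum.swap)
    finally show ?thesis .
  qed
  then show ?thesis by (subst sum.swap) simp
qed

lemma dop_mult_eq:
  assumes "x \<in> U" "dop_supp A \<subseteq> {..<na}"
  shows "dop_mult U A B m x = (\<Sum>j<na. \<Sum>i | i \<le> j \<and> j \<le> m + i.
            of_nat (j choose i) * A j x * (Rderiv ^^ i) (B (m + i - j)) x)"
  unfolding dop_mult_def using assms
  by (auto intro!: sum.mono_neutral_left sum.neutral simp: not_in_dop_supp)

lemma dop_supp_dop_mult:
  assumes "dop_supp A \<subseteq> {..<na}" "dop_supp B \<subseteq> {..<nb}"
  shows "dop_supp (dop_mult U A B) \<subseteq> {..<na + nb}"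
  unfolding dop_supp_subset_iff
proof (intro allI impI ext)
  fix m x assume m: "m \<ge> na + nb"
  show "dop_mult U A B m x = 0"
  proof (cases "x \<in> U")
    case True
    have "B (m + i - j) = (\<lambda>x. 0)" if "j < na" for i j
      using assms(2) m that unfolding dop_supp_subset_iff by auto
    then show ?thesis
      unfolding dop_mult_eq[OF True assms(1)] by (intro sum.neutral ballI) (simp add: Rderiv_pow_const)
  qed (simp add: dop_mult_def)
qed

lemma analytic_dop_mult:
  assumes U: "open U" and A: "dop_on U A" and B: "dop_on U B"
  shows "analytic_dop U (dop_mult U A B)"
proof -
  obtain na nb where n: "dop_supp A \<subseteq> {..<na}" "dop_supp B \<subseteq> {..<nb}"
    using dop_on_bound A B by metis
  have "Rhol U (dop_mult U A B m)" for m
  proof -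
    have "Rhol U (\<lambda>x. \<Sum>j<na. \<Sum>i | i \<le> j \<and> j \<le> m + i.
            of_nat (j choose i) * A j x * (Rderiv ^^ i) (B (m + i - j)) x)"
      by (intro Rhol_sum Rhol_mult Rhol_const Rhol_Rderiv_pow dop_on_Rhol[OF A] dop_on_Rhol[OF B] U)
    then show ?thesis
      by (subst Rhol_cong) (rule dop_mult_eq[OF _ n(1)])
  qed
  then show ?thesis
    using dop_supp_dop_mult[OF n, of U] finite_subset
    by (auto simp: analytic_dop_iff[OF U] dop_on_def dop_mult_def)
qed

lemma dop_on_mult:
  assumes "open U" "dop_on U A" "dop_on U B" shows "dop_on U (dop_mult U A B)"
  using analytic_dop_mult[OF assms] by (simp add: analytic_dop_iff[OF assms(1)])

text \<open>Applying the Leibniz rule to each term of \<open>B\<close> and sorting by total order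
  reproduces the coefficients of \<open>dop_mult\<close>.\<close>

lemma left_action_dop_mult:
  assumes U: "open U" "x \<in> U" and A: "dop_on U A" and B: "dop_on U B" and f: "Rhol U f"
  shows "left_action (dop_mult U A B) f x = left_action A (left_action B f) x"
proof -
  obtain na nb where n: "dop_supp A \<subseteq> {..<na}" "dop_supp B \<subseteq> {..<nb}"
    using dop_on_bound A B by metis
  have Df: "Rhol U ((Rderiv ^^ k) f)" for k using U f Rhol_Rderiv_pow by blast
  have Bk: "Rhol U (B k)" for k using B by (rule dop_on_Rhol)
  have "(Rderiv ^^ j) (left_action B f) x =
     (\<Sum>k<nb. \<Sum>i\<le>j. of_nat (j choose i) * ((Rderiv ^^ i) (B k) x * (Rderiv ^^ (k + (j - i))) f x))" for j
  proof -
    have "(Rderiv ^^ j) (left_action B f) x = (Rderiv ^^ j) (\<lambda>t. \<Sum>k<nb. B k t * (Rderiv ^^ k) f t) x"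
      by (rule Rderiv_pow_cong[OF U]) (simp add: left_action_superset[OF _ n(2)])
    also have "\<dots> = (\<Sum>k<nb. (Rderiv ^^ j) (\<lambda>t. B k t * (Rderiv ^^ k) f t) x)"
      by (rule Rderiv_pow_sum[OF U(1) Rhol_mult[OF Bk Df] U(2)])
    also have "\<dots> = (\<Sum>k<nb. \<Sum>i\<le>j. of_nat (j choose i) * ((Rderiv ^^ i) (B k) x * (Rderiv ^^ (j - i)) ((Rderiv ^^ k) f) x))"
      by (intro sum.cong refl Rderiv_pow_mult[OF U Bk Df])
    finally show ?thesis by (simp add: Rderiv_pow_add_exp[symmetric] add.commute)
  qed
  then have "left_action A (left_action B f) x = (\<Sum>j<na. \<Sum>k<nb. \<Sum>i\<le>j.
       of_nat (j choose i) * A j x * (Rderiv ^^ i) (B k) x * (Rderiv ^^ (k + (j - i))) f x)"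
    by (simp add: left_action_superset[OF _ n(1)] sum_distrib_left mult.assoc mult_of_nat_commute)
  also have "\<dots> = (\<Sum>m<na + nb. \<Sum>j<na. \<Sum>i | i \<le> j \<and> j \<le> m + i.
       of_nat (j choose i) * A j x * (Rderiv ^^ i) (B (m + i - j)) x * (Rderiv ^^ m) f x)"
    by (rule sum_Leibniz_reindex[symmetric])
       (use n(2) in \<open>simp add: dop_supp_subset_iff Rderiv_pow_const\<close>)
  also have "\<dots> = left_action (dop_mult U A B) f x"
    by (simp add: left_action_superset[OF _ dop_supp_dop_mult[OF n]] dop_mult_eq[OF U(2) n(1)] sum_distrib_right)
  finally show ?thesis by simp
qed

text \<open>The right action has the sign and the order of operations of a formal adjoint, which
  reverses composition, so \<open>A\<close> acts before \<open>B\<close>. The dual Leibniz rule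
  rewrites the double action through pure derivatives of products, the form in which the composition
  acts.\<close>

lemma right_action_dop_mult:
  assumes U: "open U" "x \<in> U" and A: "dop_on U A" and B: "dop_on U B" and f: "Rhol U f"
  shows "right_action f (dop_mult U A B) x = right_action (right_action f A) B x"
proof -
  obtain na nb where n: "dop_supp A \<subseteq> {..<na}" "dop_supp B \<subseteq> {..<nb}"
    using dop_on_bound A B by metis
  define F where "F j = (\<lambda>t. f t * A j t)" for j
  have F: "Rhol U (F j)" for j unfolding F_def by (rule Rhol_mult[OF f dop_on_Rhol[OF A]])
  have Bk: "Rhol U (B k)" for k using B by (rule dop_on_Rhol)
  have DB: "Rhol U ((Rderiv ^^ i) (B k))" for i k using U Bk Rhol_Rderiv_pow by blast
  have FB: "Rhol U (\<lambda>t. F j t * (Rderiv ^^ i) (B k) t)" for i j k by (rule Rhol_mult[OF F DB])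
  define H where "H j i k m =
    (-1) ^ m * (of_nat (j choose i) * (Rderiv ^^ m) (\<lambda>t. F j t * (Rderiv ^^ i) (B k) t) x)" for j i k m
  have "(Rderiv ^^ m) (\<lambda>t. f t * dop_mult U A B m t) x = (\<Sum>j<na. \<Sum>i | i \<le> j \<and> j \<le> m + i.
     of_nat (j choose i) * (Rderiv ^^ m) (\<lambda>t. F j t * (Rderiv ^^ i) (B (m + i - j)) t) x)" for m
  proof -
    have "f t * dop_mult U A B m t = (\<Sum>j<na. \<Sum>i | i \<le> j \<and> j \<le> m + i.
         of_nat (j choose i) * (F j t * (Rderiv ^^ i) (B (m + i - j)) t))" if "t \<in> U" for t
      unfolding dop_mult_eq[OF that n(1)] F_def
      by (simp add: sum_distrib_left mult.assoc mult_of_nat_commute)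
    then have "(Rderiv ^^ m) (\<lambda>t. f t * dop_mult U A B m t) x =
      (Rderiv ^^ m) (\<lambda>t. \<Sum>j<na. \<Sum>i | i \<le> j \<and> j \<le> m + i.
         of_nat (j choose i) * (F j t * (Rderiv ^^ i) (B (m + i - j)) t)) x"
      by (rule Rderiv_pow_cong[OF U])
    also have "\<dots> = (\<Sum>j<na. \<Sum>i | i \<le> j \<and> j \<le> m + i.
         (Rderiv ^^ m) (\<lambda>t. of_nat (j choose i) * (F j t * (Rderiv ^^ i) (B (m + i - j)) t)) x)"
    proof -
      have "(Rderiv ^^ m) (\<lambda>t. \<Sum>i | i \<le> j \<and> j \<le> m + i.
           of_nat (j choose i) * (F j t * (Rderiv ^^ i) (B (m + i - j)) t)) x =
         (\<Sum>i | i \<le> j \<and> j \<le> m + i.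
           (Rderiv ^^ m) (\<lambda>t. of_nat (j choose i) * (F j t * (Rderiv ^^ i) (B (m + i - j)) t)) x)" for j
        by (rule Rderiv_pow_sum[OF U(1) Rhol_mult[OF Rhol_const FB] U(2)])
      note inner = this
      show ?thesis
        by (rule trans[OF Rderiv_pow_sum[OF U(1) Rhol_sum[OF Rhol_mult[OF Rhol_const FB]] U(2)]])
          (simp only: inner)
    qed
    also have "\<dots> = (\<Sum>j<na. \<Sum>i | i \<le> j \<and> j \<le> m + i.
         of_nat (j choose i) * (Rderiv ^^ m) (\<lambda>t. F j t * (Rderiv ^^ i) (B (m + i - j)) t) x)"
      by (simp only: Rderiv_pow_mult_left[OF U(1) FB U(2)])
    finally show ?thesis .
  qed
  then have "right_action f (dop_mult U A B) x =
     (\<Sum>m<na + nb. \<Sum>j<na. \<Sum>i | i \<le> j \<and> j \<le> m + i. H j i (m + i - j) m)"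
    by (simp add: right_action_superset[OF _ dop_supp_dop_mult[OF n]] H_def sum_distrib_left)
  also have "\<dots> = (\<Sum>j<na. \<Sum>k<nb. \<Sum>i\<le>j. H j i k (k + (j - i)))"
    by (rule sum_Leibniz_reindex)
       (use n(2) in \<open>simp add: dop_supp_subset_iff Rderiv_pow_const H_def\<close>)
  also have "\<dots> = (\<Sum>j<na. \<Sum>k<nb. (-1) ^ (k + j) * (Rderiv ^^ k) (\<lambda>t. (Rderiv ^^ j) (F j) t * B k t) x)"
  proof (intro sum.cong refl)
    fix j k
    have "(Rderiv ^^ k) (\<lambda>t. (Rderiv ^^ j) (F j) t * B k t) x = (Rderiv ^^ k) (\<lambda>t. \<Sum>i\<le>j. 
        of_nat (j choose i) * ((-1) ^ i * (Rderiv ^^ (j - i)) (\<lambda>t. F j t * (Rderiv ^^ i) (B k) t) t)) x"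
      by (rule Rderiv_pow_cong[OF U]) (rule Rderiv_pow_mult_dual[OF U(1) _ F Bk])
    also have "\<dots> = (\<Sum>i\<le>j. (Rderiv ^^ k) (\<lambda>t. (of_nat (j choose i) * (-1) ^ i) * (Rderiv ^^ (j - i)) (\<lambda>t. F j t * (Rderiv ^^ i) (B k) t) t) x)"
      by (subst Rderiv_pow_sum[OF U(1) _ U(2)], intro Rhol_mult Rhol_const Rhol_Rderiv_pow F Bk U) (simp add: mult.assoc)
    also have "\<dots> = (\<Sum>i\<le>j. (of_nat (j choose i) * (-1) ^ i) * (Rderiv ^^ (k + (j - i))) (\<lambda>t. F j t * (Rderiv ^^ i) (B k) t) x)"
      by (simp only: Rderiv_pow_mult_left[OF U(1) Rhol_Rderiv_pow[OF U(1) FB] U(2)] Rderiv_pow_add_exp)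
    finally have "(-1) ^ (k + j) * (Rderiv ^^ k) (\<lambda>t. (Rderiv ^^ j) (F j) t * B k t) x =
       (\<Sum>i\<le>j. (-1) ^ (k + j) * (of_nat (j choose i) * (-1) ^ i * (Rderiv ^^ (k + (j - i))) (\<lambda>t. F j t * (Rderiv ^^ i) (B k) t) x))"
      by (simp add: sum_distrib_left)
    also have "\<dots> = (\<Sum>i\<le>j. H j i k (k + (j - i)))"
    proof (intro sum.cong refl)
      fix i assume "i \<in> {..j}"
      then obtain l where l: "j = i + l" by (auto simp: le_iff_add)
      \<comment> \<open>The exponents \<open>k + (j - i)\<close> and \<open>k + j + i\<close> differ
        by \<open>2 * i\<close>.\<close>
      have s: "(-1) ^ (k + (j - i)) = ((-1) ^ (k + j) * (-1) ^ i :: 'a)"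
        by (cases "even i"; cases "even l"; cases "even k") (simp_all add: l minus_one_power_iff)
      show "(-1) ^ (k + j) * (of_nat (j choose i) * (-1) ^ i * (Rderiv ^^ (k + (j - i))) (\<lambda>t. F j t * (Rderiv ^^ i) (B k) t) x)
         = H j i k (k + (j - i))"
        unfolding H_def s mult_of_nat_commute[of _ "(-1) ^ i"] by (simp only: mult.assoc)
    qed
    finally show "(\<Sum>i\<le>j. H j i k (k + (j - i))) = (-1) ^ (k + j) * (Rderiv ^^ k) (\<lambda>t. (Rderiv ^^ j) (F j) t * B k t) x" ..
  qed
  also have "\<dots> = (\<Sum>k<nb. (-1) ^ k * (Rderiv ^^ k) (\<lambda>t. right_action f A t * B k t) x)"
  proof -
    have "(Rderiv ^^ k) (\<lambda>t. right_action f A t * B k t) x =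
       (\<Sum>j<na. (-1) ^ j * (Rderiv ^^ k) (\<lambda>t. (Rderiv ^^ j) (F j) t * B k t) x)" for k
    proof -
      have "(Rderiv ^^ k) (\<lambda>t. right_action f A t * B k t) x =
         (Rderiv ^^ k) (\<lambda>t. \<Sum>j<na. (-1) ^ j * ((Rderiv ^^ j) (F j) t * B k t)) x"
        by (rule Rderiv_pow_cong[OF U])
          (simp add: right_action_superset[OF _ n(1)] F_def sum_distrib_right mult.assoc)
      also have "\<dots> = (\<Sum>j<na. (Rderiv ^^ k) (\<lambda>t. (-1) ^ j * ((Rderiv ^^ j) (F j) t * B k t)) x)"
        by (rule Rderiv_pow_sum[OF U(1) Rhol_mult[OF Rhol_const Rhol_mult[OF Rhol_Rderiv_pow[OF U(1) F] Bk]] U(2)])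
      also have "\<dots> = (\<Sum>j<na. (-1) ^ j * (Rderiv ^^ k) (\<lambda>t. (Rderiv ^^ j) (F j) t * B k t) x)"
        by (simp only: Rderiv_pow_mult_left[OF U(1) Rhol_mult[OF Rhol_Rderiv_pow[OF U(1) F] Bk] U(2)])
      finally show ?thesis .
    qed
    then show ?thesis
      by (subst sum.swap) (simp add: sum_distrib_left power_add mult.assoc)
  qed
  also have "\<dots> = right_action (right_action f A) B x"
    by (simp add: right_action_superset[OF _ n(2)])
  finally show ?thesis .
qed

lemma dop_supp_fun_dop: "dop_supp (fun_dop f) \<subseteq> {..<1}"
  by (auto simp: dop_supp_def fun_dop_def)

lemma left_action_fun_dop: "left_action (fun_dop g) f x = g x * f x"
  by (subst left_action_superset[OF _ dop_supp_fun_dop]) (simp_all add: fun_dop_def)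

lemma right_action_fun_dop: "right_action f (fun_dop g) x = f x * g x"
  by (subst right_action_superset[OF _ dop_supp_fun_dop]) (simp_all add: fun_dop_def)

lemma dop_on_fun_dop: "dop_on U (fun_dop f) \<longleftrightarrow> Rhol U f"
  unfolding dop_on_def using dop_supp_fun_dop[of f] finite_subset[OF _ finite_lessThan]
  by (auto simp: fun_dop_def Rhol_const split: if_splits)

section \<open>Commuting left and right actions\<close>

lemma hol2_cong:
  assumes "\<And>x z. x \<in> U \<Longrightarrow> z \<in> V \<Longrightarrow> F x z = G x z" "hol2 U V F"
  shows "hol2 U V G"
proof -
  have "continuous_on (U \<times> V) (\<lambda>(x, z). G x z)"
    by (rule continuous_on_eq[OF hol2_continuous[OF assms(2)]]) (use assms in auto)
  moreover have "(\<lambda>x. G x z) holomorphic_on U" if "z \<in> V" for z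
    by (rule holomorphic_transform[of "\<lambda>x. F x z"]) (use assms that in \<open>auto simp: hol2_def\<close>)
  moreover have "G x holomorphic_on V" if "x \<in> U" for x
    by (rule holomorphic_transform[of "F x"]) (use assms that in \<open>auto simp: hol2_def\<close>)
  ultimately show ?thesis by (simp add: hol2_def)
qed

lemma hol2_mult: "hol2 U V F \<Longrightarrow> hol2 U V G \<Longrightarrow> hol2 U V (\<lambda>x z. F x z * G x z)"
  by (simp add: hol2_def case_prod_unfold continuous_on_mult holomorphic_on_mult)

lemma hol2_sum: "(\<And>i. i \<in> I \<Longrightarrow> hol2 U V (F i)) \<Longrightarrow> hol2 U V (\<lambda>x z. \<Sum>i\<in>I. F i x z)"
  by (simp add: hol2_def case_prod_unfold continuous_on_sum holomorphic_on_sum)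

lemma hol2_fst: 
  assumes "f holomorphic_on U" shows "hol2 U V (\<lambda>x z. f x)"
proof -
  have "continuous_on (U \<times> V) (\<lambda>p. f (fst p))"
    by (rule continuous_on_compose2[OF holomorphic_on_imp_continuous_on[OF assms] continuous_on_fst])
      (auto intro: continuous_on_id)
  then show ?thesis using assms by (simp add: hol2_def case_prod_unfold)
qed

section \<open>Algebra-valued functions of two variables\<close>

definition Rhol2 ::
    "complex set \<Rightarrow> complex set \<Rightarrow> (complex \<Rightarrow> complex \<Rightarrow> 'r::fin_dim_complex_algebra) \<Rightarrow> bool" where
  "Rhol2 U V F \<longleftrightarrow> (\<forall>\<phi>. functional \<phi> \<longrightarrow> hol2 U V (\<lambda>x z. \<phi> (F x z)))"

lemma Ranalytic2_iff_Rhol2: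
  assumes "open U" "open V" shows "Ranalytic2 U V F \<longleftrightarrow> Rhol2 U V F"
proof
  assume "Ranalytic2 U V F"
  then show "Rhol2 U V F"
    unfolding Ranalytic2_def Rhol2_def using hol2I_has_derivative[of U V "\<lambda>x z. _ (F x z)"] by blast
next
  assume "Rhol2 U V F"
  then show "Ranalytic2 U V F"
    unfolding Ranalytic2_def Rhol2_def using hol2_has_derivative[OF assms] by blast
qed

lemma Rhol2D: "Rhol2 U V F \<Longrightarrow> functional \<phi> \<Longrightarrow> hol2 U V (\<lambda>x z. \<phi> (F x z))"
  by (simp add: Rhol2_def)

lemma Rhol2_subset: "Rhol2 U V F \<Longrightarrow> U' \<subseteq> U \<Longrightarrow> V' \<subseteq> V \<Longrightarrow> Rhol2 U' V' F"
  unfolding Rhol2_def using hol2_subset by blast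

lemma Rhol2_swap: "Rhol2 U V F \<Longrightarrow> Rhol2 V U (\<lambda>z x. F x z)"
  unfolding Rhol2_def using hol2_swap by blast

lemma Rhol2_section_fst: "Rhol2 U V F \<Longrightarrow> z \<in> V \<Longrightarrow> Rhol U (\<lambda>x. F x z)"
  by (simp add: Rhol2_def Rhol_def hol2_def)

lemma Rhol2_section_snd: "Rhol2 U V F \<Longrightarrow> x \<in> U \<Longrightarrow> Rhol V (F x)"
  by (simp add: Rhol2_def Rhol_def hol2_def)

lemma Rhol2_fst: "Rhol U f \<Longrightarrow> Rhol2 U V (\<lambda>x z. f x)"
  by (simp add: Rhol2_def Rhol_def hol2_fst)

lemma Rhol2_snd: "Rhol V f \<Longrightarrow> Rhol2 U V (\<lambda>x z. f z)"
  using Rhol2_swap[OF Rhol2_fst] by blast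

lemma Rhol2_sum: "(\<And>i. i \<in> I \<Longrightarrow> Rhol2 U V (F i)) \<Longrightarrow> Rhol2 U V (\<lambda>x z. \<Sum>i\<in>I. F i x z)"
  by (simp add: Rhol2_def functional_sum hol2_sum)

lemma Rhol2_mult:
  assumes "Rhol2 U V F" "Rhol2 U V G" shows "Rhol2 U V (\<lambda>x z. F x z * G x z)"
  unfolding Rhol2_def
proof (intro allI impI)
  fix \<phi> :: "'a \<Rightarrow> complex" assume \<phi>: "functional \<phi>"
  have "hol2 U V (\<lambda>x z. \<Sum>e\<in>alg_basis. coord e (F x z) * \<phi> (e * G x z))"
    by (intro hol2_sum hol2_mult Rhol2D[OF assms(1) functional_coord]
        Rhol2D[OF assms(2) functional_mult_left[OF \<phi>]])
  then show "hol2 U V (\<lambda>x z. \<phi> (F x z * G x z))"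
    unfolding functional_mult_expand[OF \<phi>, of "F _ _" "G _ _"] .
qed

section \<open>Partial derivatives and their commutation with both actions\<close>

definition Dx :: "(complex \<Rightarrow> complex \<Rightarrow> 'r::fin_dim_complex_algebra) \<Rightarrow> complex \<Rightarrow> complex \<Rightarrow> 'r" where
  "Dx F x z = Rderiv (\<lambda>t. F t z) x"

definition Dz :: "(complex \<Rightarrow> complex \<Rightarrow> 'r::fin_dim_complex_algebra) \<Rightarrow> complex \<Rightarrow> complex \<Rightarrow> 'r" where
  "Dz F x z = Rderiv (F x) z"

lemma Dx_pow: "(Dx ^^ k) F x z = (Rderiv ^^ k) (\<lambda>t. F t z) x"
proof (induction k arbitrary: x)
  case (Suc k)
  have "(Dx ^^ Suc k) F x z = Rderiv (\<lambda>t. (Dx ^^ k) F t z) x"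
    unfolding funpow.simps o_apply by (rule Dx_def)
  with Suc show ?case by simp
qed simp

lemma Dz_pow: "(Dz ^^ k) F x z = (Rderiv ^^ k) (F x) z"
proof (induction k arbitrary: z)
  case (Suc k)
  have "(Dz ^^ Suc k) F x z = Rderiv (\<lambda>t. (Dz ^^ k) F x t) z"
    unfolding funpow.simps o_apply by (rule Dz_def)
  with Suc show ?case by simp
qed simp

lemma Dx_cong:
  assumes "open U" "x \<in> U" "\<And>x. x \<in> U \<Longrightarrow> F x z = G x z" shows "Dx F x z = Dx G x z"
  unfolding Dx_def by (rule Rderiv_cong[OF assms])

lemma Dz_cong:
  assumes "open V" "z \<in> V" "\<And>z. z \<in> V \<Longrightarrow> F x z = G x z" shows "Dz F x z = Dz G x z"
  unfolding Dz_def by (rule Rderiv_cong[OF assms])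

lemma functional_Dx:
  assumes "open U" "Rhol2 U V F" "x \<in> U" "z \<in> V" "functional \<phi>"
  shows "\<phi> (Dx F x z) = deriv (\<lambda>t. \<phi> (F t z)) x"
  unfolding Dx_def by (rule functional_Rderiv) (use assms Rhol2_section_fst in auto)

lemma functional_Dz:
  assumes "open V" "Rhol2 U V F" "x \<in> U" "z \<in> V" "functional \<phi>"
  shows "\<phi> (Dz F x z) = deriv (\<lambda>t. \<phi> (F x t)) z"
  unfolding Dz_def by (rule functional_Rderiv) (use assms Rhol2_section_snd in auto)

lemma Rhol2_Dx:
  assumes "open U" "open V" "Rhol2 U V F" shows "Rhol2 U V (Dx F)"
  unfolding Rhol2_def
proof (intro allI impI)
  fix \<phi> :: "'a \<Rightarrow> complex" assume \<phi>: "functional \<phi>"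
  show "hol2 U V (\<lambda>x z. \<phi> (Dx F x z))"
    by (rule hol2_cong[OF _ hol2_deriv_fst[OF assms(1,2) Rhol2D[OF assms(3) \<phi>]]])
      (simp add: functional_Dx[OF assms(1,3) _ _ \<phi>])
qed

lemma Rhol2_Dz:
  assumes "open U" "open V" "Rhol2 U V F" shows "Rhol2 U V (Dz F)"
  unfolding Rhol2_def
proof (intro allI impI)
  fix \<phi> :: "'a \<Rightarrow> complex" assume \<phi>: "functional \<phi>"
  show "hol2 U V (\<lambda>x z. \<phi> (Dz F x z))"
    by (rule hol2_cong[OF _ hol2_deriv_snd[OF assms(1,2) Rhol2D[OF assms(3) \<phi>]]])
      (simp add: functional_Dz[OF assms(2,3) _ _ \<phi>])
qed

lemma Rhol2_Dx_pow: "open U \<Longrightarrow> open V \<Longrightarrow> Rhol2 U V F \<Longrightarrow> Rhol2 U V ((Dx ^^ k) F)"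
  by (induction k) (auto intro: Rhol2_Dx)

lemma Rhol2_Dz_pow: "open U \<Longrightarrow> open V \<Longrightarrow> Rhol2 U V F \<Longrightarrow> Rhol2 U V ((Dz ^^ k) F)"
  by (induction k) (auto intro: Rhol2_Dz)

lemma Dx_Dz_commute:
  assumes UV: "open U" "open V" and F: "Rhol2 U V F" and x: "x \<in> U" and z: "z \<in> V"
  shows "Dx (Dz F) x z = Dz (Dx F) x z"
proof (rule functional_eqI)
  fix \<phi> :: "'a \<Rightarrow> complex" assume \<phi>: "functional \<phi>"
  have "\<phi> (Dx (Dz F) x z) = deriv (\<lambda>t. \<phi> (Dz F t z)) x"
    by (rule functional_Dx[OF UV(1) Rhol2_Dz[OF UV F] x z \<phi>])
  also have "\<dots> = deriv (\<lambda>t. deriv (\<lambda>s. \<phi> (F t s)) z) x"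
    by (rule deriv_cong_ev)
      (use UV x z functional_Dz[OF UV(2) F _ _ \<phi>] in \<open>auto simp: eventually_nhds\<close>)
  also have "\<dots> = deriv (\<lambda>s. deriv (\<lambda>t. \<phi> (F t s)) x) z"
    using hol2_deriv_commute[OF UV Rhol2D[OF F \<phi>] x z] by simp
  also have "\<dots> = deriv (\<lambda>s. \<phi> (Dx F x s)) z"
    by (rule deriv_cong_ev)
      (use UV x z functional_Dx[OF UV(1) F _ _ \<phi>] in \<open>auto simp: eventually_nhds\<close>)
  also have "\<dots> = \<phi> (Dz (Dx F) x z)"
    by (rule functional_Dz[OF UV(2) Rhol2_Dx[OF UV F] x z \<phi>, symmetric])
  finally show "\<phi> (Dx (Dz F) x z) = \<phi> (Dz (Dx F) x z)" .
qed

lemma Dx_Dz_pow_commute: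
  assumes UV: "open U" "open V" and F: "Rhol2 U V F" and x: "x \<in> U" and z: "z \<in> V"
  shows "Dx ((Dz ^^ k) F) x z = (Dz ^^ k) (Dx F) x z"
  using z
proof (induction k arbitrary: z)
  case (Suc k)
  have "Dx ((Dz ^^ Suc k) F) x z = Dz (Dx ((Dz ^^ k) F)) x z"
    using Dx_Dz_commute[OF UV Rhol2_Dz_pow[OF UV F] x Suc.prems] by simp
  also have "\<dots> = Dz ((Dz ^^ k) (Dx F)) x z"
    by (rule Dz_cong[OF UV(2) Suc.prems]) (rule Suc.IH)
  finally show ?case by simp
qed simp

lemma dop_x_eq: "dop_x A F x z = (\<Sum>k\<in>dop_supp A. A k x * (Dx ^^ k) F x z)"
  by (simp add: dop_x_def left_action_def Dx_pow)

lemma dop_z_eq: "dop_z F A x z = (\<Sum>k\<in>dop_supp A. (-1) ^ k * (Dz ^^ k) (\<lambda>x t. F x t * A k t) x z)"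
  by (simp add: dop_z_def right_action_def Dz_pow)

lemma Rhol2_dop_x:
  assumes "open U" "open V" "dop_on U A" "Rhol2 U V F" shows "Rhol2 U V (dop_x A F)"
  unfolding dop_x_eq[abs_def]
  by (intro Rhol2_sum Rhol2_mult Rhol2_fst dop_on_Rhol[OF assms(3)] Rhol2_Dx_pow assms)

lemma Rhol2_dop_z:
  assumes "open U" "open V" "dop_on V A" "Rhol2 U V F" shows "Rhol2 U V (dop_z F A)"
  unfolding dop_z_eq[abs_def]
  by (intro Rhol2_sum Rhol2_mult[OF Rhol2_fst[OF Rhol_const]] Rhol2_Dz_pow assms(1,2)
      Rhol2_mult[OF assms(4) Rhol2_snd[OF dop_on_Rhol[OF assms(3)]]])

lemma right_action_linear:
  assumes U: "open U" "z \<in> U" and B: "dop_on U B" and f: "\<And>i. i \<in> I \<Longrightarrow> Rhol U (f i)"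
  shows "right_action (\<lambda>t. \<Sum>i\<in>I. a i * f i t) B z = (\<Sum>i\<in>I. a i * right_action (f i) B z)"
proof -
  have "(Rderiv ^^ k) (\<lambda>t. (\<Sum>i\<in>I. a i * f i t) * B k t) z =
     (\<Sum>i\<in>I. a i * (Rderiv ^^ k) (\<lambda>t. f i t * B k t) z)" for k
  proof -
    have fB: "Rhol U (\<lambda>t. f i t * B k t)" if "i \<in> I" for i
      by (rule Rhol_mult[OF f[OF that] dop_on_Rhol[OF B]])
    have "(Rderiv ^^ k) (\<lambda>t. (\<Sum>i\<in>I. a i * f i t) * B k t) z =
      (Rderiv ^^ k) (\<lambda>t. \<Sum>i\<in>I. a i * (f i t * B k t)) z"
      by (rule Rderiv_pow_cong[OF U]) (simp add: sum_distrib_right mult.assoc)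
    also have "\<dots> = (\<Sum>i\<in>I. (Rderiv ^^ k) (\<lambda>t. a i * (f i t * B k t)) z)"
      by (rule Rderiv_pow_sum[OF U(1) Rhol_mult[OF Rhol_const fB] U(2)])
    also have "\<dots> = (\<Sum>i\<in>I. a i * (Rderiv ^^ k) (\<lambda>t. f i t * B k t) z)"
      by (intro sum.cong refl Rderiv_pow_mult_left[OF U(1) fB U(2)])
    finally show ?thesis .
  qed
  moreover have "(-1) ^ k * (a i * y) = a i * ((-1) ^ k * y)" for k i y
    by (cases "even k") auto
  ultimately show ?thesis
    by (simp add: right_action_def sum_distrib_left, subst sum.swap, simp)
qed

text \<open>The coefficients of \<open>B\<close> depend on \<open>z\<close> only, so the
  \<open>x\<close>-derivative passes them, and it passes the \<open>z\<close>-derivatives by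
  equality of mixed derivatives.\<close>

lemma Dx_dop_z:
  assumes UV: "open U" "open V" and F: "Rhol2 U V F" and B: "dop_on V B" and x: "x \<in> U" and z: "z \<in> V"
  shows "Dx (dop_z F B) x z = dop_z (Dx F) B x z"
proof -
  define G where "G k = (\<lambda>x t. F x t * B k t)" for k
  have G: "Rhol2 U V (G k)" for k
    unfolding G_def by (rule Rhol2_mult[OF F Rhol2_snd[OF dop_on_Rhol[OF B]]])
  have "Dx (dop_z F B) x z = (\<Sum>k\<in>dop_supp B. Rderiv (\<lambda>t. (-1) ^ k * (Dz ^^ k) (G k) t z) x)"
    unfolding Dx_def dop_z_eq G_def[symmetric]
    by (rule Rderiv_sum[OF UV(1) Rhol_mult[OF Rhol_const Rhol2_section_fst[OF Rhol2_Dz_pow[OF UV G] z]] x])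
  also have "\<dots> = (\<Sum>k\<in>dop_supp B. (-1) ^ k * Dx ((Dz ^^ k) (G k)) x z)"
    unfolding Dx_def
    using Rderiv_pow_mult_left[OF UV(1) Rhol2_section_fst[OF Rhol2_Dz_pow[OF UV G] z] x, of 1] by simp
  also have "\<dots> = (\<Sum>k\<in>dop_supp B. (-1) ^ k * (Dz ^^ k) (Dx (G k)) x z)"
    by (simp only: Dx_Dz_pow_commute[OF UV G x z])
  also have "\<dots> = dop_z (Dx F) B x z"
  proof -
    have "Dx (G k) x t = Dx F x t * B k t" if "t \<in> V" for k t
      using Rderiv_pow_mult_right[OF UV(1) Rhol2_section_fst[OF F that] x, of 1]
      by (simp add: Dx_def G_def)
    then have "(Rderiv ^^ k) (Dx (G k) x) z = (Rderiv ^^ k) (\<lambda>t. Dx F x t * B k t) z" for k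
      by (rule Rderiv_pow_cong[OF UV(2) z])
    then show ?thesis by (simp add: dop_z_def right_action_def Dz_pow)
  qed
  finally show ?thesis .
qed

lemma Dx_pow_dop_z:
  assumes UV: "open U" "open V" and F: "Rhol2 U V F" and B: "dop_on V B" and x: "x \<in> U" and z: "z \<in> V"
  shows "(Dx ^^ k) (dop_z F B) x z = dop_z ((Dx ^^ k) F) B x z"
  using x
proof (induction k arbitrary: x)
  case (Suc k)
  have "(Dx ^^ Suc k) (dop_z F B) x z = Dx (dop_z ((Dx ^^ k) F) B) x z"
    unfolding funpow.simps o_apply by (rule Dx_cong[OF UV(1) Suc.prems]) (rule Suc.IH)
  then show ?case using Dx_dop_z[OF UV Rhol2_Dx_pow[OF UV F] B Suc.prems z] by simp
qed simp

text \<open>The coefficients of \<open>A\<close> depend on \<open>x\<close> and multiply from the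
  left, those of \<open>B\<close> depend on \<open>z\<close> and multiply from the right, so the
  operators do not interfere. This is what carries identities from one variable to the
  other.\<close>

lemma dop_x_dop_z_commute:
  assumes UV: "open U" "open V" and F: "Rhol2 U V F" and A: "dop_on U A" and B: "dop_on V B"
    and x: "x \<in> U" and z: "z \<in> V"
  shows "dop_x A (dop_z F B) x z = dop_z (dop_x A F) B x z"
proof -
  have "dop_z (dop_x A F) B x z = (\<Sum>k\<in>dop_supp A. A k x * right_action ((Dx ^^ k) F x) B z)"
    unfolding dop_z_def dop_x_eq[abs_def]
    by (rule right_action_linear[OF UV(2) z B Rhol2_section_snd[OF Rhol2_Dx_pow[OF UV F] x]])
  then show ?thesis
    unfolding dop_x_eq Dx_pow_dop_z[OF UV F B x z] by (simp add: dop_z_def)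
qed

lemma dop_x_cong:
  assumes "open U" "x \<in> U" "dop_on U A" "\<And>t. t \<in> U \<Longrightarrow> F t z = G t z"
  shows "dop_x A F x z = dop_x A G x z"
  unfolding dop_x_def using assms by (auto intro: left_action_cong[of U x "\<lambda>t. F t z" "\<lambda>t. G t z" A A])

section \<open>Operators determined by their action on polynomials\<close>

text \<open>\<open>g\<close> vanishes on the nonempty open set where \<open>f\<close> does not, and
  the identity theorem spreads this over the connected set \<open>U\<close>.\<close>

lemma holomorphic_mult_eq_0:
  assumes U: "open U" "connected U" and f: "f holomorphic_on U" and g: "g holomorphic_on U"
    and fg: "\<And>z. z \<in> U \<Longrightarrow> f z * g z = 0" and w: "w \<in> U" "f w \<noteq> 0" and z: "z \<in> U"
  shows "g z = (0 :: complex)"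
proof -
  have "continuous_on U f" using f by (rule holomorphic_on_imp_continuous_on)
  then have "open (f -` (- {0}) \<inter> U)"
    using continuous_on_open_vimage[OF U(1)] open_Compl by blast
  then show ?thesis
    using analytic_continuation_open[of "f -` (- {0}) \<inter> U" U g "\<lambda>_. 0"] assms by auto
qed

text \<open>Gaussian elimination without division in the integral domain of holomorphic functions.\<close>

lemma holomorphic_linear_dependence:
  fixes v :: "'i \<Rightarrow> 'j \<Rightarrow> complex \<Rightarrow> complex"
  assumes U: "open U" "connected U" "U \<noteq> {}"
  assumes "finite J" "finite I" "card J < card I"
    and "\<And>i j. i \<in> I \<Longrightarrow> j \<in> J \<Longrightarrow> v i j holomorphic_on U"
  shows "\<exists>c. (\<forall>i\<in>I. c i holomorphic_on U) \<and> (\<exists>i\<in>I. \<exists>z\<in>U. c i z \<noteq> 0) \<and>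
     (\<forall>j\<in>J. \<forall>z\<in>U. (\<Sum>i\<in>I. c i z * v i j z) = 0)"
  using assms(4-)
proof (induction J arbitrary: I v rule: finite_induct)
  case empty
  then have "I \<noteq> {}" by auto
  then show ?case using U(3) by (intro exI[of _ "\<lambda>_ _. 1"]) auto
next
  case (insert j J)
  show ?case
  proof (cases "\<exists>p\<in>I. \<exists>w\<in>U. v p j w \<noteq> 0")
    case False
    \<comment> \<open>All entries of equation \<open>j\<close> vanish, so any solution of the
      remaining equations satisfies it too.\<close>
    obtain c where "\<forall>i\<in>I. c i holomorphic_on U" "\<exists>i\<in>I. \<exists>z\<in>U. c i z \<noteq> 0"
      "\<forall>j\<in>J. \<forall>z\<in>U. (\<Sum>i\<in>I. c i z * v i j z) = 0"
      using insert.IH[of I v] insert.prems insert.hyps by auto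
    with False show ?thesis by (intro exI[of _ c]) auto
  next
    case True
    then obtain p w where p: "p \<in> I" "w \<in> U" "v p j w \<noteq> 0" by blast
    \<comment> \<open>Cross-multiplication by the pivot \<open>v p j\<close> replaces division and
      eliminates the unknown \<open>p\<close>; the entries of equation \<open>j\<close> itself
      become zero.\<close>
    define v' where "v' i k z = v p j z * v i k z - v i j z * v p k z" for i k z
    have hv: "v i k holomorphic_on U" if "i \<in> I" "k \<in> insert j J" for i k
      using insert.prems(3) that by blast
    have hv': "v' i k holomorphic_on U" if "i \<in> I - {p}" "k \<in> J" for i k
      unfolding v'_def[abs_def] using that p(1) by (intro holomorphic_intros hv) auto
    have "card J < card (I - {p})" using insert p by simp
    then obtain c where c: "\<forall>i\<in>I - {p}. c i holomorphic_on U" "\<exists>i\<in>I - {p}. \<exists>z\<in>U. c i z \<noteq> 0"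
      "\<forall>k\<in>J. \<forall>z\<in>U. (\<Sum>i\<in>I - {p}. c i z * v' i k z) = 0"
      using insert.IH[of "I - {p}" v'] hv' insert.prems(1) by auto
    \<comment> \<open>Back substitution: the reduced solution is multiplied by the pivot so that the
      value at \<open>p\<close> solving equation \<open>j\<close> is again holomorphic. The solution
      stays nontrivial because a product with the pivot cannot vanish identically.\<close>
    define d where "d i = (if i = p then (\<lambda>z. - (\<Sum>i\<in>I - {p}. c i z * v i j z))
        else (\<lambda>z. c i z * v p j z))" for i
    have "d i holomorphic_on U" if "i \<in> I" for i
      using that c(1) p(1) unfolding d_def by (auto intro!: holomorphic_intros hv)
    moreover have "\<exists>i\<in>I. \<exists>z\<in>U. d i z \<noteq> 0"
    proof -
      obtain i y where i: "i \<in> I - {p}" "y \<in> U" "c i y \<noteq> 0" using c(2) by blast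
      have "\<exists>z\<in>U. c i z * v p j z \<noteq> 0"
        using holomorphic_mult_eq_0[OF U(1,2) _ hv[OF p(1)], of "c i" j y w] c(1) i p by auto
      then show ?thesis using i unfolding d_def by auto
    qed
    moreover have "(\<Sum>i\<in>I. d i z * v i k z) = 0" if k: "k \<in> insert j J" and z: "z \<in> U" for k z
    proof -
      have "(\<Sum>i\<in>I. d i z * v i k z) = d p z * v p k z + (\<Sum>i\<in>I - {p}. d i z * v i k z)"
        by (rule sum.remove) (use insert.prems p in auto)
      also have "(\<Sum>i\<in>I - {p}. d i z * v i k z) = (\<Sum>i\<in>I - {p}. c i z * v p j z * v i k z)"
        by (intro sum.cong) (auto simp: d_def)
      also have "d p z * v p k z = - (\<Sum>i\<in>I - {p}. c i z * v i j z * v p k z)"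
        by (simp add: d_def sum_distrib_right)
      also have "- (\<Sum>i\<in>I - {p}. c i z * v i j z * v p k z) + (\<Sum>i\<in>I - {p}. c i z * v p j z * v i k z)
         = (\<Sum>i\<in>I - {p}. c i z * v' i k z)"
        by (simp add: v'_def algebra_simps sum_subtractf)
      also have "\<dots> = 0"
      proof (cases "k = j")
        case True then show ?thesis by (simp add: v'_def mult.commute)
      next
        case False then show ?thesis using c(3) k z by blast
      qed
      finally show ?thesis .
    qed
    ultimately show ?thesis by blast
  qed
qed

section \<open>Powers as test functions\<close>

lemma higher_deriv_power_mult:
  assumes g: "g holomorphic_on U" "open U" "z0 \<in> U" and k: "k \<le> N"
  shows "(deriv ^^ k) (\<lambda>t. (t - z0) ^ N * g t) z0 = (if k = N then fact N * g z0 else 0)"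
proof -
  have "(deriv ^^ k) (\<lambda>t. (t - z0) ^ N * g t) z0 =
     (\<Sum>i = 0..k. of_nat (k choose i) * (deriv ^^ i) (\<lambda>t. (t - z0) ^ N) z0 * (deriv ^^ (k - i)) g z0)"
    by (rule higher_deriv_mult[OF _ g]) (intro holomorphic_intros)
  also have "\<dots> = (\<Sum>i = 0..k. if i = N then fact N * g z0 else 0)"
    using k by (intro sum.cong refl) (auto simp: higher_deriv_power pochhammer_fact[symmetric])
  finally show ?thesis using k by simp
qed

text \<open>The algebra-valued power that serves as a test function: evaluation of derivatives at
  \<open>z0\<close> isolates single coefficients of an operator.\<close>

definition cpow :: "complex \<Rightarrow> nat \<Rightarrow> complex \<Rightarrow> 'r::fin_dim_complex_algebra" where
  "cpow z0 N t = scaleC ((t - z0) ^ N) 1"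

lemma Rhol_cpow: "Rhol U (cpow z0 N)"
  unfolding cpow_def[abs_def] by (intro Rhol_scaleC Rhol_const holomorphic_intros)

lemma Rderiv_pow_cpow_mult:
  assumes "open U" "z0 \<in> U" "Rhol U f" "k \<le> N"
  shows "(Rderiv ^^ k) (\<lambda>t. cpow z0 N t * f t) z0 = (if k = N then scaleC (fact N) (f z0) else 0)"
proof (rule functional_eqI)
  fix \<phi> :: "'a \<Rightarrow> complex" assume \<phi>: "functional \<phi>"
  have "\<phi> ((Rderiv ^^ k) (\<lambda>t. cpow z0 N t * f t) z0) = (deriv ^^ k) (\<lambda>t. (t - z0) ^ N * \<phi> (f t)) z0"
    using functional_Rderiv_pow[OF assms(1) Rhol_mult[OF Rhol_cpow assms(3)] assms(2) \<phi>]
    by (simp add: cpow_def scaleC_mult_left functional_scaleC[OF \<phi>])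
  then show "\<phi> ((Rderiv ^^ k) (\<lambda>t. cpow z0 N t * f t) z0) = \<phi> (if k = N then scaleC (fact N) (f z0) else 0)"
    using higher_deriv_power_mult[OF RholD[OF assms(3) \<phi>] assms(1,2,4)]
    by (simp add: functional_scaleC[OF \<phi>] functional_zero[OF \<phi>])
qed

lemma Rderiv_pow_cpow: "(Rderiv ^^ j) (cpow z0 N) z0 = (if j = N then scaleC (fact N) 1 else 0)"
proof (cases "j \<le> N")
  case True
  then show ?thesis
    using Rderiv_pow_cpow_mult[OF open_UNIV UNIV_I Rhol_const, of j N z0 1] by simp
next
  case False
  show ?thesis
  proof (rule functional_eqI)
    fix \<phi> :: "'a \<Rightarrow> complex" assume \<phi>: "functional \<phi>"
    have "\<phi> ((Rderiv ^^ j) (cpow z0 N) z0) = (deriv ^^ j) (\<lambda>t. \<phi> 1 * (t - z0) ^ N) z0"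
      using functional_Rderiv_pow[OF open_UNIV Rhol_cpow UNIV_I \<phi>]
      by (simp add: cpow_def functional_scaleC[OF \<phi>] mult.commute)
    also have "\<dots> = 0"
      using False by (subst higher_deriv_cmult[where A = UNIV]) (auto intro!: holomorphic_intros simp: higher_deriv_power pochhammer_0_left)
    finally show "\<phi> ((Rderiv ^^ j) (cpow z0 N) z0) = \<phi> (if j = N then scaleC (fact N) 1 else 0)"
      using False by (simp add: functional_zero[OF \<phi>])
  qed
qed

text \<open>Under at most \<open>p + l\<close> derivatives, the power times an analytic function
  survives at \<open>z0\<close> only if exactly \<open>p + l\<close> of them are applied. With
  \<open>i \<le> p\<close> from the operator and \<open>k \<le> l\<close> from outside this means
  \<open>i = p\<close> and \<open>k = l\<close>, so the top coefficient is read off alone.\<close>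

lemma Rderiv_pow_right_action_cpow:
  assumes U: "open U" "z0 \<in> U" and A: "dop_on U A" "dop_supp A \<subseteq> {..<Suc p}" and k: "k \<le> l"
  shows "(Rderiv ^^ k) (right_action (cpow z0 (p + l)) A) z0 =
     (if k = l then (-1) ^ p * scaleC (fact (p + l)) (A p z0) else 0)"
proof -
  have cA: "Rhol U (\<lambda>t. cpow z0 (p + l) t * A i t)" for i
    by (rule Rhol_mult[OF Rhol_cpow dop_on_Rhol[OF A(1)]])
  have "(Rderiv ^^ k) (right_action (cpow z0 (p + l)) A) z0 =
     (Rderiv ^^ k) (\<lambda>z. \<Sum>i<Suc p. (-1) ^ i * (Rderiv ^^ i) (\<lambda>t. cpow z0 (p + l) t * A i t) z) z0"
    by (rule Rderiv_pow_cong[OF U]) (rule right_action_superset[OF _ A(2)], simp)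
  also have "\<dots> = (\<Sum>i<Suc p. (Rderiv ^^ k) (\<lambda>z. (-1) ^ i * (Rderiv ^^ i) (\<lambda>t. cpow z0 (p + l) t * A i t) z) z0)"
    by (rule Rderiv_pow_sum[OF U(1) Rhol_mult[OF Rhol_const Rhol_Rderiv_pow[OF U(1) cA]] U(2)])
  also have "\<dots> = (\<Sum>i<Suc p. (-1) ^ i * (Rderiv ^^ (k + i)) (\<lambda>t. cpow z0 (p + l) t * A i t) z0)"
    by (simp only: Rderiv_pow_mult_left[OF U(1) Rhol_Rderiv_pow[OF U(1) cA] U(2)] Rderiv_pow_add_exp)
  also have "\<dots> = (\<Sum>i<Suc p. if i = p then (if k = l then (-1) ^ p * scaleC (fact (p + l)) (A p z0) else 0) else 0)"
    using k by (intro sum.cong refl, subst Rderiv_pow_cpow_mult[OF U dop_on_Rhol[OF A(1)]])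
      (auto simp: add.commute)
  finally show ?thesis by simp
qed

lemma scaleC_eq_0_iff: "scaleC c (a :: 'r::complex_algebra_1) = 0 \<longleftrightarrow> c = 0 \<or> a = 0"
  using vector_space.scale_eq_0_iff[OF vector_space_scaleC] .

lemma minus_one_power_mult_eq_0_iff: "(-1) ^ n * (a :: 'a::ring_1) = 0 \<longleftrightarrow> a = 0"
  by (cases "even n") auto

text \<open>Descent on the order bound: at each point the power with exponent equal to the top order
  reads off the top coefficient, which therefore vanishes.\<close>

lemma analytic_dop_eq_zeroI:
  assumes U: "open U" and A: "analytic_dop U A" and "dop_supp A \<subseteq> {..<M}"
    and zero: "\<And>N z. N < M \<Longrightarrow> z \<in> U \<Longrightarrow> right_action (cpow z N) A z = 0"
  shows "A = dop_zero"
  using assms(3) zero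
proof (induction M)
  case 0 then show ?case by (auto simp: dop_supp_def dop_zero_def fun_eq_iff)
next
  case (Suc p)
  have A': "dop_on U A" "\<And>k t. t \<notin> U \<Longrightarrow> A k t = 0" using A analytic_dop_iff[OF U] by blast+
  have "A p z = 0" for z
  proof (cases "z \<in> U")
    case True
    then show ?thesis
      using Rderiv_pow_right_action_cpow[OF U True A'(1) Suc.prems(1), of 0 0] Suc.prems(2)[OF _ True, of p]
      by (simp add: minus_one_power_mult_eq_0_iff scaleC_eq_0_iff)
  qed (use A' in auto)
  then have "dop_supp A \<subseteq> {..<p}"
    using Suc.prems(1) unfolding dop_supp_subset_iff by (metis Suc_leI ext le_eq_less_or_eq)
  then show ?case using Suc.IH Suc.prems(2) by simp
qed

section \<open>Differences of operators, and actions on smaller sets\<close>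

definition dop_diff :: "'r::fin_dim_complex_algebra dop \<Rightarrow> 'r dop \<Rightarrow> 'r dop" where
  "dop_diff A B = (\<lambda>k x. A k x - B k x)"

lemma dop_supp_diff: "dop_supp (dop_diff A B) \<subseteq> dop_supp A \<union> dop_supp B"
  by (auto simp: dop_supp_def dop_diff_def)

lemma dop_diff_eq_zero_iff: "dop_diff A B = dop_zero \<longleftrightarrow> A = B"
  by (auto simp: dop_diff_def dop_zero_def fun_eq_iff)

lemma dop_on_diff: "dop_on U A \<Longrightarrow> dop_on U B \<Longrightarrow> dop_on U (dop_diff A B)"
  using dop_supp_diff[of A B] unfolding dop_on_def
  by (auto intro: finite_subset Rhol_diff simp: dop_diff_def)

lemma analytic_dop_diff: "open U \<Longrightarrow> analytic_dop U A \<Longrightarrow> analytic_dop U B \<Longrightarrow> analytic_dop U (dop_diff A B)"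
  by (simp add: analytic_dop_iff dop_on_diff) (simp add: dop_diff_def)

lemma right_action_diff:
  assumes U: "open U" "z \<in> U" and A: "dop_on U A" and B: "dop_on U B" and f: "Rhol U f"
  shows "right_action f (dop_diff A B) z = right_action f A z - right_action f B z"
proof -
  let ?K = "dop_supp A \<union> dop_supp B"
  have K: "finite ?K" using A B by (auto simp: dop_on_def)
  have fA: "Rhol U (\<lambda>t. f t * A k t)" and fB: "Rhol U (\<lambda>t. f t * B k t)" for k
    using f A B by (auto intro: Rhol_mult dop_on_Rhol)
  have "(Rderiv ^^ k) (\<lambda>t. f t * dop_diff A B k t) z =
     (Rderiv ^^ k) (\<lambda>t. f t * A k t) z - (Rderiv ^^ k) (\<lambda>t. f t * B k t) z" for k
    using Rderiv_pow_add[OF U(1) fA Rhol_mult[OF Rhol_const fB] U(2), of k k "-1"]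
      Rderiv_pow_mult_left[OF U(1) fB U(2), of k "-1"]
    by (simp add: dop_diff_def right_diff_distrib)
  then show ?thesis
    using right_action_superset[OF K, of A] right_action_superset[OF K, of B]
      right_action_superset[OF K dop_supp_diff]
    by (simp add: right_diff_distrib sum_subtractf)
qed

text \<open>Operators composed on the larger set will act on functions analytic only on a smaller
  one, such as those that involve an inverse.\<close>

lemma right_action_dop_mult_subset:
  assumes U: "open U" and V: "open V" "V \<subseteq> U" "x \<in> V"
    and A: "dop_on U A" and B: "dop_on U B" and f: "Rhol V f"
  shows "right_action f (dop_mult U A B) x = right_action (right_action f A) B x"
proof -
  have AV: "dop_on V A" and BV: "dop_on V B" using A B V dop_on_subset by blast+
  have "right_action f (dop_mult U A B) x = right_action f (dop_mult V A B) x"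
    by (rule right_action_cong[OF V(1,3) refl dop_on_subset[OF dop_on_mult[OF U A B] V(2)] dop_on_mult[OF V(1) AV BV]])
      (use V in \<open>auto simp: dop_mult_def\<close>)
  then show ?thesis using right_action_dop_mult[OF V(1,3) AV BV f] by simp
qed

text \<open>The operator \<open>\<Sum>\<^sub>k \<partial>\<^sup>k a\<^sub>k\<close>, with its coefficients to the right of the derivatives.\<close>

definition rdop :: "complex set \<Rightarrow> nat \<Rightarrow> (nat \<Rightarrow> complex \<Rightarrow> 'r) \<Rightarrow> 'r::fin_dim_complex_algebra dop" where
  "rdop U K a = (\<lambda>m z. \<Sum>k<K. dop_mult U (\<lambda>j t. if j = k then 1 else 0) (fun_dop (a k)) m z)"

lemma dop_supp_deriv: "dop_supp (\<lambda>j t. if j = k then 1 else 0) \<subseteq> {..<Suc k}"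
  by (auto simp: dop_supp_def split: if_splits)

lemma dop_on_deriv: "dop_on U (\<lambda>j t. if j = k then 1 else 0)"
  using finite_subset[OF dop_supp_deriv] by (auto simp: dop_on_def Rhol_const)

lemma dop_supp_rdop: "dop_supp (rdop U K a) \<subseteq> {..<Suc K}"
  unfolding dop_supp_subset_iff
proof (intro allI impI ext)
  fix m z assume m: "m \<ge> Suc K"
  have "dop_mult U (\<lambda>j t. if j = k then 1 else 0) (fun_dop (a k)) m z = 0" if "k < K" for k
    using dop_supp_dop_mult[OF dop_supp_deriv[of k] dop_supp_fun_dop[of "a k"], of U] m that
    unfolding dop_supp_subset_iff by simp
  then show "rdop U K a m z = 0" by (simp add: rdop_def)
qed

lemma analytic_dop_rdop:
  assumes U: "open U" and a: "\<And>k. k < K \<Longrightarrow> Rhol U (a k)"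
  shows "analytic_dop U (rdop U K a)"
proof -
  have "analytic_dop U (dop_mult U (\<lambda>j t. if j = k then 1 else 0) (fun_dop (a k)))" if "k < K" for k
    by (rule analytic_dop_mult[OF U dop_on_deriv]) (simp add: dop_on_fun_dop a that)
  then have *: "Rhol U (dop_mult U (\<lambda>j t. if j = k then 1 else 0) (fun_dop (a k)) m)" if "k < K" for k m
    using that by (simp add: analytic_dop_iff[OF U] dop_on_def)
  have "Rhol U (rdop U K a m)" for m
    unfolding rdop_def by (rule Rhol_sum) (use * in auto)
  then show ?thesis
    using finite_subset[OF dop_supp_rdop]
    by (auto simp: analytic_dop_iff[OF U] dop_on_def) (simp add: rdop_def dop_mult_def)
qed

text \<open>Under the right action this operator differentiates before it multiplies, so no
  derivative of the coefficients \<open>a k\<close> occurs.\<close>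

lemma right_action_rdop:
  assumes U: "open U" and a: "\<And>k. k < K \<Longrightarrow> Rhol U (a k)"
    and V: "open V" "V \<subseteq> U" "z \<in> V" and f: "Rhol V f"
  shows "right_action f (rdop U K a) z = (\<Sum>k<K. (-1) ^ k * (Rderiv ^^ k) f z * a k z)"
proof -
  let ?D = "\<lambda>k j t. if j = k then 1 else 0 :: 'a"
  let ?M = "\<lambda>k. dop_mult U (?D k) (fun_dop (a k))"
  have D: "right_action f (?D k) z = (-1) ^ k * (Rderiv ^^ k) f z" for k z
  proof -
    have "right_action f (?D k) z = (\<Sum>j\<in>{k}. (-1) ^ j * (Rderiv ^^ j) (\<lambda>t. f t * ?D k j t) z)"
      by (rule right_action_superset) (auto simp: dop_supp_def split: if_splits)
    then show ?thesis by simp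
  qed
  have M: "analytic_dop U (?M k)" if "k < K" for k
    by (rule analytic_dop_mult[OF U dop_on_deriv]) (simp add: dop_on_fun_dop a that)
  have fM: "Rhol V (\<lambda>t. f t * ?M k m t)" if "k < K" for k m
    using M[OF that] V by (intro Rhol_mult[OF f]) (auto simp: analytic_dop_iff[OF U] dop_on_def intro: Rhol_subset)
  have supp: "dop_supp (?M k) \<subseteq> {..<Suc K}" if "k < K" for k
    using dop_supp_dop_mult[OF dop_supp_deriv[of k] dop_supp_fun_dop[of "a k"], of U] that by fastforce
  have "(Rderiv ^^ m) (\<lambda>t. f t * rdop U K a m t) z = (\<Sum>k<K. (Rderiv ^^ m) (\<lambda>t. f t * ?M k m t) z)" for m
    unfolding rdop_def sum_distrib_left by (rule Rderiv_pow_sum[OF V(1) fM V(3)]) simp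
  then have "right_action f (rdop U K a) z =
      (\<Sum>m<Suc K. \<Sum>k<K. (-1) ^ m * (Rderiv ^^ m) (\<lambda>t. f t * ?M k m t) z)"
    by (simp only: right_action_superset[OF finite_lessThan dop_supp_rdop] sum_distrib_left)
  also have "\<dots> = (\<Sum>k<K. right_action f (?M k) z)"
    by (subst sum.swap) (intro sum.cong refl, rule right_action_superset[symmetric], use supp in auto)
  also have "\<dots> = (\<Sum>k<K. (-1) ^ k * (Rderiv ^^ k) f z * a k z)"
    by (intro sum.cong refl, subst right_action_dop_mult_subset[OF U V dop_on_deriv _ f])
      (simp_all add: dop_on_fun_dop a right_action_fun_dop D)
  finally show ?thesis .
qed

text \<open>At its centre \<open>z\<close> the power of exponent \<open>k\<close> has only its
  \<open>k\<close>-th derivative nonzero, hence it isolates \<open>a k z\<close>.\<close>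

lemma rdop_eq_zeroD:
  assumes U: "open U" and a: "\<And>k. k < K \<Longrightarrow> Rhol U (a k)" and "rdop U K a = dop_zero" and k: "k < K" and z: "z \<in> U"
  shows "a k z = 0"
proof -
  have "0 = right_action (cpow z k) (rdop U K a) z"
    using assms(3) by (simp add: right_action_def dop_supp_def dop_zero_def)
  also have "\<dots> = (\<Sum>j<K. (-1) ^ j * (Rderiv ^^ j) (cpow z k) z * a j z)"
    by (rule right_action_rdop[OF U a U subset_refl z Rhol_cpow])
  also have "\<dots> = (\<Sum>j<K. if j = k then (-1) ^ k * scaleC (fact k) 1 * a k z else 0)"
    by (intro sum.cong refl) (simp add: Rderiv_pow_cpow)
  finally show ?thesis
    using k by (simp add: mult.assoc scaleC_mult_left minus_one_power_mult_eq_0_iff scaleC_eq_0_iff)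
qed

section \<open>Common right multiples\<close>

lemma cpow_shift:
  "cpow w N t = (\<Sum>i\<le>N. scaleC (of_nat (N choose i) * (- w) ^ (N - i)) 1 * cpow 0 i t)"
proof -
  have s: "scaleC (\<Sum>i\<in>I. g i) (1 :: 'a) = (\<Sum>i\<in>I. scaleC (g i) 1)" for g :: "nat \<Rightarrow> complex" and I
    by (rule Rvs.scale_sum_left)
  have "(t - w) ^ N = (\<Sum>i\<le>N. of_nat (N choose i) * (- w) ^ (N - i) * t ^ i)"
    using binomial_ring[of t "- w" N] by (simp add: mult_ac)
  then have "cpow w N t = (\<Sum>i\<le>N. scaleC (of_nat (N choose i) * (- w) ^ (N - i) * t ^ i) (1 :: 'a))"
    by (simp only: cpow_def s)
  then show ?thesis by (simp add: cpow_def scaleC_mult_left scaleC_scaleC)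
qed

text \<open>Powers centred at \<open>z\<close> are test functions that vary with the point. Their
  binomial expansion involves only the \<open>M\<close> fixed monomials, so that vanishing of an
  operator becomes finitely many equations between functions of \<open>z\<close>.\<close>

lemma analytic_dop_eq_zeroI_monomials:
  assumes U: "open U" and A: "analytic_dop U A" and M: "dop_supp A \<subseteq> {..<M}"
    and zero: "\<And>j z. j < M \<Longrightarrow> z \<in> U \<Longrightarrow> right_action (cpow 0 j) A z = 0"
  shows "A = dop_zero"
proof (rule analytic_dop_eq_zeroI[OF U A M])
  fix N z assume N: "N < M" and z: "z \<in> U"
  have A': "dop_on U A" using A by (simp add: analytic_dop_iff[OF U])
  have "right_action (cpow z N) A z =
      right_action (\<lambda>t. \<Sum>i\<le>N. scaleC (of_nat (N choose i) * (- z) ^ (N - i)) 1 * cpow 0 i t) A z"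
    by (rule arg_cong[of _ _ "\<lambda>f. right_action f A z"], rule ext, rule cpow_shift)
  also have "\<dots> = (\<Sum>i\<le>N. scaleC (of_nat (N choose i) * (- z) ^ (N - i)) 1 * right_action (cpow 0 i) A z)"
    by (rule right_action_linear[OF U z A' Rhol_cpow])
  also have "\<dots> = 0" using zero[OF _ z] N by (intro sum.neutral) auto
  finally show "right_action (cpow z N) A z = 0" .
qed

lemma coord_sum_scaleC:
  assumes "e \<in> alg_basis" shows "coord e (\<Sum>e'\<in>alg_basis. scaleC (c e') e') = c e"
proof -
  have "coord e (\<Sum>e'\<in>alg_basis. scaleC (c e') e') = (\<Sum>e'\<in>alg_basis. c e' * coord e e')"
    by (simp add: functional_sum[OF functional_coord] functional_scaleC[OF functional_coord])
  also have "\<dots> = (\<Sum>e'\<in>alg_basis. if e' = e then c e else 0)"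
    by (intro sum.cong refl) (simp add: coord_def Rvs.representation_basis[OF Rvs.independent_Basis])
  finally show ?thesis using assms by simp
qed

text \<open>An Ore condition: if composition with \<open>S\<close> is injective, then \<open>S\<close> and \<open>G\<close> have a common right
  multiple \<open>S A = G d\<close> with \<open>d \<noteq> 0\<close> a scalar operator. The coefficients of \<open>A\<close> and \<open>d\<close> solve a
  linear system over the holomorphic functions, which for large orders has more unknowns than
  equations; writing them to the right of the derivatives makes the system linear.\<close>

lemma common_right_multiple:
  fixes S G :: "'r::fin_dim_complex_algebra dop"
  assumes U: "open U" "connected U" "U \<noteq> {}" and S: "dop_on U S" and G: "dop_on U G"
    and inj: "\<And>A. analytic_dop U A \<Longrightarrow>
      (\<And>f z. Rhol U f \<Longrightarrow> z \<in> U \<Longrightarrow> right_action (right_action f S) A z = 0) \<Longrightarrow> A = dop_zero"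
  obtains A K c where "analytic_dop U A" "\<And>k. k < K \<Longrightarrow> c k holomorphic_on U"
    "\<exists>k<K. \<exists>z\<in>U. c k z \<noteq> 0"
    "dop_mult U S A = dop_mult U G (rdop U K (\<lambda>k z. scaleC (c k z) 1))"
proof -
  obtain nS where nS: "dop_supp S \<subseteq> {..<nS}" using dop_on_bound[OF S] .
  obtain nG where nG: "dop_supp G \<subseteq> {..<nG}" using dop_on_bound[OF G] .
  define n where "n = card (alg_basis :: 'r set)"
  \<comment> \<open>With \<open>n\<close> the dimension there are \<open>n * K + K'\<close> unknowns
    and \<open>n * M = n * K + n * nS + n\<close> equations, so \<open>K' > n * nS + n\<close> is
    enough. The extra summands \<open>nG\<close> in \<open>K\<close> and \<open>nS\<close> in
    \<open>K'\<close> give both compositions the same order bound \<open>M\<close>.\<close>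
  define K where "K = nG + n * nS + n + 1"
  define K' where "K' = nS + n * nS + n + 1"
  define M where "M = nS + Suc K"
  define I where "I = (alg_basis :: 'r set) \<times> {..<K} <+> {..<K'}"
  define J where "J = (alg_basis :: 'r set) \<times> {..<M}"
  define w where "w i j z = (case i of
       Inl (e, k) \<Rightarrow> (-1) ^ k * (Rderiv ^^ k) (right_action (cpow 0 j) S) z * e
     | Inr k \<Rightarrow> (-1) ^ k * (Rderiv ^^ k) (right_action (cpow 0 j) G) z)" for i :: "'r \<times> nat + nat" and j z
  define v where "v i = (\<lambda>(e', j) z. coord e' (w i j z))" for i
  have w: "Rhol U (w i j)" for i j
    unfolding w_def[abs_def]
    by (cases i)
      (auto intro!: Rhol_mult[OF Rhol_mult[OF Rhol_const Rhol_Rderiv_pow] Rhol_const]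
        Rhol_mult[OF Rhol_const Rhol_Rderiv_pow] Rhol_right_action Rhol_cpow U S G)
  have "v i j holomorphic_on U" for i j
    unfolding v_def by (cases j) (simp add: RholD[OF w functional_coord])
  moreover have "card J < card I"
    by (simp add: I_def J_def card_Plus card_cartesian_product n_def[symmetric] K_def K'_def M_def algebra_simps)
  moreover have "finite I" "finite J" by (auto simp: I_def J_def)
  ultimately obtain c where c: "\<forall>i\<in>I. c i holomorphic_on U" "\<exists>i\<in>I. \<exists>z\<in>U. c i z \<noteq> 0"
     "\<forall>j\<in>J. \<forall>z\<in>U. (\<Sum>i\<in>I. c i z * v i j z) = 0"
    using holomorphic_linear_dependence[OF U, of J I v] by blast
  \<comment> \<open>The sign turns the vanishing linear combination into an equality of the two
    compositions.\<close>
  define a where "a k z = - (\<Sum>e\<in>alg_basis. scaleC (c (Inl (e, k)) z) e)" for k z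
  define d where "d k z = scaleC (c (Inr k) z) (1 :: 'r)" for k z
  have a: "Rhol U (a k)" if "k < K" for k
    unfolding a_def[abs_def] using that c(1)
    by (intro Rhol_minus Rhol_sum Rhol_scaleC Rhol_const) (auto simp: I_def)
  have d: "Rhol U (d k)" if "k < K'" for k
    unfolding d_def[abs_def] using that c(1) by (intro Rhol_scaleC Rhol_const) (auto simp: I_def)
  let ?A = "rdop U K a" and ?d = "rdop U K' d"
  have A: "analytic_dop U ?A" "dop_on U ?A" and d': "analytic_dop U ?d" "dop_on U ?d"
    using analytic_dop_rdop[OF U(1)] a d analytic_dop_iff[OF U(1)] by blast+
  have SA: "analytic_dop U (dop_mult U S ?A)" "dop_on U (dop_mult U S ?A)"
    and Gd: "analytic_dop U (dop_mult U G ?d)" "dop_on U (dop_mult U G ?d)"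
    using analytic_dop_mult[OF U(1)] S G A d' dop_on_mult[OF U(1)] by blast+
  have "dop_supp (dop_mult U S ?A) \<subseteq> {..<M}"
    unfolding M_def by (rule dop_supp_dop_mult[OF nS dop_supp_rdop])
  moreover have "dop_supp (dop_mult U G ?d) \<subseteq> {..<nG + Suc K'}"
    by (rule dop_supp_dop_mult[OF nG dop_supp_rdop])
  then have "dop_supp (dop_mult U G ?d) \<subseteq> {..<M}"
    by (rule order_trans) (simp add: M_def K_def K'_def)
  ultimately have supp: "dop_supp (dop_diff (dop_mult U S ?A) (dop_mult U G ?d)) \<subseteq> {..<M}"
    by (intro order_trans[OF dop_supp_diff]) simp
  have "dop_diff (dop_mult U S ?A) (dop_mult U G ?d) = dop_zero"
  proof (rule analytic_dop_eq_zeroI_monomials[OF U(1) analytic_dop_diff[OF U(1) SA(1) Gd(1)] supp])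
    fix j z assume j: "j < M" and z: "z \<in> U"
    have "right_action (cpow 0 j) (dop_diff (dop_mult U S ?A) (dop_mult U G ?d)) z =
      right_action (right_action (cpow 0 j) S) ?A z - right_action (right_action (cpow 0 j) G) ?d z"
      by (simp add: right_action_diff[OF U(1) z SA(2) Gd(2) Rhol_cpow]
          right_action_dop_mult[OF U(1) z S A(2) Rhol_cpow] right_action_dop_mult[OF U(1) z G d'(2) Rhol_cpow])
    also have "right_action (right_action (cpow 0 j) S) ?A z =
        (\<Sum>k<K. (-1) ^ k * (Rderiv ^^ k) (right_action (cpow 0 j) S) z * a k z)"
      by (rule right_action_rdop[OF U(1) a U(1) subset_refl z Rhol_right_action[OF U(1) S Rhol_cpow]])
    also have "\<dots> = - (\<Sum>k<K. \<Sum>e\<in>alg_basis. scaleC (c (Inl (e, k)) z) (w (Inl (e, k)) j z))"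
      by (simp add: a_def w_def sum_distrib_left scaleC_mult_right sum_negf)
    also have "(\<Sum>k<K. \<Sum>e\<in>alg_basis. scaleC (c (Inl (e, k)) z) (w (Inl (e, k)) j z)) =
      (\<Sum>i\<in>alg_basis \<times> {..<K}. scaleC (c (Inl i) z) (w (Inl i) j z))"
      by (subst sum.swap) (simp add: sum.cartesian_product case_prod_unfold)
    also have "right_action (right_action (cpow 0 j) G) ?d z =
        (\<Sum>k<K'. (-1) ^ k * (Rderiv ^^ k) (right_action (cpow 0 j) G) z * d k z)"
      by (rule right_action_rdop[OF U(1) d U(1) subset_refl z Rhol_right_action[OF U(1) G Rhol_cpow]])
    also have "\<dots> = (\<Sum>k<K'. scaleC (c (Inr k) z) (w (Inr k) j z))"
      by (simp add: d_def w_def scaleC_mult_right)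
    also have "- (\<Sum>i\<in>alg_basis \<times> {..<K}. scaleC (c (Inl i) z) (w (Inl i) j z)) -
        (\<Sum>k<K'. scaleC (c (Inr k) z) (w (Inr k) j z)) = - (\<Sum>i\<in>I. scaleC (c i z) (w i j z))"
      unfolding I_def by (subst sum.Plus) simp_all
    also have "(\<Sum>i\<in>I. scaleC (c i z) (w i j z)) = 0"
    proof (rule coord_eqI)
      fix e :: 'r assume e: "e \<in> alg_basis"
      have "coord e (\<Sum>i\<in>I. scaleC (c i z) (w i j z)) = (\<Sum>i\<in>I. c i z * v i (e, j) z)"
        by (simp add: functional_sum[OF functional_coord] functional_scaleC[OF functional_coord] v_def)
      also have "\<dots> = 0" using c(3) e j z by (simp add: J_def)
      finally show "coord e (\<Sum>i\<in>I. scaleC (c i z) (w i j z)) = coord e 0"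
        by (simp add: functional_zero[OF functional_coord])
    qed
    finally show "right_action (cpow 0 j) (dop_diff (dop_mult U S ?A) (dop_mult U G ?d)) z = 0" by simp
  qed
  then have eq: "dop_mult U S ?A = dop_mult U G ?d" by (simp add: dop_diff_eq_zero_iff)
  have eq': "right_action (right_action f S) ?A z = right_action (right_action f G) ?d z"
    if "Rhol U f" "z \<in> U" for f z
    using eq right_action_dop_mult[OF U(1) that(2) S A(2) that(1)]
      right_action_dop_mult[OF U(1) that(2) G d'(2) that(1)] by simp
  \<comment> \<open>A nontrivial solution might have all its nonzero entries in \<open>A\<close>.
    Then \<open>S A = 0\<close>, and injectivity excludes this.\<close>
  have "\<exists>k<K'. \<exists>z\<in>U. c (Inr k) z \<noteq> 0"
  proof (rule ccontr)
    assume none: "\<not> (\<exists>k<K'. \<exists>z\<in>U. c (Inr k) z \<noteq> 0)"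
    then have d0: "d k z = 0" if "k < K'" "z \<in> U" for k z using that by (simp add: d_def scaleC_eq_0_iff)
    have "?A = dop_zero"
    proof (rule inj[OF A(1)])
      fix f :: "complex \<Rightarrow> 'r" and z assume f: "Rhol U f" and z: "z \<in> U"
      have "right_action (right_action f G) ?d z =
          (\<Sum>k<K'. (-1) ^ k * (Rderiv ^^ k) (right_action f G) z * d k z)"
        by (rule right_action_rdop[OF U(1) d U(1) subset_refl z Rhol_right_action[OF U(1) G f]])
      then show "right_action (right_action f S) ?A z = 0" using eq'[OF f z] d0[OF _ z] by simp
    qed
    then have a0: "a k z = 0" if "k < K" "z \<in> U" for k z
      using rdop_eq_zeroD[of U K a k z] U(1) a that by blast
    have "c (Inl (e, k)) z = 0" if "e \<in> alg_basis" "k < K" "z \<in> U" for e k z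
      using coord_sum_scaleC[OF that(1), of "\<lambda>e. c (Inl (e, k)) z"] a0[OF that(2,3)]
      by (simp add: a_def functional_zero[OF functional_coord])
    then show False using c(2) none by (auto simp: I_def)
  qed
  moreover have "c (Inr k) holomorphic_on U" if "k < K'" for k using c(1) that by (auto simp: I_def)
  ultimately show thesis
    using that[OF A(1), of K' "\<lambda>k. c (Inr k)"] eq unfolding d_def[abs_def] by blast
qed

text \<open>With \<open>p\<close> and \<open>l\<close> the top orders, testing on a power shows that
  \<open>c l\<close> times \<open>T p\<close> is zero. Since \<open>c l\<close> is scalar, it
  multiplies each coordinate of \<open>T p\<close> separately, and scalar holomorphic functions have
  no zero divisors.\<close>

lemma scalar_rdop_right_cancel:
  fixes T :: "'r::fin_dim_complex_algebra dop"
  assumes V: "open V" "connected V" and c: "\<And>k. k < K \<Longrightarrow> c k holomorphic_on V"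
    and c_ne: "\<exists>k<K. \<exists>z\<in>V. c k z \<noteq> 0"
    and U: "open U" "U \<subseteq> V" and T: "analytic_dop U T"
    and zero: "\<And>f z. Rhol U f \<Longrightarrow> z \<in> U \<Longrightarrow>
      right_action (right_action f T) (rdop V K (\<lambda>k z. scaleC (c k z) 1)) z = 0"
  shows "T = dop_zero"
proof (rule ccontr)
  assume ne: "T \<noteq> dop_zero"
  have T': "dop_on U T" "\<And>k t. t \<notin> U \<Longrightarrow> T k t = 0" using T analytic_dop_iff[OF U(1)] by blast+
  have fin: "finite (dop_supp T)" using T'(1) by (simp add: dop_on_def)
  have "dop_supp T \<noteq> {}" using ne by (auto simp: dop_supp_def dop_zero_def fun_eq_iff)
  define p where "p = Max (dop_supp T)"
  have p: "p \<in> dop_supp T" "dop_supp T \<subseteq> {..<Suc p}"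
    unfolding p_def using Max_in[OF fin \<open>dop_supp T \<noteq> {}\<close>] Max_ge[OF fin] by (auto simp: less_Suc_eq_le)
  then obtain z1 where z1: "T p z1 \<noteq> 0" by (auto simp: dop_supp_def)
  then have z1U: "z1 \<in> U" using T'(2) by blast
  obtain e where e: "coord e (T p z1) \<noteq> 0"
    using z1 by (metis coord_eqI functional_coord functional_zero)
  \<comment> \<open>Only values on \<open>V\<close> matter, so the order is the largest index whose
    coefficient is not identically zero there.\<close>
  define l where "l = Max {k. k < K \<and> (\<exists>z\<in>V. c k z \<noteq> 0)}"
  have l: "l < K" "\<exists>z\<in>V. c l z \<noteq> 0"
    using Max_in[of "{k. k < K \<and> (\<exists>z\<in>V. c k z \<noteq> 0)}"] c_ne unfolding l_def by auto
  have c0: "c k z = 0" if "k < K" "k > l" "z \<in> V" for k z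
    using Max_ge[of "{k. k < K \<and> (\<exists>z\<in>V. c k z \<noteq> 0)}" k] that unfolding l_def[symmetric] by force
  have cT: "c l z * coord e (T p z) = 0" if z: "z \<in> U" for z
  proof -
    \<comment> \<open>The exponent \<open>p + l\<close> removes all terms but the product of the
      leading coefficients: lower orders leave a zero of the power at \<open>z\<close>, and
      \<open>c k\<close> vanishes for \<open>k > l\<close>.\<close>
    have "0 = right_action (right_action (cpow z (p + l)) T) (rdop V K (\<lambda>k z. scaleC (c k z) 1)) z"
      using zero[OF Rhol_cpow z] by simp
    also have "\<dots> = (\<Sum>k<K. (-1) ^ k * (Rderiv ^^ k) (right_action (cpow z (p + l)) T) z * scaleC (c k z) 1)"
      by (rule right_action_rdop[OF V(1) _ U z Rhol_right_action[OF U(1) T'(1) Rhol_cpow]])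
        (intro Rhol_scaleC c Rhol_const)
    also have "\<dots> = (\<Sum>k<K. if k = l then (-1) ^ l * ((-1) ^ p * scaleC (fact (p + l)) (T p z)) * scaleC (c l z) 1 else 0)"
    proof (intro sum.cong refl)
      fix k assume "k \<in> {..<K}"
      then show "(-1) ^ k * (Rderiv ^^ k) (right_action (cpow z (p + l)) T) z * scaleC (c k z) 1 =
         (if k = l then (-1) ^ l * ((-1) ^ p * scaleC (fact (p + l)) (T p z)) * scaleC (c l z) 1 else 0)"
        using Rderiv_pow_right_action_cpow[OF U(1) z T'(1) p(2), of k l] c0[of k z] z U(2)
        by (cases k l rule: linorder_cases) (auto simp: scaleC_eq_0_iff)
    qed
    finally have "scaleC (c l z) (T p z) = 0"
      using l(1) by (simp add: mult.assoc minus_one_power_mult_eq_0_iff scaleC_mult_right scaleC_scaleC scaleC_eq_0_iff)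
    then have "c l z = 0 \<or> T p z = 0" by (simp add: scaleC_eq_0_iff)
    then show ?thesis by (auto simp: functional_zero[OF functional_coord])
  qed
  \<comment> \<open>\<open>U\<close> is not assumed connected, so the argument runs on a disc around
    \<open>z1\<close>, where the coordinate is not identically zero; connectedness of
    \<open>V\<close> then carries the vanishing of \<open>c l\<close> to all of
    \<open>V\<close>.\<close>
  obtain r where r: "r > 0" "ball z1 r \<subseteq> U" using U(1) z1U open_contains_ball by blast
  have cl0: "c l y = 0" if y: "y \<in> ball z1 r" for y
  proof (rule holomorphic_mult_eq_0[of "ball z1 r" "\<lambda>z. coord e (T p z)" "c l" z1])
    show "(\<lambda>z. coord e (T p z)) holomorphic_on ball z1 r"
      using RholD[OF dop_on_Rhol[OF T'(1)] functional_coord] r(2) holomorphic_on_subset by blast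
    show "c l holomorphic_on ball z1 r" using c[OF l(1)] r(2) U(2) holomorphic_on_subset by blast
    show "coord e (T p z) * c l z = 0" if "z \<in> ball z1 r" for z
      using cT[of z] r(2) that by (auto simp: mult.commute)
  qed (use e r y in auto)
  then have "c l z = 0" if "z \<in> V" for z
    using analytic_continuation_open[of "ball z1 r" V "c l" "\<lambda>_. 0" z] V c[OF l(1)] r U(2) that by auto
  then show False using l(2) by blast
qed

section \<open>The bispectral Darboux transformation\<close>

lemma right_action_mult_left:
  assumes "open U" "z \<in> U" "dop_on U B" "Rhol U f"
  shows "right_action (\<lambda>t. a * f t) B z = a * right_action f B z"
  using right_action_linear[OF assms(1-3), of "{()}" "\<lambda>_. f" "\<lambda>_. a"] assms(4) by simp

lemma right_action_diff_left:
  assumes "open U" "z \<in> U" "dop_on U B" "Rhol U f" "Rhol U g"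
  shows "right_action (\<lambda>t. f t - g t) B z = right_action f B z - right_action g B z"
  using right_action_linear[OF assms(1-3), of "{True, False}" "\<lambda>b. if b then f else g" "\<lambda>b. if b then 1 else -1"]
    assms(4,5) by simp

lemma left_action_mult_right:
  assumes "open U" "x \<in> U" "Rhol U f"
  shows "left_action A (\<lambda>t. f t * b) x = left_action A f x * b"
  by (simp add: left_action_def Rderiv_pow_mult_right[OF assms(1,3,2)] sum_distrib_right mult.assoc)

lemma left_action_zero: "left_action dop_zero f x = 0"
  by (simp add: left_action_def dop_supp_def dop_zero_def)

lemma right_action_zero: "right_action f dop_zero z = 0"
  by (simp add: right_action_def dop_supp_def dop_zero_def)

lemma dop_mult_fun_dop:
  assumes "x \<in> U" shows "dop_mult U (fun_dop f) A m x = f x * A m x"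
proof -
  have "{i. i \<le> (0::nat) \<and> 0 \<le> m + i} = {0}" by auto
  then show ?thesis
    by (subst dop_mult_eq[OF assms dop_supp_fun_dop]) (simp add: fun_dop_def)
qed

lemma dop_on_restrict: "dop_on V A \<Longrightarrow> U \<subseteq> V \<Longrightarrow> dop_on U (dop_restrict U A)"
  unfolding dop_on_def
proof (intro conjI allI)
  fix k assume "finite (dop_supp A) \<and> (\<forall>k. Rhol V (A k))" "U \<subseteq> V"
  then show "Rhol U (dop_restrict U A k)"
    using Rhol_subset[of V "A k" U] Rhol_cong[of U "dop_restrict U A k" "A k"]
    by (simp add: dop_restrict_def fun_restrict_def)
qed (auto simp: dop_supp_def dop_restrict_def fun_restrict_def elim!: finite_subset[rotated] split: if_splits)

lemma analytic_dop_restrict: "open U \<Longrightarrow> dop_on V A \<Longrightarrow> U \<subseteq> V \<Longrightarrow> analytic_dop U (dop_restrict U A)"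
  by (simp add: analytic_dop_iff dop_on_restrict) (simp add: dop_restrict_def fun_restrict_def)

lemma Rhol_eq_zero_continuation:
  assumes "open U" "U \<noteq> {}" "U \<subseteq> V" "open V" "connected V" "Rhol V f"
    and "\<And>t. t \<in> U \<Longrightarrow> f t = 0" and "t \<in> V"
  shows "f t = 0"
proof (rule functional_eqI)
  fix \<phi> :: "'a \<Rightarrow> complex" assume \<phi>: "functional \<phi>"
  show "\<phi> (f t) = \<phi> 0"
    using analytic_continuation_open[OF assms(1,4,2,5,3) RholD[OF assms(6) \<phi>] holomorphic_on_const[of 0]]
      assms(7,8) by (simp add: functional_zero[OF \<phi>])
qed

text \<open>Here \<open>S = b(P)\<close>, \<open>T = b(Q)\<close> and \<open>G = b(g)\<close>.\<close>

lemma dual_factorization: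
  fixes \<Psi> :: "complex \<Rightarrow> complex \<Rightarrow> 'r::fin_dim_complex_algebra"
  assumes \<Omega>\<^sub>1: "open \<Omega>\<^sub>1" "connected \<Omega>\<^sub>1" and \<Omega>\<^sub>2: "open \<Omega>\<^sub>2" "connected \<Omega>\<^sub>2"
    and \<Psi>: "Rhol2 \<Omega>\<^sub>1 \<Omega>\<^sub>2 \<Psi>"
    and nonsplit: "\<And>A. analytic_dop \<Omega>\<^sub>2 A \<Longrightarrow>
      (\<And>x z. x \<in> \<Omega>\<^sub>1 \<Longrightarrow> z \<in> \<Omega>\<^sub>2 \<Longrightarrow> dop_z \<Psi> A x z = 0) \<Longrightarrow> A = dop_zero"
    and Q: "dop_on \<Omega>\<^sub>1 Q" 
    and S: "dop_on \<Omega>\<^sub>2 S" and T: "dop_on \<Omega>\<^sub>2 T" and G: "dop_on \<Omega>\<^sub>2 G"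
    and PS: "\<And>x z. x \<in> \<Omega>\<^sub>1 \<Longrightarrow> z \<in> \<Omega>\<^sub>2 \<Longrightarrow> dop_x P \<Psi> x z = dop_z \<Psi> S x z"
    and QT: "\<And>x z. x \<in> \<Omega>\<^sub>1 \<Longrightarrow> z \<in> \<Omega>\<^sub>2 \<Longrightarrow> dop_x Q \<Psi> x z = dop_z \<Psi> T x z"
    and gG: "\<And>x z. x \<in> \<Omega>\<^sub>1 \<Longrightarrow> z \<in> \<Omega>\<^sub>2 \<Longrightarrow> g x * \<Psi> x z = dop_z \<Psi> G x z"
    and U\<^sub>1: "open U\<^sub>1" "U\<^sub>1 \<subseteq> \<Omega>\<^sub>1" "U\<^sub>1 \<noteq> {}" and gi: "Rhol U\<^sub>1 gi" "\<And>x. x \<in> U\<^sub>1 \<Longrightarrow> gi x * g x = 1"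
    and L: "\<And>x z. x \<in> U\<^sub>1 \<Longrightarrow> z \<in> \<Omega>\<^sub>2 \<Longrightarrow>
       left_action Q (\<lambda>t. gi t * dop_x P \<Psi> t z) x = \<Psi> x z * h z"
    and h: "Rhol \<Omega>\<^sub>2 h"
    and U\<^sub>2: "open U\<^sub>2" "U\<^sub>2 \<subseteq> \<Omega>\<^sub>2" "U\<^sub>2 \<noteq> {}" and hi: "Rhol U\<^sub>2 hi"
      "\<And>z. z \<in> U\<^sub>2 \<Longrightarrow> hi z * h z = 1"
    and f: "Rhol U\<^sub>2 f" and z: "z \<in> U\<^sub>2"
  shows "right_action f G z = right_action (\<lambda>t. right_action f S t * hi t) T z"
proof -
  define W where "W t s = gi t * \<Psi> t s" for t s
  \<comment> \<open>\<open>N\<close> is \<open>Q g\<^sup>-\<^sup>1 \<Psi>\<close>, considered for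
    \<open>x\<close> in \<open>U\<^sub>1\<close> only: a function on which both \<open>S\<close> and
    \<open>G\<close> act with known result.\<close>
  define N where "N = dop_x Q W"
  have Q1: "dop_on U\<^sub>1 Q" using Q U\<^sub>1(2) dop_on_subset by blast
  have \<Psi>1: "Rhol2 U\<^sub>1 \<Omega>\<^sub>2 \<Psi>" using \<Psi> U\<^sub>1(2) Rhol2_subset by blast
  have W: "Rhol2 U\<^sub>1 \<Omega>\<^sub>2 W" unfolding W_def[abs_def] by (rule Rhol2_mult[OF Rhol2_fst[OF gi(1)] \<Psi>1])
  have N: "Rhol2 U\<^sub>1 \<Omega>\<^sub>2 N" unfolding N_def by (rule Rhol2_dop_x[OF U\<^sub>1(1) \<Omega>\<^sub>2(1) Q1 W])
  have Nx: "Rhol \<Omega>\<^sub>2 (N x)" and \<Psi>x: "Rhol \<Omega>\<^sub>2 (\<Psi> x)" if "x \<in> U\<^sub>1" for x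
    using N \<Psi>1 that Rhol2_section_snd by blast+
  have WA: "dop_z W A x z = gi x * dop_z \<Psi> A x z" if "dop_on \<Omega>\<^sub>2 A" "x \<in> U\<^sub>1" "z \<in> \<Omega>\<^sub>2" for A x z
    unfolding dop_z_def W_def[abs_def] by (rule right_action_mult_left[OF \<Omega>\<^sub>2(1) that(3,1) \<Psi>x[OF that(2)]])
  have NS: "right_action (N x) S z = \<Psi> x z * h z" if x: "x \<in> U\<^sub>1" and z: "z \<in> \<Omega>\<^sub>2" for x z
  proof -
    have "right_action (N x) S z = dop_x Q (dop_z W S) x z"
      unfolding N_def dop_z_def[symmetric]
      by (rule dop_x_dop_z_commute[OF U\<^sub>1(1) \<Omega>\<^sub>2(1) W Q1 S x z, symmetric])
    also have "\<dots> = dop_x Q (\<lambda>t z. gi t * dop_x P \<Psi> t z) x z"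
      by (rule dop_x_cong[OF U\<^sub>1(1) x Q1]) (use WA[OF S _ z] PS[OF _ z] U\<^sub>1(2) in auto)
    also have "\<dots> = \<Psi> x z * h z" unfolding dop_x_def[of Q] by (rule L[OF x z])
    finally show ?thesis .
  qed
  have NG: "right_action (N x) G z = right_action (\<Psi> x) T z" if x: "x \<in> U\<^sub>1" and z: "z \<in> \<Omega>\<^sub>2" for x z
  proof -
    have "right_action (N x) G z = dop_x Q (dop_z W G) x z"
      unfolding N_def dop_z_def[symmetric]
      by (rule dop_x_dop_z_commute[OF U\<^sub>1(1) \<Omega>\<^sub>2(1) W Q1 G x z, symmetric])
    also have "\<dots> = dop_x Q \<Psi> x z"
      by (rule dop_x_cong[OF U\<^sub>1(1) x Q1])
        (use WA[OF G _ z] gG[OF _ z, symmetric] gi(2) U\<^sub>1(2) in \<open>auto simp: mult.assoc[symmetric]\<close>)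
    also have "\<dots> = right_action (\<Psi> x) T z"
      using QT[of x z] x z U\<^sub>1(2) by (auto simp: dop_z_def)
    finally show ?thesis .
  qed
  \<comment> \<open>Nonsplitness needs every \<open>x\<close> in \<open>\<Omega>\<^sub>1\<close>;
    the action on \<open>\<Psi>\<close> is analytic in \<open>x\<close>, so agreement on the
    nonempty open set \<open>U\<^sub>1\<close> extends.\<close>
  have faithful: "A = B" if A: "analytic_dop \<Omega>\<^sub>2 A" and B: "analytic_dop \<Omega>\<^sub>2 B"
    and eq: "\<And>x z. x \<in> U\<^sub>1 \<Longrightarrow> z \<in> \<Omega>\<^sub>2 \<Longrightarrow> right_action (\<Psi> x) A z = right_action (\<Psi> x) B z" for A B
  proof -
    have AB: "dop_on \<Omega>\<^sub>2 A" "dop_on \<Omega>\<^sub>2 B" using A B by (auto simp: analytic_dop_iff[OF \<Omega>\<^sub>2(1)])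
    have "dop_diff A B = dop_zero"
    proof (rule nonsplit[OF analytic_dop_diff[OF \<Omega>\<^sub>2(1) A B]])
      fix x z assume x: "x \<in> \<Omega>\<^sub>1" and z: "z \<in> \<Omega>\<^sub>2"
      have "Rhol \<Omega>\<^sub>1 (\<lambda>x. dop_z \<Psi> (dop_diff A B) x z)"
        by (rule Rhol2_section_fst[OF Rhol2_dop_z[OF \<Omega>\<^sub>1(1) \<Omega>\<^sub>2(1) dop_on_diff[OF AB] \<Psi>] z])
      then show "dop_z \<Psi> (dop_diff A B) x z = 0"
        by (rule Rhol_eq_zero_continuation[OF U\<^sub>1(1,3,2) \<Omega>\<^sub>1 _ _ x])
          (simp add: dop_z_def right_action_diff[OF \<Omega>\<^sub>2(1) z AB] \<Psi>x eq z)
    qed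
    then show ?thesis by (simp add: dop_diff_eq_zero_iff)
  qed
  have fh: "dop_on \<Omega>\<^sub>2 (fun_dop h)" using h by (simp add: dop_on_fun_dop)
  have hA: "right_action (right_action (N x) S) A z = right_action (\<Psi> x) (dop_mult \<Omega>\<^sub>2 (fun_dop h) A) z"
    if A: "dop_on \<Omega>\<^sub>2 A" and x: "x \<in> U\<^sub>1" and z: "z \<in> \<Omega>\<^sub>2" for A x z
  proof -
    have "right_action (right_action (N x) S) A z = right_action (right_action (\<Psi> x) (fun_dop h)) A z"
      by (rule right_action_cong[OF \<Omega>\<^sub>2(1) z _ A A]) (simp_all add: NS[OF x] right_action_fun_dop)
    then show ?thesis by (simp add: right_action_dop_mult[OF \<Omega>\<^sub>2(1) z fh A \<Psi>x[OF x]])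
  qed
  \<comment> \<open>Applied to \<open>N x\<close>, the hypothesis says that \<open>h A\<close>
    annihilates \<open>\<Psi>\<close>, so \<open>h A = 0\<close>. The inverse of \<open>h\<close>
    removes the factor on \<open>U\<^sub>2\<close>, and continuation gives \<open>A = 0\<close> on
    \<open>\<Omega>\<^sub>2\<close>.\<close>
  have inj: "A = dop_zero" if A: "analytic_dop \<Omega>\<^sub>2 A"
    and zero: "\<And>f z. Rhol \<Omega>\<^sub>2 f \<Longrightarrow> z \<in> \<Omega>\<^sub>2 \<Longrightarrow> right_action (right_action f S) A z = 0" for A
  proof -
    have A': "dop_on \<Omega>\<^sub>2 A" "\<And>k t. t \<notin> \<Omega>\<^sub>2 \<Longrightarrow> A k t = 0"
      using A by (auto simp: analytic_dop_iff[OF \<Omega>\<^sub>2(1)])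
    have zz: "analytic_dop \<Omega>\<^sub>2 dop_zero"
      by (simp add: analytic_dop_iff[OF \<Omega>\<^sub>2(1)] dop_on_def dop_supp_def dop_zero_def Rhol_const)
    have hA0: "dop_mult \<Omega>\<^sub>2 (fun_dop h) A = dop_zero"
    proof (rule faithful[OF analytic_dop_mult[OF \<Omega>\<^sub>2(1) fh A'(1)] zz])
      fix x z assume "x \<in> U\<^sub>1" "z \<in> \<Omega>\<^sub>2"
      then show "right_action (\<Psi> x) (dop_mult \<Omega>\<^sub>2 (fun_dop h) A) z = right_action (\<Psi> x) dop_zero z"
        using hA[OF A'(1), of x z] zero[OF Nx, of x z]
        by (simp add: right_action_zero)
    qed
    have A0: "A k z = 0" if z: "z \<in> U\<^sub>2" for k z
    proof -
      have "hi z * (h z * A k z) = 0"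
        using dop_mult_fun_dop[of z \<Omega>\<^sub>2 h A k] hA0 z U\<^sub>2(2) by (auto simp: dop_zero_def)
      then show ?thesis using hi(2)[OF z] by (simp add: mult.assoc[symmetric])
    qed
    have "A k z = 0" if "z \<in> \<Omega>\<^sub>2" for k z
      by (rule Rhol_eq_zero_continuation[OF U\<^sub>2(1,3,2) \<Omega>\<^sub>2 dop_on_Rhol[OF A'(1)] A0 that])
    then show ?thesis using A'(2) by (auto simp: dop_zero_def fun_eq_iff)
  qed
  have "\<Omega>\<^sub>2 \<noteq> {}" using U\<^sub>2 by auto
  obtain A K c where A: "analytic_dop \<Omega>\<^sub>2 A" and c: "\<And>k. k < K \<Longrightarrow> c k holomorphic_on \<Omega>\<^sub>2"
    "\<exists>k<K. \<exists>z\<in>\<Omega>\<^sub>2. c k z \<noteq> 0"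
    and SA: "dop_mult \<Omega>\<^sub>2 S A = dop_mult \<Omega>\<^sub>2 G (rdop \<Omega>\<^sub>2 K (\<lambda>k z. scaleC (c k z) 1))"
    by (rule common_right_multiple[OF \<Omega>\<^sub>2 \<open>\<Omega>\<^sub>2 \<noteq> {}\<close> S G]) (blast intro: inj, blast intro: that)
  let ?D = "rdop \<Omega>\<^sub>2 K (\<lambda>k z. scaleC (c k z) 1)"
  have "analytic_dop \<Omega>\<^sub>2 ?D" by (intro analytic_dop_rdop \<Omega>\<^sub>2(1) Rhol_scaleC c(1) Rhol_const)
  then have D: "dop_on \<Omega>\<^sub>2 ?D" and A': "dop_on \<Omega>\<^sub>2 A" using A by (auto simp: analytic_dop_iff[OF \<Omega>\<^sub>2(1)])
  \<comment> \<open>The set \<open>V\<close> is left open because the identity is applied to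
    \<open>N x\<close> on \<open>\<Omega>\<^sub>2\<close> and later to functions analytic only on
    \<open>U\<^sub>2\<close>.\<close>
  have SA': "right_action (right_action f S) A z = right_action (right_action f G) ?D z"
    if V: "open V" "V \<subseteq> \<Omega>\<^sub>2" "z \<in> V" and f: "Rhol V f" for V f z
    using right_action_dop_mult_subset[OF \<Omega>\<^sub>2(1) V S A' f]
      right_action_dop_mult_subset[OF \<Omega>\<^sub>2(1) V G D f] SA by simp
  \<comment> \<open>Tested on \<open>\<Psi>\<close>: passing to \<open>N\<close> turns
    \<open>T\<close> into \<open>G\<close>, the common multiple turns \<open>G\<close> followed by
    \<open>?D\<close> into \<open>S\<close> followed by \<open>A\<close>, and passing back turns
    \<open>S\<close> into \<open>h\<close>.\<close>
  have TD: "dop_mult \<Omega>\<^sub>2 T ?D = dop_mult \<Omega>\<^sub>2 (fun_dop h) A"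
  proof (rule faithful[OF analytic_dop_mult[OF \<Omega>\<^sub>2(1) T D] analytic_dop_mult[OF \<Omega>\<^sub>2(1) fh A']])
    fix x z assume x: "x \<in> U\<^sub>1" and z: "z \<in> \<Omega>\<^sub>2"
    have "right_action (\<Psi> x) (dop_mult \<Omega>\<^sub>2 T ?D) z = right_action (right_action (\<Psi> x) T) ?D z"
      by (rule right_action_dop_mult[OF \<Omega>\<^sub>2(1) z T D \<Psi>x[OF x]])
    also have "\<dots> = right_action (right_action (N x) G) ?D z"
      by (rule right_action_cong[OF \<Omega>\<^sub>2(1) z _ D D]) (simp_all add: NG[OF x])
    also have "\<dots> = right_action (\<Psi> x) (dop_mult \<Omega>\<^sub>2 (fun_dop h) A) z"
      using SA'[OF \<Omega>\<^sub>2(1) subset_refl z Nx[OF x]] hA[OF A' x z] by simp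
    finally show "right_action (\<Psi> x) (dop_mult \<Omega>\<^sub>2 T ?D) z
       = right_action (\<Psi> x) (dop_mult \<Omega>\<^sub>2 (fun_dop h) A) z" .
  qed
  have S2: "dop_on U\<^sub>2 S" and T2: "dop_on U\<^sub>2 T" and G2: "dop_on U\<^sub>2 G" and A2: "dop_on U\<^sub>2 A" and D2: "dop_on U\<^sub>2 ?D"
    using dop_on_subset[OF _ U\<^sub>2(2)] S T G A' D by blast+
  have fhi: "dop_on U\<^sub>2 (fun_dop hi)" using hi(1) by (simp add: dop_on_fun_dop)
  have hiT: "dop_on U\<^sub>2 (dop_mult U\<^sub>2 (fun_dop hi) T)" by (rule dop_on_mult[OF U\<^sub>2(1) fhi T2])
  \<comment> \<open>\<open>?E\<close> is \<open>b(P) h\<^sup>-\<^sup>1 b(Q)\<close>, formed on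
    \<open>U\<^sub>2\<close>; \<open>b(g)\<close> is cut off to the same set so that the two can be
    compared as coefficient sequences.\<close>
  let ?G = "dop_restrict U\<^sub>2 G" and ?E = "dop_mult U\<^sub>2 S (dop_mult U\<^sub>2 (fun_dop hi) T)"
  have G': "analytic_dop U\<^sub>2 ?G" by (rule analytic_dop_restrict[OF U\<^sub>2(1) G U\<^sub>2(2)])
  have E: "analytic_dop U\<^sub>2 ?E" by (rule analytic_dop_mult[OF U\<^sub>2(1) S2 hiT])
  have GE: "dop_on U\<^sub>2 ?G" "dop_on U\<^sub>2 ?E" using G' E by (auto simp: analytic_dop_iff[OF U\<^sub>2(1)])
  have Ef: "right_action f ?E z = right_action (\<lambda>t. right_action f S t * hi t) T z"
    if f: "Rhol U\<^sub>2 f" and z: "z \<in> U\<^sub>2" for f z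
    using right_action_dop_mult[OF U\<^sub>2(1) z S2 hiT f]
      right_action_dop_mult[OF U\<^sub>2(1) z fhi T2 Rhol_right_action[OF U\<^sub>2(1) S2 f]]
    by (simp add: right_action_fun_dop[abs_def])
  have Gf: "right_action f ?G z = right_action f G z" if "z \<in> U\<^sub>2" for f z
    by (rule right_action_cong[OF U\<^sub>2(1) that refl GE(1) G2]) (simp add: dop_restrict_def fun_restrict_def)
  \<comment> \<open>With \<open>F\<close> the result of letting \<open>S\<close> and then
    \<open>h\<^sup>-\<^sup>1\<close> act on \<open>f\<close>, the operator \<open>T ?D = h A\<close>
    takes \<open>F\<close> to the same function as \<open>S A\<close>, hence \<open>G ?D\<close>,
    takes \<open>f\<close>. So the difference composed with \<open>?D\<close> is zero, and
    \<open>?D\<close> can be cancelled.\<close>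
  have "dop_diff ?G ?E = dop_zero"
  proof (rule scalar_rdop_right_cancel[OF \<Omega>\<^sub>2 c U\<^sub>2(1,2) analytic_dop_diff[OF U\<^sub>2(1) G' E]])
    fix f :: "complex \<Rightarrow> 'r" and z assume f: "Rhol U\<^sub>2 f" and z: "z \<in> U\<^sub>2"
    define F where "F = (\<lambda>t. right_action f S t * hi t)"
    have fS: "Rhol U\<^sub>2 (right_action f S)" by (rule Rhol_right_action[OF U\<^sub>2(1) S2 f])
    have F: "Rhol U\<^sub>2 F" unfolding F_def by (rule Rhol_mult[OF fS hi(1)])
    have "right_action (right_action f (dop_diff ?G ?E)) ?D z =
        right_action (\<lambda>t. right_action f G t - right_action F T t) ?D z"
      by (rule right_action_cong[OF U\<^sub>2(1) z _ D2 D2])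
        (simp_all add: right_action_diff[OF U\<^sub>2(1) _ GE f] Gf Ef[OF f] F_def)
    also have "\<dots> = right_action (right_action f G) ?D z - right_action (right_action F T) ?D z"
      by (rule right_action_diff_left[OF U\<^sub>2(1) z D2 Rhol_right_action[OF U\<^sub>2(1) G2 f] Rhol_right_action[OF U\<^sub>2(1) T2 F]])
    also have "right_action (right_action F T) ?D z = right_action F (dop_mult \<Omega>\<^sub>2 (fun_dop h) A) z"
      using right_action_dop_mult_subset[OF \<Omega>\<^sub>2(1) U\<^sub>2(1,2) z T D F] TD by simp
    also have "\<dots> = right_action (right_action F (fun_dop h)) A z"
      by (rule right_action_dop_mult_subset[OF \<Omega>\<^sub>2(1) U\<^sub>2(1,2) z fh A' F])
    also have "\<dots> = right_action (right_action f S) A z"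
      by (rule right_action_cong[OF U\<^sub>2(1) z _ A2 A2])
        (simp_all add: right_action_fun_dop F_def mult.assoc hi(2))
    also have "\<dots> = right_action (right_action f G) ?D z" by (rule SA'[OF U\<^sub>2(1,2) z f])
    finally show "right_action (right_action f (dop_diff ?G ?E)) ?D z = 0" by simp
  qed
  then have "?G = ?E" by (simp add: dop_diff_eq_zero_iff)
  then show ?thesis using Gf[OF z, of f] Ef[OF f z] by simp
qed

lemma analytic_dop_zero: "open U \<Longrightarrow> analytic_dop U dop_zero"
  by (simp add: analytic_dop_iff dop_on_def dop_supp_def dop_zero_def Rhol_const)

theorem theorem1p1:
  fixes \<Psi> :: "complex \<Rightarrow> complex \<Rightarrow> 'r::fin_dim_complex_algebra"
    and \<Omega>\<^sub>1 \<Omega>\<^sub>2 :: "complex set"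
    and L P Q :: "'r dop" and g :: "complex \<Rightarrow> 'r"
  defines "b \<equiv> b_map \<Omega>\<^sub>1 \<Omega>\<^sub>2 \<Psi>"
    and "U\<^sub>1 \<equiv> inv_locus \<Omega>\<^sub>1 g"
    and "g_inv \<equiv> fun_dop (inv_fun \<Omega>\<^sub>1 g)"
    and "h \<equiv> b_map \<Omega>\<^sub>1 \<Omega>\<^sub>2 \<Psi> L 0"
    and "U\<^sub>2 \<equiv> inv_locus \<Omega>\<^sub>2 (b_map \<Omega>\<^sub>1 \<Omega>\<^sub>2 \<Psi> L 0)"
    and "h_inv \<equiv> fun_dop (inv_fun \<Omega>\<^sub>2 (b_map \<Omega>\<^sub>1 \<Omega>\<^sub>2 \<Psi> L 0))"
    and "\<Phi> \<equiv> dop_x P \<Psi>"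
  assumes "domain_set \<Omega>\<^sub>1" and "domain_set \<Omega>\<^sub>2"
    and "bispectral \<Omega>\<^sub>1 \<Omega>\<^sub>2 \<Psi>" and "nonsplit \<Omega>\<^sub>1 \<Omega>\<^sub>2 \<Psi>"
    and "L \<in> alg_A1 \<Omega>\<^sub>1 \<Omega>\<^sub>2 \<Psi>"
    and "P \<in> alg_B1 \<Omega>\<^sub>1 \<Omega>\<^sub>2 \<Psi>" and "Q \<in> alg_B1 \<Omega>\<^sub>1 \<Omega>\<^sub>2 \<Psi>"
    and "regular_in \<Omega>\<^sub>1 (alg_K1 \<Omega>\<^sub>1 \<Omega>\<^sub>2 \<Psi>) (fun_dop g)"
    and "U\<^sub>1 \<noteq> {}"
    and "dop_restrict U\<^sub>1 L = dop_mult U\<^sub>1 Q (dop_mult U\<^sub>1 g_inv P)"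
  shows "bispectral \<Omega>\<^sub>1 \<Omega>\<^sub>2 \<Phi> \<and>
    bispectral_by U\<^sub>1 U\<^sub>2 \<Phi>
      (dop_mult U\<^sub>1 P (dop_mult U\<^sub>1 Q g_inv)) (fun_restrict U\<^sub>2 h)
      (fun_restrict U\<^sub>1 g) (dop_mult U\<^sub>2 h_inv (dop_mult U\<^sub>2 (b Q) (b P))) \<and>
    (\<forall>x\<in>U\<^sub>1. \<forall>z\<in>\<Omega>\<^sub>2.
       dop_x (dop_mult U\<^sub>1 P (dop_mult U\<^sub>1 Q g_inv)) \<Phi> x z = \<Phi> x z * h z) \<and>
    (\<forall>x\<in>\<Omega>\<^sub>1. \<forall>z\<in>U\<^sub>2.
       g x * \<Phi> x z = dop_z \<Phi> (dop_mult U\<^sub>2 h_inv (dop_mult U\<^sub>2 (b Q) (b P))) x z)"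
proof -
  have \<Omega>\<^sub>1: "open \<Omega>\<^sub>1" "connected \<Omega>\<^sub>1" and \<Omega>\<^sub>2: "open \<Omega>\<^sub>2" "connected \<Omega>\<^sub>2"
    using assms(8,9) by (auto simp: domain_set_def)
  have \<Psi>: "Rhol2 \<Omega>\<^sub>1 \<Omega>\<^sub>2 \<Psi>"
    using assms(10) Ranalytic2_iff_Rhol2[OF \<Omega>\<^sub>1(1) \<Omega>\<^sub>2(1)] by (auto simp: bispectral_def bispectral_by_def)
  have nonsplit: "A = dop_zero" if "analytic_dop \<Omega>\<^sub>2 A"
    "\<And>x z. x \<in> \<Omega>\<^sub>1 \<Longrightarrow> z \<in> \<Omega>\<^sub>2 \<Longrightarrow> dop_z \<Psi> A x z = 0" for A
    using assms(11) that unfolding nonsplit_def by blast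
  \<comment> \<open>Two partners of one operator differ by an operator annihilating
    \<open>\<Psi>\<close>. This is what makes the description in \<open>b_map\<close> yield an
    actual partner.\<close>
  have uniq: "A = B" if i: "intertwined \<Omega>\<^sub>1 \<Omega>\<^sub>2 \<Psi> X A" "intertwined \<Omega>\<^sub>1 \<Omega>\<^sub>2 \<Psi> X B" for X A B
  proof -
    have an: "analytic_dop \<Omega>\<^sub>2 A" "analytic_dop \<Omega>\<^sub>2 B" using i by (auto simp: intertwined_def)
    have "dop_diff A B = dop_zero"
    proof (rule nonsplit[OF analytic_dop_diff[OF \<Omega>\<^sub>2(1) an]])
      fix x z assume "x \<in> \<Omega>\<^sub>1" "z \<in> \<Omega>\<^sub>2"
      then show "dop_z \<Psi> (dop_diff A B) x z = 0"
        using i an right_action_diff[OF \<Omega>\<^sub>2(1) \<open>z \<in> \<Omega>\<^sub>2\<close>, of A B "\<Psi> x"] Rhol2_section_snd[OF \<Psi>, of x]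
        by (simp add: intertwined_def dop_z_def analytic_dop_iff[OF \<Omega>\<^sub>2(1)])
    qed
    then show ?thesis by (simp add: dop_diff_eq_zero_iff)
  qed
  have b: "intertwined \<Omega>\<^sub>1 \<Omega>\<^sub>2 \<Psi> X (b X)" if X: "X \<in> alg_B1 \<Omega>\<^sub>1 \<Omega>\<^sub>2 \<Psi>" for X
  proof -
    obtain A where A: "intertwined \<Omega>\<^sub>1 \<Omega>\<^sub>2 \<Psi> X A" using X by (auto simp: alg_B1_def)
    show ?thesis unfolding b_def b_map_def by (rule theI[of _ A]) (use A uniq in blast)+
  qed
  define gi where "gi = inv_fun \<Omega>\<^sub>1 g"
  define hi where "hi = inv_fun \<Omega>\<^sub>2 h"
  have g_inv: "g_inv = fun_dop gi" and h_inv: "h_inv = fun_dop hi" and U\<^sub>2_eq: "U\<^sub>2 = inv_locus \<Omega>\<^sub>2 h"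
    by (simp_all add: g_inv_def gi_def h_inv_def hi_def h_def U\<^sub>2_def)
  have bP: "intertwined \<Omega>\<^sub>1 \<Omega>\<^sub>2 \<Psi> P (b P)" and bQ: "intertwined \<Omega>\<^sub>1 \<Omega>\<^sub>2 \<Psi> Q (b Q)"
    using b assms(13,14) by auto
  have "fun_dop g \<in> alg_B1 \<Omega>\<^sub>1 \<Omega>\<^sub>2 \<Psi>" using assms(15) by (simp add: regular_in_def alg_K1_def)
  then have bg: "intertwined \<Omega>\<^sub>1 \<Omega>\<^sub>2 \<Psi> (fun_dop g) (b (fun_dop g))" by (rule b)
  have bL: "intertwined \<Omega>\<^sub>1 \<Omega>\<^sub>2 \<Psi> L (b L)" and "b L \<in> range fun_dop"
    using b assms(12) by (auto simp: alg_A1_def alg_K2_def b_def)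
  then obtain h' where "b L = fun_dop h'" by auto
  moreover have "h = h'" using calculation by (simp add: h_def b_def fun_dop_def)
  ultimately have bL_eq: "b L = fun_dop h" by simp
  have P: "dop_on \<Omega>\<^sub>1 P" and Q: "dop_on \<Omega>\<^sub>1 Q" and L: "dop_on \<Omega>\<^sub>1 L" and g: "Rhol \<Omega>\<^sub>1 g"
    and S: "dop_on \<Omega>\<^sub>2 (b P)" and T: "dop_on \<Omega>\<^sub>2 (b Q)" and G: "dop_on \<Omega>\<^sub>2 (b (fun_dop g))" and h: "Rhol \<Omega>\<^sub>2 h"
    using bP bQ bg bL
    by (auto simp: intertwined_def analytic_dop_iff \<Omega>\<^sub>1 \<Omega>\<^sub>2 bL_eq dop_on_fun_dop)
  have PS: "dop_x P \<Psi> x z = dop_z \<Psi> (b P) x z"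
    and QT: "dop_x Q \<Psi> x z = dop_z \<Psi> (b Q) x z"
    and gG: "g x * \<Psi> x z = dop_z \<Psi> (b (fun_dop g)) x z"
    and Lh: "dop_x L \<Psi> x z = \<Psi> x z * h z" if "x \<in> \<Omega>\<^sub>1" "z \<in> \<Omega>\<^sub>2" for x z
    using bP bQ bg bL that unfolding intertwined_def bL_eq
    by (auto simp: dop_x_def left_action_fun_dop dop_z_def right_action_fun_dop)
  have U\<^sub>1: "open U\<^sub>1" "U\<^sub>1 \<subseteq> \<Omega>\<^sub>1" and U\<^sub>2: "open U\<^sub>2" "U\<^sub>2 \<subseteq> \<Omega>\<^sub>2"
    unfolding U\<^sub>1_def U\<^sub>2_eq using open_inv_locus \<Omega>\<^sub>1 \<Omega>\<^sub>2 g h by (auto simp: inv_locus_def)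
  have gi: "Rhol U\<^sub>1 gi" "\<And>x. x \<in> U\<^sub>1 \<Longrightarrow> gi x * g x = 1"
    unfolding U\<^sub>1_def gi_def using Rhol_inv_fun[OF \<Omega>\<^sub>1(1) g] inv_fun_mult by auto
  have hi: "Rhol U\<^sub>2 hi" "\<And>z. z \<in> U\<^sub>2 \<Longrightarrow> hi z * h z = 1"
    unfolding U\<^sub>2_eq hi_def using Rhol_inv_fun[OF \<Omega>\<^sub>2(1) h] inv_fun_mult by auto
  have P1: "dop_on U\<^sub>1 P" and Q1: "dop_on U\<^sub>1 Q" and L1: "dop_on U\<^sub>1 L" and gi1: "dop_on U\<^sub>1 (fun_dop gi)"
    using P Q L gi U\<^sub>1(2) dop_on_subset by (auto simp: dop_on_fun_dop)
  have S2: "dop_on U\<^sub>2 (b P)" and T2: "dop_on U\<^sub>2 (b Q)" and hi2: "dop_on U\<^sub>2 (fun_dop hi)"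
    using S T hi U\<^sub>2(2) dop_on_subset by (auto simp: dop_on_fun_dop)
  have \<Phi>: "Rhol2 \<Omega>\<^sub>1 \<Omega>\<^sub>2 \<Phi>" unfolding \<Phi>_def by (rule Rhol2_dop_x[OF \<Omega>\<^sub>1(1) \<Omega>\<^sub>2(1) P \<Psi>])
  \<comment> \<open>Here the factorization of \<open>L\<close> enters: applied to
    \<open>\<Psi>\<close>, it says that \<open>Q g\<^sup>-\<^sup>1\<close> takes
    \<open>\<Phi>\<close> back to \<open>\<Psi> h\<close>.\<close>
  have factor: "left_action Q (\<lambda>t. gi t * \<Phi> t z) x = \<Psi> x z * h z" if x: "x \<in> U\<^sub>1" and z: "z \<in> \<Omega>\<^sub>2" for x z
  proof -
    have \<psi>: "Rhol U\<^sub>1 (\<lambda>t. \<Psi> t z)"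
      using Rhol2_section_fst[OF \<Psi> z] U\<^sub>1(2) Rhol_subset by blast
    have "left_action L (\<lambda>t. \<Psi> t z) x = left_action (dop_restrict U\<^sub>1 L) (\<lambda>t. \<Psi> t z) x"
      by (rule left_action_cong[OF U\<^sub>1(1) x refl L1 dop_on_restrict[OF L1 subset_refl]])
        (use x in \<open>simp add: dop_restrict_def fun_restrict_def\<close>)
    also have "\<dots> = left_action Q (left_action (dop_mult U\<^sub>1 (fun_dop gi) P) (\<lambda>t. \<Psi> t z)) x"
      unfolding assms(17) g_inv
      by (rule left_action_dop_mult[OF U\<^sub>1(1) x Q1 dop_on_mult[OF U\<^sub>1(1) gi1 P1] \<psi>])
    also have "\<dots> = left_action Q (\<lambda>t. gi t * \<Phi> t z) x"
      by (rule left_action_cong[OF U\<^sub>1(1) x _ Q1 Q1])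
        (simp_all add: left_action_dop_mult[OF U\<^sub>1(1) _ gi1 P1 \<psi>] left_action_fun_dop \<Phi>_def dop_x_def)
    finally show ?thesis using Lh[of x z] x z U\<^sub>1(2) by (auto simp: dop_x_def)
  qed
  have eq1: "dop_x (dop_mult U\<^sub>1 P (dop_mult U\<^sub>1 Q g_inv)) \<Phi> x z = \<Phi> x z * h z"
    if x: "x \<in> U\<^sub>1" and z: "z \<in> \<Omega>\<^sub>2" for x z
  proof -
    have \<phi>: "Rhol U\<^sub>1 (\<lambda>t. \<Phi> t z)" and \<psi>: "Rhol U\<^sub>1 (\<lambda>t. \<Psi> t z)"
      using Rhol2_section_fst[OF \<Phi> z] Rhol2_section_fst[OF \<Psi> z] U\<^sub>1(2) Rhol_subset by blast+
    have "dop_x (dop_mult U\<^sub>1 P (dop_mult U\<^sub>1 Q g_inv)) \<Phi> x z =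
       left_action P (left_action (dop_mult U\<^sub>1 Q (fun_dop gi)) (\<lambda>t. \<Phi> t z)) x"
      unfolding dop_x_def g_inv
      by (rule left_action_dop_mult[OF U\<^sub>1(1) x P1 dop_on_mult[OF U\<^sub>1(1) Q1 gi1] \<phi>])
    also have "\<dots> = left_action P (\<lambda>t. \<Psi> t z * h z) x"
      by (rule left_action_cong[OF U\<^sub>1(1) x _ P1 P1])
        (simp_all add: left_action_dop_mult[OF U\<^sub>1(1) _ Q1 gi1 \<phi>] left_action_fun_dop[abs_def] factor[OF _ z])
    also have "\<dots> = \<Phi> x z * h z"
      unfolding left_action_mult_right[OF U\<^sub>1(1) x \<psi>] by (simp add: \<Phi>_def dop_x_def)
    finally show ?thesis .
  qed
  have eq2: "g x * \<Phi> x z = dop_z \<Phi> (dop_mult U\<^sub>2 h_inv (dop_mult U\<^sub>2 (b Q) (b P))) x z"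
    if x: "x \<in> \<Omega>\<^sub>1" and z: "z \<in> U\<^sub>2" for x z
  proof -
    have \<Psi>x: "Rhol U\<^sub>2 (\<Psi> x)" and \<Phi>x: "Rhol U\<^sub>2 (\<Phi> x)"
      using Rhol2_section_snd[OF \<Psi> x] Rhol2_section_snd[OF \<Phi> x] U\<^sub>2(2) Rhol_subset by blast+
    have \<Phi>_eq: "\<Phi> x t = right_action (\<Psi> x) (b P) t" if "t \<in> U\<^sub>2" for t
      using PS[OF x, of t] that U\<^sub>2(2) by (auto simp: \<Phi>_def dop_z_def)
    \<comment> \<open>The dual factorization is an identity of operators in \<open>z\<close>, so it
      may be tested on \<open>\<Psi> x\<close> for every \<open>x\<close> in
      \<open>\<Omega>\<^sub>1\<close>, including points where \<open>g x\<close> is not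
      invertible.\<close>
    have key: "g x * \<Psi> x t = right_action (right_action (\<Phi> x) (fun_dop hi)) (b Q) t" if t: "t \<in> U\<^sub>2" for t
    proof -
      have "g x * \<Psi> x t = right_action (\<Psi> x) (b (fun_dop g)) t"
        using gG[OF x, of t] t U\<^sub>2(2) by (auto simp: dop_z_def)
      also have "\<dots> = right_action (\<lambda>s. right_action (\<Psi> x) (b P) s * hi s) (b Q) t"
        by (rule dual_factorization[OF \<Omega>\<^sub>1 \<Omega>\<^sub>2 \<Psi> nonsplit Q S T G PS QT gG U\<^sub>1 assms(16) gi
              factor[unfolded \<Phi>_def] h U\<^sub>2 _ hi \<Psi>x t]) (use t in auto)
      also have "\<dots> = right_action (right_action (\<Phi> x) (fun_dop hi)) (b Q) t"
        by (rule right_action_cong[OF U\<^sub>2(1) t _ T2 T2]) (simp_all add: \<Phi>_eq right_action_fun_dop)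
      finally show ?thesis .
    qed
    \<comment> \<open>\<open>g x\<close> is constant in \<open>z\<close> and stands on the left, so
      it passes through the right action of \<open>b P\<close>.\<close>
    have "g x * \<Phi> x z = right_action (\<lambda>t. g x * \<Psi> x t) (b P) z"
      using right_action_mult_left[OF U\<^sub>2(1) z S2 \<Psi>x] \<Phi>_eq[OF z] by simp
    also have "\<dots> = right_action (right_action (right_action (\<Phi> x) (fun_dop hi)) (b Q)) (b P) z"
      by (rule right_action_cong[OF U\<^sub>2(1) z key S2 S2]) simp_all
    also have "\<dots> = dop_z \<Phi> (dop_mult U\<^sub>2 h_inv (dop_mult U\<^sub>2 (b Q) (b P))) x z"
      unfolding dop_z_def h_inv right_action_dop_mult[OF U\<^sub>2(1) z hi2 dop_on_mult[OF U\<^sub>2(1) T2 S2] \<Phi>x]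
      by (rule right_action_dop_mult[OF U\<^sub>2(1) z T2 S2 Rhol_right_action[OF U\<^sub>2(1) hi2 \<Phi>x], symmetric])
    finally show ?thesis .
  qed
  have restrict: "Ranalytic V (fun_restrict V f)" if "open V" "Rhol V' f" "V \<subseteq> V'" for V V' and f :: "complex \<Rightarrow> 'r"
  proof -
    have "Rhol V (fun_restrict V f)"
      using Rhol_subset[OF that(2,3)] Rhol_cong[of V "fun_restrict V f" f] by (simp add: fun_restrict_def)
    then show ?thesis by (simp add: Ranalytic_iff_Rhol[OF that(1)] fun_restrict_def)
  qed
  \<comment> \<open>Bispectrality as defined admits zero operators, so on \<open>\<Omega>\<^sub>1 \<times> \<Omega>\<^sub>2\<close> it is joint analyticity.\<close>
  have "bispectral_by \<Omega>\<^sub>1 \<Omega>\<^sub>2 \<Phi> dop_zero (\<lambda>_. 0) (\<lambda>_. 0) dop_zero"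
    unfolding bispectral_by_def
    using \<Phi> by (simp add: Ranalytic2_iff_Rhol2 Ranalytic_iff_Rhol Rhol_const analytic_dop_zero \<Omega>\<^sub>1 \<Omega>\<^sub>2
        dop_x_def left_action_zero dop_z_def right_action_zero)
  then have "bispectral \<Omega>\<^sub>1 \<Omega>\<^sub>2 \<Phi>" unfolding bispectral_def by blast
  moreover have "bispectral_by U\<^sub>1 U\<^sub>2 \<Phi>
      (dop_mult U\<^sub>1 P (dop_mult U\<^sub>1 Q g_inv)) (fun_restrict U\<^sub>2 h)
      (fun_restrict U\<^sub>1 g) (dop_mult U\<^sub>2 h_inv (dop_mult U\<^sub>2 (b Q) (b P)))"
    unfolding bispectral_by_def
  proof (intro conjI ballI)
    show "Ranalytic2 U\<^sub>1 U\<^sub>2 \<Phi>"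
      unfolding Ranalytic2_iff_Rhol2[OF U\<^sub>1(1) U\<^sub>2(1)] by (rule Rhol2_subset[OF \<Phi> U\<^sub>1(2) U\<^sub>2(2)])
    show "analytic_dop U\<^sub>1 (dop_mult U\<^sub>1 P (dop_mult U\<^sub>1 Q g_inv))"
      unfolding g_inv by (intro analytic_dop_mult dop_on_mult U\<^sub>1(1) P1 Q1 gi1)
    show "analytic_dop U\<^sub>2 (dop_mult U\<^sub>2 h_inv (dop_mult U\<^sub>2 (b Q) (b P)))"
      unfolding h_inv by (intro analytic_dop_mult dop_on_mult U\<^sub>2(1) S2 T2 hi2)
    show "Ranalytic U\<^sub>1 (fun_restrict U\<^sub>1 g)" by (rule restrict[OF U\<^sub>1(1) g U\<^sub>1(2)])
    show "Ranalytic U\<^sub>2 (fun_restrict U\<^sub>2 h)" by (rule restrict[OF U\<^sub>2(1) h U\<^sub>2(2)])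
    fix x z assume x: "x \<in> U\<^sub>1" and z: "z \<in> U\<^sub>2"
    show "dop_x (dop_mult U\<^sub>1 P (dop_mult U\<^sub>1 Q g_inv)) \<Phi> x z = \<Phi> x z * fun_restrict U\<^sub>2 h z"
      using eq1[OF x, of z] z U\<^sub>2(2) by (auto simp: fun_restrict_def)
    show "fun_restrict U\<^sub>1 g x * \<Phi> x z = dop_z \<Phi> (dop_mult U\<^sub>2 h_inv (dop_mult U\<^sub>2 (b Q) (b P))) x z"
      using eq2[OF _ z, of x] x U\<^sub>1(2) by (auto simp: fun_restrict_def)
  qed
  ultimately show ?thesis using eq1 eq2 by blast
qed

end
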